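(* Let $\Phi\in L^1_{\mathrm{pr}}(\Omega_T\times U;H)$ be such that $\mathbb E\int_0^T\int_U\|D_{t,x}\Phi(s,y)\|\,\nu(\mathrm dy)\,\mathrm ds<\infty$ for $\lambda\otimes\nu$-almost all $(t,x)\in[0,T]\times U$. Then the equality $$D_{t,x}\int_0^T\int_U\Phi(s,y)\,\tilde N(\mathrm ds,\mathrm dy)=\int_0^T\int_UD_{t,x}\Phi(s,y)\,\tilde N(\mathrm ds,\mathrm dy)+\Phi(t,x)$$ holds $\mathbb P_T\otimes\nu$-almost everywhere.
   Context: Setting: $T\in(0,\infty)$, $U$ is a separable real Hilbert space, $\nu$ is a $\sigma$-finite measure on $(U,\mathcal B(U))$, $\lambda$ is Lebesgue measure on $[0,T]$. $\mathbf N$ is the space of all $\sigma$-finite $\mathbb N_0\cup\{+\infty\}$-valued measures on $([0,T]\times U,\mathcal B([0,T]\times U))$ with the $\sigma$-algebra generated by the evaluations $\eta\mapsto\eta(B)$. $(\Omega,\mathcal F,\mathbb P)$ is a complete probability space, $N:\Omega\to\mathbf N$ is a Poisson random measure on $[0,T]\times U$ with intensity measure $\lambda\otimes\nu$, given as a random sum of Dirac measures $N=\sum_{n=1}^{N([0,T]\times U)}\delta_{X_n}$ with random variables $X_n$ in $[0,T]\times U$; $\mathcal F$ is the $\mathbb P$-completion of $\sigma(N)$; $\tilde N:=N-\lambda\otimes\nu$. $H$ is a separable real Hilbert space with inner product $\langle\cdot,\cdot\rangle$, norm $\|\cdot\|$. Filtration: $\mathcal F_t:=\bigcap_{u\in(t,T]}\mathcal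 F_{[0,u]\times U}$ for $t<T$ and $\mathcal F_T:=\mathcal F$, where $\mathcal F_{[0,u]\times U}$ is the $\mathbb P$-completion of the $\sigma$-algebra generated by $N(([0,u]\times U)\cap B)$, $B\in\mathcal B([0,T]\times U)$. $\Omega_T:=\Omega\times[0,T]$, $\mathbb P_T:=\mathbb P\otimes\lambda$, $\mathcal P_T$ is the predictable $\sigma$-algebra of $(\mathcal F_t)$, and $L^p_{\mathrm{pr}}(\Omega_T\times U;H):=L^p(\Omega_T\times U,\mathcal P_T\otimes\mathcal B(U),\mathbb P_T\otimes\nu;H)$. Difference operator ($L^0$ denotes equivalence classes of strongly measurable functions): for $F\in L^0(\Omega;H)$, $D_{t,x}F:=f(N+\delta_{(t,x)})-f(N)$, where $f:\mathbf N\to H$ is measurable with $F=f(N)$ a.s. For $\Phi\in L^0(\Omega_T\times U;H)$ with $\Phi(s,y)=\varphi(N,s,y)$ a.e., $\varphi$ measurable, $D_{t,x}\Phi(s,y):=\varphi(N+\delta_{(t,x)},s,y)-\varphi(N,s,y)$. These are a.e. independent of the representatives. Stochastic integral: for $p\in[1,2]$, $\Phi\mapsto\int_0^T\int_U\Phi(s,y)\,\tilde N(\mathrm ds,\mathrm dy)$ is the unique continuous linear map $L^p_{\mathrm{pr}}(\Omega_T\times U;H)\to L^p(\Omega;H)$ that sends $F\mathbf 1_{(r,s]\times B}$ to $F\,\tilde N((r,s]\times B)$ for $0\le r\le s\le T$, $F:\Omega\to H$ bounded and $\mathcal F_r$-measurable, $\nu(B)<\infty$; the maps for different $p$ agree on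 the intersection of their domains. For $\Phi\in L^p_{\mathrm{pr}}(\Omega_T\times U;H)$ the derivative $(\omega,s,y,t,x)\mapsto D_{t,x}\Phi(\omega,s,y)$ has a $\mathcal P_T\otimes\mathcal B(U)\otimes\mathcal B([0,T]\times U)$-measurable version; $\int_0^T\int_UD_{t,x}\Phi(s,y)\,\tilde N(\mathrm ds,\mathrm dy)$ denotes, for $\lambda\otimes\nu$-almost all $(t,x)$, the $L^1$-stochastic integral of this version, regarded as an element of $L^0([0,T]\times U;L^1(\Omega;H))\subset L^0(\Omega_T\times U;H)$ in the variable $(t,x)$. *)

theory Defs
  imports "HOL-Probability.Probability"
begin

text \<open>Elements of $L^0$ and $L^p$ are handled through representatives. Consequently an operator
  that is only determined up to null sets is a function on representatives, obtained by choosing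
  (with \<open>SOME\<close>) one of the representatives of its value; all statements about it are
  almost-everywhere statements.\<close>

section \<open>Point configurations and Poisson random measures\<close>

definition point_measures :: "'z measure \<Rightarrow> 'z measure set" where
  "point_measures E = {\<eta>. sets \<eta> = sets E \<and> sigma_finite_measure \<eta> \<and>
     (\<forall>B\<in>sets E. emeasure \<eta> B \<in> range of_nat \<union> {\<infinity>})}"

definition configurations :: "'z measure \<Rightarrow> 'z measure measure" where
  "configurations E = sigma (point_measures E)
     {{\<eta> \<in> point_measures E. emeasure \<eta> B \<in> C} | B C. B \<in> sets E \<and> C \<in> sets borel}"

definition add_point :: "'z measure \<Rightarrow> 'z \<Rightarrow> 'z measure" where
  "add_point \<eta> z = measure_of (space \<eta>) (sets \<eta>) (\<lambda>B. emeasure \<eta> B + emeasure (return \<eta> z) B)"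

definition poisson_random_measure :: "'w measure \<Rightarrow> 'z measure \<Rightarrow> ('w \<Rightarrow> 'z measure) \<Rightarrow> bool" where
  "poisson_random_measure M E N \<longleftrightarrow>
     N \<in> measurable M (configurations E) \<and>
     (\<forall>B\<in>sets E. emeasure E B < \<infinity> \<longrightarrow>
        (\<forall>k::nat. measure M {\<omega> \<in> space M. emeasure (N \<omega>) B = of_nat k} =
            exp (- measure E B) * measure E B ^ k / fact k)) \<and>
     (\<forall>B\<in>sets E. emeasure E B = \<infinity> \<longrightarrow> (AE \<omega> in M. emeasure (N \<omega>) B = \<infinity>)) \<and>
     (\<forall>(n::nat) B. (\<forall>i<n. B i \<in> sets E) \<and> disjoint_family_on B {..<n} \<longrightarrow>
        prob_space.indep_vars M (\<lambda>_. borel) (\<lambda>i \<omega>. emeasure (N \<omega>) (B i)) {..<n})"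

definition time_measure :: "real \<Rightarrow> real measure" where
  "time_measure T = restrict_space lborel {0..T}"

abbreviation intensity :: "real \<Rightarrow> 'u measure \<Rightarrow> (real \<times> 'u) measure" where
  "intensity T \<nu> \<equiv> time_measure T \<Otimes>\<^sub>M \<nu>"

abbreviation process_measure :: "'w measure \<Rightarrow> real \<Rightarrow> 'u measure \<Rightarrow> (('w \<times> real) \<times> 'u) measure" where
  "process_measure M T \<nu> \<equiv> (M \<Otimes>\<^sub>M time_measure T) \<Otimes>\<^sub>M \<nu>"

text \<open>The completion of \<open>G\<close> under the restriction of \<open>M\<close> to \<open>G\<close>. Adjoining all null sets of
  \<open>M\<close> instead would change predictable processes only on null sets, hence not the classes in
  $L^p_{\mathrm{pr}}$.\<close>

definition completed :: "'w measure \<Rightarrow> 'w measure \<Rightarrow> 'w measure" where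
  "completed M G = completion (restr_to_subalg M G)"

text \<open>The points \<open>X n\<close> are numbered from \<open>0\<close>, so that exactly those with
  \<open>n < N \<omega> ([0,T] \<times> U)\<close> are present in the configuration.\<close>

locale poisson_setting =
  prob_space M + complete_measure M + mark: sigma_finite_measure \<nu>
  for M :: "'w measure"
    and \<nu> :: "'u :: {real_inner, banach, second_countable_topology} measure" +
  fixes T :: real
    and N :: "'w \<Rightarrow> (real \<times> 'u) measure"
    and X :: "nat \<Rightarrow> 'w \<Rightarrow> real \<times> 'u"
  assumes T_pos: "0 < T"
    and sets_mark: "sets \<nu> = sets borel"
    and poisson: "poisson_random_measure M (intensity T \<nu>) N"
    and points_measurable: "\<And>n. X n \<in> measurable M (intensity T \<nu>)"
    and points: "\<And>\<omega> B. \<omega> \<in> space M \<Longrightarrow> B \<in> sets (intensity T \<nu>) \<Longrightarrow>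
        emeasure (N \<omega>) B =
          (\<Sum>n. if of_nat n < emeasure (N \<omega>) (space (intensity T \<nu>)) then indicator B (X n \<omega>) else 0)"
    and sets_generated:
      "sets M = sets (completed M (vimage_algebra (space M) N (configurations (intensity T \<nu>))))"


section \<open>Filtration and predictable integrands\<close>

definition observed :: "'w measure \<Rightarrow> 'z measure \<Rightarrow> ('w \<Rightarrow> 'z measure) \<Rightarrow> 'z set \<Rightarrow> 'w measure" where
  "observed M E N A = completed M (sigma (space M)
     {{\<omega> \<in> space M. emeasure (N \<omega>) (A \<inter> B) \<in> C} | B C. B \<in> sets E \<and> C \<in> sets borel})"

definition history :: "'w measure \<Rightarrow> real \<Rightarrow> 'u measure \<Rightarrow> ('w \<Rightarrow> (real \<times> 'u) measure) \<Rightarrow> real \<Rightarrow> 'w measure" where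
  "history M T \<nu> N t =
     (if t < T then sigma (space M) (\<Inter>u\<in>{t<..T}. sets (observed M (intensity T \<nu>) N ({0..u} \<times> UNIV)))
      else M)"

definition predictable ::
  "'w measure \<Rightarrow> real \<Rightarrow> 'u measure \<Rightarrow> ('w \<Rightarrow> (real \<times> 'u) measure) \<Rightarrow> ('w \<times> real) measure" where
  "predictable M T \<nu> N = sigma (space M \<times> {0..T})
     ({A \<times> {0} | A. A \<in> sets (history M T \<nu> N 0)} \<union>
      {A \<times> {r<..s} | A r s. 0 \<le> r \<and> r \<le> s \<and> s \<le> T \<and> A \<in> sets (history M T \<nu> N r)})"

definition p_moment :: "real \<Rightarrow> 'a measure \<Rightarrow> ('a \<Rightarrow> 'h::real_normed_vector) \<Rightarrow> ennreal" where
  "p_moment p M f = (\<integral>\<^sup>+ a. ennreal (norm (f a) powr p) \<partial>M)"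

definition Lp :: "real \<Rightarrow> 'a measure \<Rightarrow> ('a \<Rightarrow> 'h::real_normed_vector) set" where
  "Lp p M = {f \<in> borel_measurable M. p_moment p M f < \<infinity>}"

definition Lp_pr ::
  "real \<Rightarrow> 'w measure \<Rightarrow> real \<Rightarrow> 'u::topological_space measure \<Rightarrow> ('w \<Rightarrow> (real \<times> 'u) measure) \<Rightarrow>
   (('w \<times> real) \<times> 'u \<Rightarrow> 'h::real_normed_vector) set" where
  "Lp_pr p M T \<nu> N = {\<Phi> \<in> borel_measurable (predictable M T \<nu> N \<Otimes>\<^sub>M borel).
     p_moment p (process_measure M T \<nu>) \<Phi> < \<infinity>}"


section \<open>Stochastic integral\<close>

text \<open>Continuity with respect to the $L^p$ seminorms includes that the map respects
  almost-everywhere equality (take a constant sequence).\<close>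

definition is_stochastic_integral ::
  "real \<Rightarrow> 'w measure \<Rightarrow> real \<Rightarrow> 'u::topological_space measure \<Rightarrow> ('w \<Rightarrow> (real \<times> 'u) measure) \<Rightarrow>
   ((('w \<times> real) \<times> 'u \<Rightarrow> 'h::real_normed_vector) \<Rightarrow> 'w \<Rightarrow> 'h) \<Rightarrow> bool" where
  "is_stochastic_integral p M T \<nu> N I \<longleftrightarrow>
     (\<forall>\<Phi>\<in>Lp_pr p M T \<nu> N. I \<Phi> \<in> Lp p M) \<and>
     (\<forall>\<Phi>\<in>Lp_pr p M T \<nu> N. \<forall>\<Psi>\<in>Lp_pr p M T \<nu> N. \<forall>a b.
        AE \<omega> in M. I (\<lambda>\<zeta>. a *\<^sub>R \<Phi> \<zeta> + b *\<^sub>R \<Psi> \<zeta>) \<omega> = a *\<^sub>R I \<Phi> \<omega> + b *\<^sub>R I \<Psi> \<omega>) \<and>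
     (\<forall>\<Phi>s. \<forall>\<Phi>\<in>Lp_pr p M T \<nu> N. (\<forall>n. \<Phi>s n \<in> Lp_pr p M T \<nu> N) \<longrightarrow>
        (\<lambda>n. p_moment p (process_measure M T \<nu>) (\<lambda>\<zeta>. \<Phi>s n \<zeta> - \<Phi> \<zeta>)) \<longlonglongrightarrow> 0 \<longrightarrow>
        (\<lambda>n. p_moment p M (\<lambda>\<omega>. I (\<Phi>s n) \<omega> - I \<Phi> \<omega>)) \<longlonglongrightarrow> 0) \<and>
     (\<forall>r s F B. 0 \<le> r \<longrightarrow> r \<le> s \<longrightarrow> s \<le> T \<longrightarrow>
        F \<in> borel_measurable (history M T \<nu> N r) \<longrightarrow> bounded (F ` space M) \<longrightarrow>
        B \<in> sets borel \<longrightarrow> emeasure \<nu> B < \<infinity> \<longrightarrow>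
        (AE \<omega> in M. I (\<lambda>((\<omega>', t), x). indicator ({r<..s} \<times> B) (t, x) *\<^sub>R F \<omega>') \<omega> =
           (measure (N \<omega>) ({r<..s} \<times> B) - measure (intensity T \<nu>) ({r<..s} \<times> B)) *\<^sub>R F \<omega>))"

definition stochastic_integral ::
  "real \<Rightarrow> 'w measure \<Rightarrow> real \<Rightarrow> 'u::topological_space measure \<Rightarrow> ('w \<Rightarrow> (real \<times> 'u) measure) \<Rightarrow>
   (('w \<times> real) \<times> 'u \<Rightarrow> 'h::real_normed_vector) \<Rightarrow> 'w \<Rightarrow> 'h" where
  "stochastic_integral p M T \<nu> N = (SOME I. is_stochastic_integral p M T \<nu> N I)"


section \<open>Difference operator\<close>

definition difference ::
  "'w measure \<Rightarrow> 'z measure \<Rightarrow> ('w \<Rightarrow> 'z measure) \<Rightarrow> ('w \<Rightarrow> 'h::real_normed_vector) \<Rightarrow> 'z \<Rightarrow> 'w \<Rightarrow> 'h" where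
  "difference M E N F z \<omega> =
     (let f = (SOME f. f \<in> borel_measurable (configurations E) \<and> (AE \<omega> in M. F \<omega> = f (N \<omega>)))
      in f (add_point (N \<omega>) z) - f (N \<omega>))"

definition process_difference ::
  "'w measure \<Rightarrow> real \<Rightarrow> 'u measure \<Rightarrow> ('w \<Rightarrow> (real \<times> 'u) measure) \<Rightarrow>
   (('w \<times> real) \<times> 'u \<Rightarrow> 'h::real_normed_vector) \<Rightarrow> real \<times> 'u \<Rightarrow> ('w \<times> real) \<times> 'u \<Rightarrow> 'h" where
  "process_difference M T \<nu> N \<Phi> z = (\<lambda>((\<omega>, s), y).
     let \<phi> = (SOME \<phi>. \<phi> \<in> borel_measurable (configurations (intensity T \<nu>) \<Otimes>\<^sub>M intensity T \<nu>) \<and>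
                (AE ((\<omega>, s), y) in process_measure M T \<nu>. \<Phi> ((\<omega>, s), y) = \<phi> (N \<omega>, (s, y))))
     in \<phi> (add_point (N \<omega>) z, (s, y)) - \<phi> (N \<omega>, (s, y)))"

definition predictable_difference ::
  "'w measure \<Rightarrow> real \<Rightarrow> 'u::topological_space measure \<Rightarrow> ('w \<Rightarrow> (real \<times> 'u) measure) \<Rightarrow>
   (('w \<times> real) \<times> 'u \<Rightarrow> 'h::real_normed_vector) \<Rightarrow> real \<times> 'u \<Rightarrow> ('w \<times> real) \<times> 'u \<Rightarrow> 'h" where
  "predictable_difference M T \<nu> N \<Phi> =
     (SOME \<Psi>. (\<lambda>(\<zeta>, z). \<Psi> z \<zeta>) \<in> borel_measurable ((predictable M T \<nu> N \<Otimes>\<^sub>M borel) \<Otimes>\<^sub>M intensity T \<nu>) \<and>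
        (AE (\<zeta>, z) in process_measure M T \<nu> \<Otimes>\<^sub>M intensity T \<nu>.
           \<Psi> z \<zeta> = process_difference M T \<nu> N \<Phi> z \<zeta>))"

text \<open>The integral of the derivative is an element of $L^0([0,T]\times U; L^1(\Omega;H))$; it is
  regarded as an element of $L^0(\Omega_T\times U;H)$ through a jointly measurable version.\<close>

definition integral_of_difference ::
  "'w measure \<Rightarrow> real \<Rightarrow> 'u::topological_space measure \<Rightarrow> ('w \<Rightarrow> (real \<times> 'u) measure) \<Rightarrow>
   (('w \<times> real) \<times> 'u \<Rightarrow> 'h::real_normed_vector) \<Rightarrow> ('w \<times> real) \<times> 'u \<Rightarrow> 'h" where
  "integral_of_difference M T \<nu> N \<Phi> =
     (SOME J. J \<in> borel_measurable (process_measure M T \<nu>) \<and>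
        (AE (t, x) in intensity T \<nu>. AE \<omega> in M.
           J ((\<omega>, t), x) = stochastic_integral 1 M T \<nu> N (predictable_difference M T \<nu> N \<Phi> (t, x)) \<omega>))"

end

theory Submission
  imports Defs
begin

text \<open>
  The stochastic integral of an integrand in $L^1_{\mathrm{pr}}$ is an honest pathwise integral. A
  predictable $\Phi$ agrees, outside a null set of $\omega$ and at all times $t > 0$, with
  $\varphi(N(\omega), t, x)$ for some $\varphi$ whose value at time $t$ depends only on the points
  of the configuration strictly before $t$ (\<open>predictable_version\<close>). Set
  $g(\eta) = \int \varphi(\eta, z)\,\eta(dz) - \int \varphi(\eta, z)\,(\lambda \otimes \nu)(dz)$;
  then the stochastic integral of $\Phi$ is $g(N)$ almost surely.

  The commutation formula is now a computation with one configuration. Insert a point $z$: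
  \[ g(\eta + \delta_z) = \int \varphi(\eta + \delta_z, y)\,(\eta - \lambda \otimes \nu)(dy)
       + \varphi(\eta + \delta_z, z), \]
  and $\varphi(\eta + \delta_z, z) = \varphi(\eta, z)$ because $\varphi$ does not look at the
  present (\<open>canonical_add_present\<close>). Subtracting $g(\eta)$ leaves the compensated integral of
  $D_z\varphi$ plus $\varphi(\eta, z)$ (\<open>compensated_difference\<close>). The integrability hypothesis
  on $D\Phi$ is what allows the difference of the two integrals to be taken inside.

  All probabilistic input comes from the Mecke formula (theorem \<open>mecke\<close>)
  \[ E \int h(N, z)\,N(dz) = E \int h(N + \delta_z, z)\,(\lambda \otimes \nu)(dz). \]
  For canonical predictable $h$ the right-hand side is $E \int h(N, z)\,(\lambda \otimes \nu)(dz)$.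
  Hence $\Phi \mapsto g(N)$ is bounded from $L^1_{\mathrm{pr}}$ to $L^1$; it takes the prescribed
  values on elementary integrands, and a monotone class argument shows that these values determine
  it (\<open>integrals_agree\<close>). For $h(\eta, z) = 1_Z(\eta)$ the formula shows that $N + \delta_z$ avoids
  every set $Z$ that $N$ avoids almost surely, for almost all $z$ (\<open>AE_add_point\<close>); therefore the
  difference operators do not depend on the representatives that their definitions choose.

  The Mecke formula itself reduces, through independence on disjoint sets, to the identity
  $(m+1)\,P(N(B) = m+1) = \lambda\otimes\nu(B)\,P(N(B) = m)$ for Poisson counts.
\<close>

section \<open>Configurations and insertion of a point\<close>

lemma configuration_generator_subset:
  "{{\<eta> \<in> point_measures E. emeasure \<eta> B \<in> C} | B C. B \<in> sets E \<and> C \<in> sets borel}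
     \<subseteq> Pow (point_measures E)"
  by auto

lemma space_configurations: "space (configurations E) = point_measures E"
  unfolding configurations_def by (rule space_measure_of[OF configuration_generator_subset])

lemma sets_point_measure: "\<eta> \<in> point_measures E \<Longrightarrow> sets \<eta> = sets E"
  by (simp add: point_measures_def)

lemma space_point_measure: "\<eta> \<in> point_measures E \<Longrightarrow> space \<eta> = space E"
  by (rule sets_eq_imp_space_eq) (rule sets_point_measure)

lemma sets_config: "\<eta> \<in> space (configurations E) \<Longrightarrow> sets \<eta> = sets E"
  by (simp add: space_configurations sets_point_measure)

lemma space_config: "\<eta> \<in> space (configurations E) \<Longrightarrow> space \<eta> = space E"
  by (simp add: space_configurations space_point_measure)

lemma borel_measurable_config:
  "\<eta> \<in> space (configurations E) \<Longrightarrow> borel_measurable \<eta> = borel_measurable E"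
  by (rule measurable_cong_sets) (simp_all add: sets_config)

lemma emeasure_config_cases:
  assumes "\<eta> \<in> space (configurations E)" "B \<in> sets E"
  obtains k :: nat where "emeasure \<eta> B = of_nat k" | "emeasure \<eta> B = \<infinity>"
  using assms unfolding space_configurations point_measures_def by blast

lemma measurable_emeasure_config [measurable]:
  assumes "B \<in> sets E"
  shows "(\<lambda>\<eta>. emeasure \<eta> B) \<in> borel_measurable (configurations E)"
proof (rule measurableI)
  fix C :: "ennreal set" assume C: "C \<in> sets borel"
  have "(\<lambda>\<eta>. emeasure \<eta> B) -` C \<inter> space (configurations E)
    = {\<eta> \<in> point_measures E. emeasure \<eta> B \<in> C}"
    by (auto simp: space_configurations)
  also have "\<dots> \<in> sets (configurations E)"
    unfolding configurations_def using C assms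
    by (subst sets_measure_of[OF configuration_generator_subset]) (blast intro: sigma_sets.Basic)
  finally show "(\<lambda>\<eta>. emeasure \<eta> B) -` C \<inter> space (configurations E) \<in> sets (configurations E)" .
qed simp

lemma measurable_configurationsI:
  assumes "\<And>x. x \<in> space P \<Longrightarrow> \<kappa> x \<in> point_measures E"
    and "\<And>B. B \<in> sets E \<Longrightarrow> (\<lambda>x. emeasure (\<kappa> x) B) \<in> borel_measurable P"
  shows "\<kappa> \<in> measurable P (configurations E)"
  unfolding configurations_def
proof (rule measurable_measure_of[OF configuration_generator_subset])
  show "\<kappa> \<in> space P \<rightarrow> point_measures E" using assms(1) by auto
next
  fix y assume "y \<in> {{\<eta> \<in> point_measures E. emeasure \<eta> B \<in> C} | B C. B \<in> sets E \<and> C \<in> sets borel}"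
  then obtain B C where y: "y = {\<eta> \<in> point_measures E. emeasure \<eta> B \<in> C}" and "B \<in> sets E" "C \<in> sets borel"
    by auto
  moreover have "\<kappa> -` y \<inter> space P = (\<lambda>x. emeasure (\<kappa> x) B) -` C \<inter> space P"
    using assms(1) by (auto simp: y)
  ultimately show "\<kappa> -` y \<inter> space P \<in> sets P"
    using measurable_sets[OF assms(2)] by auto
qed

lemma space_add_point [simp]: "space (add_point \<eta> z) = space \<eta>"
  by (simp add: add_point_def)

lemma sets_add_point [simp, measurable_cong]: "sets (add_point \<eta> z) = sets \<eta>"
  by (simp add: add_point_def)

lemma emeasure_add_point:
  assumes "B \<in> sets \<eta>"
  shows "emeasure (add_point \<eta> z) B = emeasure \<eta> B + indicator B z"
proof -
  have "emeasure (add_point \<eta> z) B = emeasure \<eta> B + emeasure (return \<eta> z) B"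
    unfolding add_point_def
  proof (rule emeasure_measure_of_sigma)
    show "sigma_algebra (space \<eta>) (sets \<eta>)" ..
    show "positive (sets \<eta>) (\<lambda>B. emeasure \<eta> B + emeasure (return \<eta> z) B)"
      by (simp add: positive_def)
    show "countably_additive (sets \<eta>) (\<lambda>B. emeasure \<eta> B + emeasure (return \<eta> z) B)"
      unfolding countably_additive_def
    proof (intro allI impI)
      fix A :: "nat \<Rightarrow> 'a set"
      assume A: "range A \<subseteq> sets \<eta>" "disjoint_family A" "(\<Union>i. A i) \<in> sets \<eta>"
      have "(\<Sum>i. emeasure \<eta> (A i) + emeasure (return \<eta> z) (A i))
        = (\<Sum>i. emeasure \<eta> (A i)) + (\<Sum>i. emeasure (return \<eta> z) (A i))"
        by (rule suminf_add[symmetric]) auto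
      also have "\<dots> = emeasure \<eta> (\<Union>i. A i) + emeasure (return \<eta> z) (\<Union>i. A i)"
        using A(1,2) by (intro arg_cong2[where f="(+)"] suminf_emeasure) auto
      finally show "(\<Sum>i. emeasure \<eta> (A i) + emeasure (return \<eta> z) (A i))
        = emeasure \<eta> (\<Union>i. A i) + emeasure (return \<eta> z) (\<Union>i. A i)" .
    qed
    show "B \<in> sets \<eta>" by fact
  qed
  then show ?thesis using assms by simp
qed

lemma nn_integral_add_point:
  assumes z: "z \<in> space \<eta>" and f: "f \<in> borel_measurable \<eta>"
  shows "(\<integral>\<^sup>+ y. f y \<partial>add_point \<eta> z) = (\<integral>\<^sup>+ y. f y \<partial>\<eta>) + f z"
  using f
proof (induction rule: borel_measurable_induct)
  case (cong f g)
  have "(\<integral>\<^sup>+ y. f y \<partial>add_point \<eta> z) = (\<integral>\<^sup>+ y. g y \<partial>add_point \<eta> z)"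
    "(\<integral>\<^sup>+ y. f y \<partial>\<eta>) = (\<integral>\<^sup>+ y. g y \<partial>\<eta>)"
    using cong(3) by (auto intro!: nn_integral_cong)
  then show ?case using cong z by simp
next
  case (set A)
  then show ?case by (simp add: emeasure_add_point)
next
  case (mult f c)
  have "f \<in> borel_measurable (add_point \<eta> z)" using mult by (simp cong: measurable_cong_sets)
  then show ?case using mult by (simp add: nn_integral_cmult distrib_left)
next
  case (add f g)
  have "f \<in> borel_measurable (add_point \<eta> z)" "g \<in> borel_measurable (add_point \<eta> z)"
    using add by (simp_all cong: measurable_cong_sets)
  then show ?case using add by (simp add: nn_integral_add ac_simps)
next
  case (seq U)
  have U: "\<And>i. U i \<in> borel_measurable (add_point \<eta> z)" using seq by (simp cong: measurable_cong_sets)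
  have inc: "incseq (\<lambda>i. \<integral>\<^sup>+ y. U i y \<partial>\<eta>)" "incseq (\<lambda>i. U i z)"
    using seq(3) by (auto intro!: nn_integral_mono simp: incseq_def le_fun_def)
  have "(\<integral>\<^sup>+ y. (SUP i. U i) y \<partial>add_point \<eta> z) = (SUP i. \<integral>\<^sup>+ y. U i y \<partial>add_point \<eta> z)"
    using nn_integral_monotone_convergence_SUP[OF seq(3) U] by (simp add: image_comp)
  also have "\<dots> = (SUP i. (\<integral>\<^sup>+ y. U i y \<partial>\<eta>) + U i z)" using seq by simp
  also have "\<dots> = (SUP i. \<integral>\<^sup>+ y. U i y \<partial>\<eta>) + (SUP i. U i z)"
    by (rule ennreal_SUP_add) (use inc in auto)
  also have "(SUP i. \<integral>\<^sup>+ y. U i y \<partial>\<eta>) = (\<integral>\<^sup>+ y. (SUP i. U i) y \<partial>\<eta>)"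
    using nn_integral_monotone_convergence_SUP[OF seq(3) seq(1)] by (simp add: image_comp)
  finally show ?case by (simp add: image_comp)
qed

text \<open>The Bochner integral is approximated by simple functions simultaneously for \<open>\<eta>\<close> and for
  \<open>add_point \<eta> z\<close>: the dominating function stays integrable because the new point adds only
  the finite number \<open>norm (f z)\<close>.\<close>

lemma integral_add_point:
  fixes f :: "'z \<Rightarrow> 'h::{banach, second_countable_topology}"
  assumes z: "z \<in> space \<eta>" and f: "integrable \<eta> f"
  shows "integrable (add_point \<eta> z) f \<and> integral\<^sup>L (add_point \<eta> z) f = integral\<^sup>L \<eta> f + f z"
proof -
  have int: "integrable (add_point \<eta> z) g" if "integrable \<eta> g" for g :: "'z \<Rightarrow> 'h"
  proof (rule integrableI_bounded)
    have g: "g \<in> borel_measurable \<eta>" using that by simp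
    then show "g \<in> borel_measurable (add_point \<eta> z)" by (simp cong: measurable_cong_sets)
    have "(\<integral>\<^sup>+ y. ennreal (norm (g y)) \<partial>add_point \<eta> z)
        = (\<integral>\<^sup>+ y. ennreal (norm (g y)) \<partial>\<eta>) + ennreal (norm (g z))"
      by (rule nn_integral_add_point) (use z g in simp_all)
    then show "(\<integral>\<^sup>+ y. ennreal (norm (g y)) \<partial>add_point \<eta> z) < \<infinity>"
      using that by (simp add: integrable_iff_bounded)
  qed
  have "integral\<^sup>L (add_point \<eta> z) f = integral\<^sup>L \<eta> f + f z"
    using f
  proof (induction rule: integrable_induct)
    case (base A c)
    then have "measure (add_point \<eta> z) A = measure \<eta> A + indicator A z"
      by (auto simp: measure_def emeasure_add_point enn2real_plus split: split_indicator)
    moreover have "emeasure (add_point \<eta> z) A < \<infinity>"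
      using base by (auto simp: emeasure_add_point split: split_indicator)
    ultimately show ?case using base by (simp add: scaleR_add_left)
  next
    case (add f g)
    then show ?case using int[of f] int[of g] by (simp add: ac_simps)
  next
    case (lim f s)
    have z': "z \<in> space \<eta>" by fact
    have "(\<lambda>i. integral\<^sup>L (add_point \<eta> z) (s i)) \<longlonglongrightarrow> integral\<^sup>L (add_point \<eta> z) f"
    proof (rule integral_dominated_convergence[where w="\<lambda>x. 2 * norm (f x)"])
      show "f \<in> borel_measurable (add_point \<eta> z)" "\<And>i. s i \<in> borel_measurable (add_point \<eta> z)"
        using int[of f] int[of "s _"] lim by auto
      show "integrable (add_point \<eta> z) (\<lambda>x. 2 * norm (f x))" using int[of f] lim by auto
    qed (use lim in auto)
    moreover have "(\<lambda>i. integral\<^sup>L \<eta> (s i)) \<longlonglongrightarrow> integral\<^sup>L \<eta> f"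
      by (rule integral_dominated_convergence[where w="\<lambda>x. 2 * norm (f x)"]) (use lim in auto)
    then have "(\<lambda>i. integral\<^sup>L \<eta> (s i) + s i z) \<longlonglongrightarrow> integral\<^sup>L \<eta> f + f z"
      using lim(2)[OF z'] by (intro tendsto_add)
    ultimately show ?case using lim by (simp add: LIMSEQ_unique)
  qed
  with int[OF f] show ?thesis by simp
qed

lemma add_point_in_configurations:
  assumes \<eta>: "\<eta> \<in> space (configurations E)"
  shows "add_point \<eta> z \<in> space (configurations E)"
proof -
  have s: "sets \<eta> = sets E" using \<eta> by (rule sets_config)
  interpret sigma_finite_measure \<eta>
    using \<eta> by (simp add: space_configurations point_measures_def)
  have "sigma_finite_measure (add_point \<eta> z)"
  proof (rule sigma_finite_measure.intro)
    obtain A :: "nat \<Rightarrow> _" where A: "range A \<subseteq> sets \<eta>" "(\<Union>i. A i) = space \<eta>" "\<And>i. emeasure \<eta> (A i) \<noteq> \<infinity>"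
      using sigma_finite by blast
    then have "emeasure (add_point \<eta> z) (A i) \<noteq> \<infinity>" for i
      by (subst emeasure_add_point) (auto split: split_indicator)
    then show "\<exists>A. countable A \<and> A \<subseteq> sets (add_point \<eta> z) \<and> \<Union> A = space (add_point \<eta> z)
        \<and> (\<forall>a\<in>A. emeasure (add_point \<eta> z) a \<noteq> \<infinity>)"
      using A by (intro exI[of _ "range A"]) auto
  qed
  moreover have "emeasure (add_point \<eta> z) B \<in> range of_nat \<union> {\<infinity>}" if B: "B \<in> sets E" for B
  proof -
    have "emeasure (add_point \<eta> z) B = emeasure \<eta> B + indicator B z"
      using B s by (simp add: emeasure_add_point)
    also have "\<dots> \<in> range of_nat \<union> {\<infinity>}"
    proof (cases rule: emeasure_config_cases[OF \<eta> B])
      case (1 k)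
      then have "emeasure \<eta> B + indicator B z = of_nat (k + (if z \<in> B then 1 else 0))" by simp
      then show ?thesis by (metis UnCI rangeI)
    qed simp
    finally show ?thesis .
  qed
  ultimately show ?thesis using s by (simp add: space_configurations point_measures_def)
qed

lemma measurable_add_point [measurable]:
  "(\<lambda>(\<eta>, z). add_point \<eta> z) \<in> measurable (configurations E \<Otimes>\<^sub>M E) (configurations E)"
proof (rule measurable_configurationsI)
  fix x assume "x \<in> space (configurations E \<Otimes>\<^sub>M E)"
  then show "(case x of (\<eta>, z) \<Rightarrow> add_point \<eta> z) \<in> point_measures E"
    using add_point_in_configurations[of "fst x" E "snd x"]
    by (auto simp: space_pair_measure space_configurations)
next
  fix B assume [measurable]: "B \<in> sets E"
  have "(\<lambda>(\<eta>, z). emeasure \<eta> B + indicator B z) \<in> borel_measurable (configurations E \<Otimes>\<^sub>M E)"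
    by measurable
  also have "?this \<longleftrightarrow> (\<lambda>x. emeasure (case x of (\<eta>, z) \<Rightarrow> add_point \<eta> z) B) \<in> borel_measurable (configurations E \<Otimes>\<^sub>M E)"
    by (rule measurable_cong) (auto simp: space_pair_measure sets_config emeasure_add_point)
  finally show "(\<lambda>x. emeasure (case x of (\<eta>, z) \<Rightarrow> add_point \<eta> z) B) \<in> borel_measurable (configurations E \<Otimes>\<^sub>M E)" .
qed

section \<open>Measurable dependence of integrals on the configuration\<close>

text \<open>Configurations are only assumed \<open>\<sigma>\<close>-finite one by one, so they share no exhausting sequence
  of sets of finite mass. Those that are finite on the pieces of a fixed partition \<open>D\<close> do; almost
  every realisation of the random measure is of this kind.\<close>

locale exhaustion =
  fixes E :: "'z measure" and D :: "nat \<Rightarrow> 'z set"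
  assumes D_sets [measurable]: "\<And>m. D m \<in> sets E"
    and D_disjoint: "disjoint_family D"
    and D_union: "(\<Union>m. D m) = space E"
    and D_finite: "\<And>m. emeasure E (D m) < \<infinity>"
    and space_nonempty: "space E \<noteq> {}"
begin

definition locally_finite :: "'z measure \<Rightarrow> bool" where
  "locally_finite \<eta> \<longleftrightarrow> (\<forall>m. emeasure \<eta> (D m) < \<infinity>)"

definition cell :: "'z \<Rightarrow> nat" where
  "cell z = (LEAST m. z \<in> D m)"

lemma cell_eq: "z \<in> D m \<Longrightarrow> cell z = m"
  unfolding cell_def using D_disjoint
  by (intro Least_equality) (auto simp: disjoint_family_on_def, metis disjoint_iff le_eq_less_or_eq nat_le_linear)

lemma in_cell: "z \<in> space E \<Longrightarrow> z \<in> D (cell z)"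
  using D_union cell_eq by blast

lemma measurable_cell [measurable]: "cell \<in> measurable E (count_space UNIV)"
  unfolding cell_def by measurable

text \<open>A strictly positive function with integral at most $1$ against every locally finite
  configuration. Multiplying a configuration by it gives a subprobability measure, to which the
  theory of measurable kernels applies; dividing the integrand by it undoes the change.\<close>

definition weight :: "'z measure \<Rightarrow> 'z \<Rightarrow> real" where
  "weight \<eta> z = (1 / 2) ^ Suc (cell z) / (1 + measure \<eta> (D (cell z)))"

lemma weight_pos: "weight \<eta> z > 0"
  unfolding weight_def by (simp add: add_pos_nonneg)

text \<open>The null measure is a default value that makes this a kernel on all configurations.\<close>

definition normalized :: "'z measure \<Rightarrow> 'z measure" where
  "normalized \<eta> = (if locally_finite \<eta> then density \<eta> (\<lambda>z. ennreal (weight \<eta> z)) else null_measure E)"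

lemma measurable_locally_finite [measurable]:
  "Measurable.pred (configurations E) locally_finite"
  unfolding locally_finite_def by measurable

lemma locally_finite_add_point:
  assumes "\<eta> \<in> space (configurations E)" "locally_finite \<eta>"
  shows "locally_finite (add_point \<eta> z)"
  unfolding locally_finite_def
proof
  fix m
  have "emeasure (add_point \<eta> z) (D m) = emeasure \<eta> (D m) + indicator (D m) z"
    by (rule emeasure_add_point) (simp add: sets_config[OF assms(1)])
  then show "emeasure (add_point \<eta> z) (D m) < \<infinity>"
    using assms(2) by (auto simp: locally_finite_def split: split_indicator)
qed

lemma measurable_weight:
  assumes [measurable]: "\<kappa> \<in> measurable P (configurations E)"
  shows "(\<lambda>x. weight (\<kappa> (fst x)) (snd x)) \<in> borel_measurable (P \<Otimes>\<^sub>M E)"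
proof -
  have [measurable]: "(\<lambda>x. measure (\<kappa> (fst x)) (D m)) \<in> borel_measurable (P \<Otimes>\<^sub>M E)" for m
    unfolding measure_def by measurable
  show ?thesis
    unfolding weight_def
    by (rule measurable_compose_countable[where
          f="\<lambda>m x. (1 / 2) ^ Suc m / (1 + measure (\<kappa> (fst x)) (D m))" and g="\<lambda>x. cell (snd x)"])
       measurable
qed

lemma weight_measurable: "weight \<eta> \<in> borel_measurable E"
  unfolding weight_def by (rule measurable_compose_countable[where g=cell]) measurable

lemma emeasure_weight:
  assumes \<eta>: "\<eta> \<in> space (configurations E)" and A: "A \<in> sets E"
  shows "emeasure (density \<eta> (\<lambda>z. ennreal (weight \<eta> z))) A
    = (\<Sum>m. ennreal ((1 / 2) ^ Suc m / (1 + measure \<eta> (D m))) * emeasure \<eta> (A \<inter> D m))"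
proof -
  note [simp] = borel_measurable_config[OF \<eta>] sets_config[OF \<eta>]
  let ?c = "\<lambda>m. ennreal ((1 / 2) ^ Suc m / (1 + measure \<eta> (D m)))"
  have sp: "z \<in> space E" if "z \<in> space \<eta>" for z using that space_config[OF \<eta>] by simp
  have "emeasure (density \<eta> (\<lambda>z. ennreal (weight \<eta> z))) A
     = (\<integral>\<^sup>+ z. ennreal (weight \<eta> z) * indicator A z \<partial>\<eta>)"
    using A weight_measurable by (subst emeasure_density) auto
  also have "\<dots> = (\<integral>\<^sup>+ z. (\<Sum>m. ?c m * indicator (A \<inter> D m) z) \<partial>\<eta>)"
  proof (rule nn_integral_cong)
    fix z assume "z \<in> space \<eta>"
    then have z: "z \<in> D (cell z)" by (intro in_cell sp)
    have "(\<Sum>m. (?c m * indicator A z) * indicator (D m) z) = ?c (cell z) * indicator A z"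
      by (rule suminf_cmult_indicator[OF D_disjoint z])
    then show "ennreal (weight \<eta> z) * indicator A z = (\<Sum>m. ?c m * indicator (A \<inter> D m) z)"
      by (simp add: weight_def indicator_inter_arith mult.assoc)
  qed
  also have "\<dots> = (\<Sum>m. \<integral>\<^sup>+ z. ?c m * indicator (A \<inter> D m) z \<partial>\<eta>)"
    using A by (intro nn_integral_suminf) simp
  also have "\<dots> = (\<Sum>m. ?c m * emeasure \<eta> (A \<inter> D m))"
    using A by (subst nn_integral_cmult_indicator) simp_all
  finally show ?thesis .
qed

lemma subprob_space_normalized:
  assumes \<eta>: "\<eta> \<in> space (configurations E)"
  shows "subprob_space (normalized \<eta>)"
proof (cases "locally_finite \<eta>")
  case True
  have "emeasure (normalized \<eta>) (space E)
     = (\<Sum>m. ennreal ((1 / 2) ^ Suc m / (1 + measure \<eta> (D m))) * emeasure \<eta> (space E \<inter> D m))"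
    using True emeasure_weight[OF \<eta>] by (simp add: normalized_def)
  also have "\<dots> \<le> (\<Sum>m. ennreal ((1 / 2) ^ Suc m))"
  proof (rule suminf_le)
    fix m
    have "emeasure \<eta> (space E \<inter> D m) = emeasure \<eta> (D m)"
      using sets.sets_into_space[OF D_sets] by (metis inf.absorb2)
    also have "\<dots> = ennreal (measure \<eta> (D m))"
      using True by (intro emeasure_eq_ennreal_measure) (auto simp: locally_finite_def less_top)
    finally have *: "emeasure \<eta> (space E \<inter> D m) = ennreal (measure \<eta> (D m))" .
    have "(1 / 2) ^ Suc m / (1 + measure \<eta> (D m)) * measure \<eta> (D m) \<le> (1 / 2) ^ Suc m"
      by (simp add: field_simps add_pos_nonneg)
    then show "ennreal ((1 / 2) ^ Suc m / (1 + measure \<eta> (D m))) * emeasure \<eta> (space E \<inter> D m)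
        \<le> ennreal ((1 / 2) ^ Suc m)"
      unfolding * by (simp add: ennreal_mult[symmetric] del: power_Suc)
  qed auto
  also have "\<dots> = ennreal 1"
    by (rule suminf_ennreal_eq[OF _ power_half_series]) simp
  finally show ?thesis
    using True space_nonempty space_config[OF \<eta>]
    by (intro subprob_spaceI) (simp_all add: normalized_def)
next
  case False
  then show ?thesis using space_nonempty by (intro subprob_spaceI) (simp_all add: normalized_def)
qed

text \<open>The mass of \<open>A\<close> is a countable sum over the pieces, with coefficients that depend measurably
  on the configuration.\<close>

lemma measurable_normalized:
  assumes [measurable]: "\<kappa> \<in> measurable P (configurations E)"
  shows "(\<lambda>p. normalized (\<kappa> p)) \<in> measurable P (subprob_algebra E)"
proof (rule measurable_subprob_algebra)
  fix p assume "p \<in> space P"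
  then have \<kappa>: "\<kappa> p \<in> space (configurations E)" using assms by (rule measurable_space[rotated])
  show "subprob_space (normalized (\<kappa> p))" by (rule subprob_space_normalized[OF \<kappa>])
  show "sets (normalized (\<kappa> p)) = sets E" using sets_config[OF \<kappa>] by (simp add: normalized_def)
next
  fix A assume A [measurable]: "A \<in> sets E"
  have [measurable]: "(\<lambda>p. measure (\<kappa> p) (D m)) \<in> borel_measurable P" for m
    unfolding measure_def by measurable
  have "(\<lambda>p. if locally_finite (\<kappa> p) then
      (\<Sum>m. ennreal ((1 / 2) ^ Suc m / (1 + measure (\<kappa> p) (D m))) * emeasure (\<kappa> p) (A \<inter> D m)) else 0)
     \<in> borel_measurable P" by measurable
  also have "?this \<longleftrightarrow> (\<lambda>p. emeasure (normalized (\<kappa> p)) A) \<in> borel_measurable P"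
    using measurable_space[OF assms] A
    by (intro measurable_cong) (auto simp: normalized_def emeasure_weight simp del: power_Suc)
  finally show "(\<lambda>p. emeasure (normalized (\<kappa> p)) A) \<in> borel_measurable P" .
qed

lemma nn_integral_normalized:
  assumes \<eta>: "\<eta> \<in> space (configurations E)" and [measurable]: "h \<in> borel_measurable E"
  shows "(\<integral>\<^sup>+ z. ennreal (1 / weight \<eta> z) * h z \<partial>normalized \<eta>)
    = (if locally_finite \<eta> then \<integral>\<^sup>+ z. h z \<partial>\<eta> else 0)"
proof -
  note weight_measurable[measurable]
  have "weight \<eta> z * (1 / weight \<eta> z) = 1" for z
    using weight_pos[of \<eta> z] by simp
  then have "ennreal (weight \<eta> z) * (ennreal (1 / weight \<eta> z) * h z) = h z" for z
    using weight_pos[of \<eta> z] by (metis ennreal_1 ennreal_mult' less_imp_le mult.assoc mult_1)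
  then show ?thesis
    by (simp add: normalized_def nn_integral_density borel_measurable_config[OF \<eta>])
qed

text \<open>The integral against \<open>\<kappa> p\<close> equals that of the integrand divided by \<open>weight\<close>
  against the subprobability kernel \<open>normalized\<close>.\<close>

lemma borel_measurable_nn_integral_config:
  assumes \<kappa>: "\<kappa> \<in> measurable P (configurations E)"
    and h [measurable]: "(\<lambda>(p, z). h p z) \<in> borel_measurable (P \<Otimes>\<^sub>M E)"
  shows "(\<lambda>p. if locally_finite (\<kappa> p) then \<integral>\<^sup>+ z. h p z \<partial>\<kappa> p else 0) \<in> borel_measurable P"
proof -
  note measurable_weight[OF \<kappa>, measurable]
  have "(\<lambda>(p, z). ennreal (1 / weight (\<kappa> p) z) * h p z) \<in> borel_measurable (P \<Otimes>\<^sub>M E)"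
    unfolding case_prod_beta' by measurable
  from nn_integral_measurable_subprob_algebra2[OF this measurable_normalized[OF \<kappa>]]
  have "(\<lambda>p. \<integral>\<^sup>+ z. ennreal (1 / weight (\<kappa> p) z) * h p z \<partial>normalized (\<kappa> p)) \<in> borel_measurable P" .
  also have "?this \<longleftrightarrow> ?thesis"
  proof (rule measurable_cong)
    fix p assume p: "p \<in> space P"
    show "(\<integral>\<^sup>+ z. ennreal (1 / weight (\<kappa> p) z) * h p z \<partial>normalized (\<kappa> p))
      = (if locally_finite (\<kappa> p) then \<integral>\<^sup>+ z. h p z \<partial>\<kappa> p else 0)"
      by (rule nn_integral_normalized[OF measurable_space[OF \<kappa> p]]) (use p in measurable)
  qed
  finally show ?thesis .
qed

lemma borel_measurable_integral_config:
  fixes h :: "_ \<Rightarrow> _ \<Rightarrow> 'h::{banach, second_countable_topology}"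
  assumes \<kappa>: "\<kappa> \<in> measurable P (configurations E)"
    and h [measurable]: "(\<lambda>(p, z). h p z) \<in> borel_measurable (P \<Otimes>\<^sub>M E)"
  shows "(\<lambda>p. if locally_finite (\<kappa> p) then \<integral> z. h p z \<partial>\<kappa> p else 0) \<in> borel_measurable P"
proof -
  note measurable_weight[OF \<kappa>, measurable]
  note measurable_normalized[OF \<kappa>, measurable]
  note measurable_distr2[measurable]
  let ?g = "\<lambda>(p, z). (1 / weight (\<kappa> p) z) *\<^sub>R h p z"
  have g [measurable]: "?g \<in> borel_measurable (P \<Otimes>\<^sub>M E)"
    unfolding case_prod_beta' by measurable
  have "(\<lambda>p. integral\<^sup>L (distr (normalized (\<kappa> p)) (P \<Otimes>\<^sub>M E) (\<lambda>z. (p, z))) ?g) \<in> borel_measurable P"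
    by measurable
  also have "?this \<longleftrightarrow> ?thesis"
  proof (rule measurable_cong)
    fix p assume p [measurable]: "p \<in> space P"
    then have \<eta>: "\<kappa> p \<in> space (configurations E)" using \<kappa> by (rule measurable_space[rotated])
    have [measurable]: "h p \<in> borel_measurable E" using p by measurable
    note weight_measurable[measurable]
    have "integral\<^sup>L (distr (normalized (\<kappa> p)) (P \<Otimes>\<^sub>M E) (\<lambda>z. (p, z))) ?g
       = (\<integral>z. ?g (p, z) \<partial>normalized (\<kappa> p))"
    proof (rule integral_distr[OF _ g])
      have "sets (normalized (\<kappa> p)) = sets E" using sets_config[OF \<eta>] by (simp add: normalized_def)
      then show "Pair p \<in> measurable (normalized (\<kappa> p)) (P \<Otimes>\<^sub>M E)"
        by (simp cong: measurable_cong_sets)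
    qed
    also have "\<dots> = (if locally_finite (\<kappa> p) then \<integral> z. h p z \<partial>\<kappa> p else 0)"
      using weight_pos[of "\<kappa> p"]
      by (simp add: normalized_def integral_density borel_measurable_config[OF \<eta>] less_imp_le less_imp_neq[symmetric])
    finally show "integral\<^sup>L (distr (normalized (\<kappa> p)) (P \<Otimes>\<^sub>M E) (\<lambda>z. (p, z))) ?g
       = (if locally_finite (\<kappa> p) then \<integral> z. h p z \<partial>\<kappa> p else 0)" .
  qed
  finally show ?thesis .
qed

end

section \<open>Size-biased Poisson counts\<close>

lemma measurable_add_point' [measurable (raw)]:
  assumes "f \<in> measurable P (configurations E)" "g \<in> measurable P E"
  shows "(\<lambda>p. add_point (f p) (g p)) \<in> measurable P (configurations E)"
  using measurable_compose[OF measurable_Pair[OF assms] measurable_add_point] by simp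

sublocale exhaustion \<subseteq> sigma_finite_measure E
proof
  show "\<exists>A. countable A \<and> A \<subseteq> sets E \<and> \<Union> A = space E \<and> (\<forall>a\<in>A. emeasure E a \<noteq> \<infinity>)"
    using D_union D_finite by (intro exI[of _ "range D"]) (auto simp: less_top[symmetric])
qed

locale poisson_process = prob_space M + exhaustion E D
  for M :: "'w measure" and E :: "'z measure" and D :: "nat \<Rightarrow> 'z set" +
  fixes N :: "'w \<Rightarrow> 'z measure"
  assumes poisson: "poisson_random_measure M E N"
begin

lemma N_measurable [measurable]: "N \<in> measurable M (configurations E)"
  using poisson by (simp add: poisson_random_measure_def)

lemma N_space: "\<omega> \<in> space M \<Longrightarrow> N \<omega> \<in> space (configurations E)"
  by (rule measurable_space[OF N_measurable])

lemma count_cases: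
  assumes "\<omega> \<in> space M" "B \<in> sets E"
  obtains k :: nat where "emeasure (N \<omega>) B = of_nat k" | "emeasure (N \<omega>) B = \<infinity>"
  using emeasure_config_cases[OF N_space] assms by blast

lemma count_distribution:
  assumes "B \<in> sets E" "emeasure E B < \<infinity>"
  shows "measure M {\<omega> \<in> space M. emeasure (N \<omega>) B = of_nat k}
    = exp (- measure E B) * measure E B ^ k / fact k"
  using poisson assms by (auto simp: poisson_random_measure_def)

text \<open>The Poisson probabilities of the finite values already add up to $1$.\<close>

lemma count_finite_AE:
  assumes [measurable]: "B \<in> sets E" and fin: "emeasure E B < \<infinity>"
  shows "AE \<omega> in M. emeasure (N \<omega>) B < \<infinity>"
proof -
  let ?A = "\<lambda>k::nat. {\<omega> \<in> space M. emeasure (N \<omega>) B = of_nat k}"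
  have "(\<lambda>k. measure M (?A k)) sums measure M (\<Union>k. ?A k)"
    by (rule finite_measure_UNION) (auto simp: disjoint_family_on_def)
  moreover have "(\<lambda>k. measure M (?A k)) sums (exp (- measure E B) * exp (measure E B))"
    using sums_mult[OF exp_converges[of "measure E B"], of "exp (- measure E B)"]
    unfolding count_distribution[OF assms] by (simp add: field_simps)
  ultimately have "prob (\<Union>k. ?A k) = exp (- measure E B) * exp (measure E B)" by (rule sums_unique2)
  then have "prob (\<Union>k. ?A k) = 1" by (simp add: exp_add[symmetric])
  then have "AE \<omega> in M. \<omega> \<in> (\<Union>k. ?A k)" by (subst (asm) prob_eq_1) auto
  then show ?thesis by eventually_elim (auto simp: of_nat_less_top)
qed

lemma AE_locally_finite: "AE \<omega> in M. locally_finite (N \<omega>)"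
  unfolding locally_finite_def unfolding AE_all_countable using count_finite_AE[OF D_sets D_finite] by blast

text \<open>For \<open>x = m + 1\<close> this is $(m+1)\,e^{-\lambda}\lambda^{m+1}/(m+1)! =
  \lambda\,e^{-\lambda}\lambda^m/m!$. For every other \<open>x\<close> both sides vanish, since the count
  is almost surely a natural number.\<close>

lemma size_bias_count:
  assumes B [measurable]: "B \<in> sets E" and fin: "emeasure E B < \<infinity>"
  shows "x * emeasure M {\<omega> \<in> space M. emeasure (N \<omega>) B = x}
    = emeasure E B * emeasure M {\<omega> \<in> space M. emeasure (N \<omega>) B + 1 = x}"
proof -
  consider (0) "x = 0" | (Suc) m where "x = of_nat (Suc m)" | (inf) "x = \<infinity>"
    | (none) "x \<notin> range of_nat" "x \<noteq> \<infinity>"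
    by (metis not0_implies_Suc of_nat_0 rangeE)
  then show ?thesis
  proof cases
    case 0
    then show ?thesis by simp
  next
    case (Suc m)
    have eq: "{\<omega> \<in> space M. emeasure (N \<omega>) B + 1 = x} = {\<omega> \<in> space M. emeasure (N \<omega>) B = of_nat m}"
    proof (intro Collect_cong conj_cong refl)
      fix \<omega> assume "\<omega> \<in> space M"
      then show "(emeasure (N \<omega>) B + 1 = x) = (emeasure (N \<omega>) B = of_nat m)"
        unfolding Suc of_nat_Suc by (subst (1 2) add.commute) (simp add: ennreal_add_left_cancel)
    qed
    have e: "emeasure E B = ennreal (measure E B)"
      using fin by (intro emeasure_eq_ennreal_measure) auto
    have "real (Suc m) * (exp (- measure E B) * measure E B ^ Suc m / fact (Suc m))
      = measure E B * (exp (- measure E B) * measure E B ^ m / fact m)"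
      by (simp add: field_simps del: of_nat_Suc)
    then show ?thesis
      unfolding eq unfolding Suc emeasure_eq_measure count_distribution[OF B fin] e
      unfolding ennreal_of_nat_eq_real_of_nat
      by (subst (1 2) ennreal_mult[symmetric]) auto
  next
    case inf
    have "AE \<omega> in M. emeasure (N \<omega>) B \<noteq> \<infinity>" "AE \<omega> in M. emeasure (N \<omega>) B + 1 \<noteq> \<infinity>"
      using count_finite_AE[OF B fin] by (auto elim!: eventually_mono)
    then have "emeasure M {\<omega> \<in> space M. emeasure (N \<omega>) B = x} = 0"
      "emeasure M {\<omega> \<in> space M. emeasure (N \<omega>) B + 1 = x} = 0"
      unfolding inf by (auto intro!: emeasure_eq_0_AE)
    then show ?thesis by simp
  next
    case none
    have 1: "{\<omega> \<in> space M. emeasure (N \<omega>) B = x} = {}"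
      using none by (auto elim!: count_cases[OF _ B])
    have "emeasure (N \<omega>) B + 1 \<noteq> x" if "\<omega> \<in> space M" for \<omega>
    proof (cases rule: count_cases[OF that B])
      case (1 k)
      then have "emeasure (N \<omega>) B + 1 = of_nat (Suc k)" by simp
      then show ?thesis using none(1) by (metis rangeI)
    qed (use none in auto)
    then have 2: "{\<omega> \<in> space M. emeasure (N \<omega>) B + 1 = x} = {}" by auto
    show ?thesis unfolding 1 2 by simp
  qed
qed

text \<open>By independence both probabilities factorise, and they differ only in the factor of index
  \<open>j\<close>.\<close>

lemma size_bias_atom:
  fixes k :: "nat \<Rightarrow> ennreal"
  assumes P: "\<And>i. i < n \<Longrightarrow> P i \<in> sets E" and disj: "disjoint_family_on P {..<n}"
    and j: "j < n" and fin: "emeasure E (P j) < \<infinity>"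
  shows "k j * emeasure M {\<omega> \<in> space M. \<forall>i<n. emeasure (N \<omega>) (P i) = k i}
    = emeasure E (P j) * emeasure M {\<omega> \<in> space M. \<forall>i<n. emeasure (N \<omega>) (P i) + of_bool (i = j) = k i}"
proof -
  have ind: "indep_vars (\<lambda>_. borel) (\<lambda>i \<omega>. emeasure (N \<omega>) (P i)) {..<n}"
    using poisson P disj by (auto simp: poisson_random_measure_def)
  have prod: "emeasure M {\<omega> \<in> space M. \<forall>i<n. emeasure (N \<omega>) (P i) + d i = k i}
     = (\<Prod>i<n. emeasure M {\<omega> \<in> space M. emeasure (N \<omega>) (P i) + d i = k i})" for d :: "nat \<Rightarrow> ennreal"
  proof -
    let ?A = "\<lambda>i. {x. x + d i = k i}"
    have "prob (\<Inter>i\<in>{..<n}. (\<lambda>\<omega>. emeasure (N \<omega>) (P i)) -` ?A i \<inter> space M)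
      = (\<Prod>i\<in>{..<n}. prob ((\<lambda>\<omega>. emeasure (N \<omega>) (P i)) -` ?A i \<inter> space M))"
      by (rule indep_varsD_finite[OF ind]) (use j in auto)
    moreover have "(\<Inter>i\<in>{..<n}. (\<lambda>\<omega>. emeasure (N \<omega>) (P i)) -` ?A i \<inter> space M)
       = {\<omega> \<in> space M. \<forall>i<n. emeasure (N \<omega>) (P i) + d i = k i}" using j by auto
    moreover have "(\<lambda>\<omega>. emeasure (N \<omega>) (P i)) -` ?A i \<inter> space M
       = {\<omega> \<in> space M. emeasure (N \<omega>) (P i) + d i = k i}" for i by auto
    ultimately show ?thesis by (simp add: emeasure_eq_measure prod_ennreal)
  qed
  have split: "(\<Prod>i<n. f i) = f j * (\<Prod>i\<in>{..<n} - {j}. f i)" for f :: "nat \<Rightarrow> ennreal"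
    by (rule prod.remove) (use j in auto)
  show ?thesis
    using prod[of "\<lambda>_. 0"] prod[of "\<lambda>i. of_bool (i = j)"] size_bias_count[OF P[OF j] fin, of "k j"]
    by (simp add: split mult.assoc[symmetric])
qed

text \<open>The vector of counts takes countably many values, so the identity for single vectors is an
  equality of two discrete measures and extends to every set \<open>K\<close> of vectors.\<close>

lemma size_bias_partition:
  fixes P :: "nat \<Rightarrow> 'z set"
  assumes P: "\<And>i. i < n \<Longrightarrow> P i \<in> sets E" and disj: "disjoint_family_on P {..<n}"
    and j: "j < n" and fin: "emeasure E (P j) < \<infinity>"
  shows "(\<integral>\<^sup>+ \<omega>. emeasure (N \<omega>) (P j) * indicator K (\<lambda>i\<in>{..<n}. emeasure (N \<omega>) (P i)) \<partial>M)
    = emeasure E (P j) *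
        emeasure M {\<omega> \<in> space M. (\<lambda>i\<in>{..<n}. emeasure (N \<omega>) (P i) + of_bool (i = j)) \<in> K}"
proof -
  define R :: "ennreal set" where "R = range of_nat \<union> {\<infinity>}"
  define Tu where "Tu = PiE {..<n} (\<lambda>_. R)"
  have cnt: "countable Tu" unfolding Tu_def R_def by (intro countable_PiE) auto
  define V where "V d \<omega> = (\<lambda>i\<in>{..<n}. emeasure (N \<omega>) (P i) + of_nat (d i))" for d :: "nat \<Rightarrow> nat" and \<omega>
  note [measurable] = P
  have V_atom: "V d -` {a} \<inter> space M = {\<omega> \<in> space M. \<forall>i<n. emeasure (N \<omega>) (P i) + of_nat (d i) = a i}"
    if "a \<in> Tu" for a d
    using that unfolding V_def Tu_def by (auto simp: fun_eq_iff PiE_def extensional_def restrict_def)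
  have V_in: "V d \<omega> \<in> Tu" if "\<omega> \<in> space M" for d \<omega>
  proof -
    have "emeasure (N \<omega>) (P i) + of_nat (d i) \<in> R" if "i < n" for i
    proof (cases rule: count_cases[OF \<open>\<omega> \<in> space M\<close> P[OF that]])
      case (1 k)
      then have "emeasure (N \<omega>) (P i) + of_nat (d i) = of_nat (k + d i)" by simp
      then show ?thesis unfolding R_def by (metis UnI1 rangeI)
    qed (simp add: R_def)
    then show ?thesis by (auto simp: V_def Tu_def)
  qed
  have V_meas [measurable]: "V d \<in> measurable M (count_space Tu)" for d
    by (subst measurable_count_space_eq_countable[OF cnt]) (auto simp: V_atom V_in)
  define d where "d i = (if i = j then 1 else 0 :: nat)" for i
  let ?\<nu>1 = "distr (density M (\<lambda>\<omega>. emeasure (N \<omega>) (P j))) (count_space Tu) (V (\<lambda>_. 0))"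
  let ?\<nu>2 = "scale_measure (emeasure E (P j)) (distr M (count_space Tu) (V d))"
  have [measurable]: "(\<lambda>\<omega>. emeasure (N \<omega>) (P j)) \<in> borel_measurable M" using P[OF j] by measurable
  have \<nu>1: "emeasure ?\<nu>1 A = (\<integral>\<^sup>+ \<omega>. emeasure (N \<omega>) (P j) * indicator A (V (\<lambda>_. 0) \<omega>) \<partial>M)"
    if "A \<subseteq> Tu" for A
  proof -
    have [measurable]: "A \<in> sets (count_space Tu)" using that by simp
    have "emeasure ?\<nu>1 A = (\<integral>\<^sup>+ \<omega>. emeasure (N \<omega>) (P j) * indicator (V (\<lambda>_. 0) -` A \<inter> space M) \<omega> \<partial>M)"
      by (subst emeasure_distr) (auto intro!: emeasure_density simp: that)
    also have "\<dots> = (\<integral>\<^sup>+ \<omega>. emeasure (N \<omega>) (P j) * indicator A (V (\<lambda>_. 0) \<omega>) \<partial>M)"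
      by (intro nn_integral_cong) (auto split: split_indicator)
    finally show ?thesis .
  qed
  have \<nu>2: "emeasure ?\<nu>2 A = emeasure E (P j) * emeasure M (V d -` A \<inter> space M)" if "A \<subseteq> Tu" for A
    using that by (simp add: emeasure_distr)
  have "?\<nu>1 = ?\<nu>2"
  proof (rule measure_eqI_countable[OF _ _ cnt])
    fix a assume a: "a \<in> Tu"
    have "emeasure ?\<nu>1 {a} = (\<integral>\<^sup>+ \<omega>. a j * indicator (V (\<lambda>_. 0) -` {a} \<inter> space M) \<omega> \<partial>M)"
      using a j by (subst \<nu>1) (auto intro!: nn_integral_cong simp: V_def split: split_indicator)
    also have "\<dots> = a j * emeasure M (V (\<lambda>_. 0) -` {a} \<inter> space M)"
      using a by (intro nn_integral_cmult_indicator measurable_sets[OF V_meas]) auto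
    also have "\<dots> = emeasure E (P j) * emeasure M (V d -` {a} \<inter> space M)"
      using size_bias_atom[OF P disj j fin, of a] unfolding V_atom[OF a]
      by (simp add: d_def of_bool_def if_distrib[of of_nat])
    also have "\<dots> = emeasure ?\<nu>2 {a}" using a by (subst \<nu>2) auto
    finally show "emeasure ?\<nu>1 {a} = emeasure ?\<nu>2 {a}" .
  qed (simp_all)
  then have "emeasure ?\<nu>1 (K \<inter> Tu) = emeasure ?\<nu>2 (K \<inter> Tu)" by simp
  moreover have "emeasure ?\<nu>1 (K \<inter> Tu)
    = (\<integral>\<^sup>+ \<omega>. emeasure (N \<omega>) (P j) * indicator K (\<lambda>i\<in>{..<n}. emeasure (N \<omega>) (P i)) \<partial>M)"
    using V_in[of _ "\<lambda>_. 0"] by (subst \<nu>1) (auto intro!: nn_integral_cong simp: V_def split: split_indicator)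
  moreover have "V d -` (K \<inter> Tu) \<inter> space M
     = {\<omega> \<in> space M. (\<lambda>i\<in>{..<n}. emeasure (N \<omega>) (P i) + of_bool (i = j)) \<in> K}"
  proof -
    have "V d \<omega> = (\<lambda>i\<in>{..<n}. emeasure (N \<omega>) (P i) + of_bool (i = j))" for \<omega>
      by (auto simp: V_def d_def fun_eq_iff)
    then show ?thesis using V_in[of _ d] by auto
  qed
  ultimately show ?thesis by (subst (asm) \<nu>2) auto
qed

end

text \<open>The \<open>P j\<close> are the atoms of the algebra generated by finitely many sets; \<open>s j\<close> collects the
  indices of the sets that contain the atom \<open>P j\<close>.\<close>

lemma finite_partition_atoms:
  fixes B :: "nat \<Rightarrow> 'z set"
  assumes "\<And>i. i \<le> n \<Longrightarrow> B i \<in> sets E"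
  shows "\<exists>(m::nat) P s. (\<forall>j<m. P j \<in> sets E) \<and> disjoint_family_on P {..<m} \<and>
    (\<forall>i\<le>n. B i = (\<Union>j\<in>{j. j < m \<and> i \<in> s j}. P j)) \<and>
    (\<forall>i\<le>n. \<forall>j<m. \<forall>z\<in>P j. z \<in> B i \<longleftrightarrow> i \<in> s j)"
proof -
  obtain s where s: "bij_betw s {0..<card (Pow {..n})} (Pow {..n})"
    using ex_bij_betw_nat_finite[of "Pow {..n}"] by auto
  define m where "m = card (Pow {..n})"
  define P where "P j = {z \<in> space E. \<forall>i\<in>{..n}. z \<in> B i \<longleftrightarrow> i \<in> s j}" for j
  have s_ex: "\<exists>j<m. s j = I" if "I \<subseteq> {..n}" for I
  proof -
    have "I \<in> s ` {0..<m}" using s that by (simp add: bij_betw_def m_def)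
    then show ?thesis by auto
  qed
  have s_sub: "s j \<subseteq> {..n}" if "j < m" for j
    using bij_betwE[OF s] that by (auto simp: m_def)
  show ?thesis
  proof (rule exI[of _ m], rule exI[of _ P], rule exI[of _ s], intro conjI allI impI ballI)
    fix j assume "j < m"
    have "{z \<in> space E. z \<in> B i \<longleftrightarrow> i \<in> s j} \<in> sets E" if "i \<in> {..n}" for i
    proof -
      have [measurable]: "B i \<in> sets E" using assms that by simp
      show ?thesis by measurable
    qed
    then show "P j \<in> sets E" unfolding P_def by (intro sets.sets_Collect_finite_All) auto
  next
    show "disjoint_family_on P {..<m}"
      unfolding disjoint_family_on_def
    proof safe
      fix i j z assume ij: "i < m" "j < m" "i \<noteq> j" "z \<in> P i" "z \<in> P j"
      then have "s i = s j" using s_sub[of i] s_sub[of j] by (auto simp: P_def)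
      then show "z \<in> {}" using ij s by (auto simp: bij_betw_def m_def inj_on_def)
    qed
  next
    fix i assume i: "i \<le> n"
    show "B i = (\<Union>j\<in>{j. j < m \<and> i \<in> s j}. P j)"
    proof safe
      fix z assume z: "z \<in> B i"
      obtain j where "j < m" "s j = {i. i \<le> n \<and> z \<in> B i}" using s_ex[of "{i. i \<le> n \<and> z \<in> B i}"] by auto
      moreover have "z \<in> space E" using z assms[OF i] sets.sets_into_space by blast
      ultimately show "z \<in> (\<Union>j\<in>{j. j < m \<and> i \<in> s j}. P j)" using z i by (auto simp: P_def)
    qed (use i in \<open>auto simp: P_def\<close>)
  qed (auto simp: P_def)
qed

context poisson_process
begin

lemma add_point_count:
  "\<omega> \<in> space M \<Longrightarrow> B \<in> sets E \<Longrightarrow> emeasure (add_point (N \<omega>) z) B = emeasure (N \<omega>) B + indicator B z"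
  by (rule emeasure_add_point) (simp add: sets_config[OF N_space])

text \<open>The set \<open>A\<close> is a disjoint union of atoms common to \<open>A\<close> and all \<open>B i\<close>. A point
  inserted into one of these atoms raises the count of that atom by one and changes no other, and
  every \<open>B i\<close> is counted by summing over its atoms. So the claim is the size-bias identity,
  summed over the atoms inside \<open>A\<close>.\<close>

lemma mecke_cylinder:
  fixes B :: "nat \<Rightarrow> 'z set"
  assumes B: "\<And>i. i < n \<Longrightarrow> B i \<in> sets E" and A: "A \<in> sets E" and fin: "emeasure E A < \<infinity>"
  shows "(\<integral>\<^sup>+ \<omega>. emeasure (N \<omega>) A * of_bool (\<forall>i<n. emeasure (N \<omega>) (B i) = k i) \<partial>M)
    = (\<integral>\<^sup>+ \<omega>. \<integral>\<^sup>+ z. indicator A z * of_bool (\<forall>i<n. emeasure (add_point (N \<omega>) z) (B i) = k i) \<partial>E \<partial>M)"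
proof -
  \<comment> \<open>The set \<open>A\<close> is put last so that one family of atoms serves all sets.\<close>
  define B' where "B' i = (if i < n then B i else A)" for i
  have B'_sets: "\<And>i. i \<le> n \<Longrightarrow> B' i \<in> sets E" using B A by (simp add: B'_def)
  have "\<exists>(m::nat) P s. (\<forall>j<m. P j \<in> sets E) \<and> disjoint_family_on P {..<m} \<and>
    (\<forall>i\<le>n. B' i = (\<Union>j\<in>{j. j < m \<and> i \<in> s j}. P j)) \<and>
    (\<forall>i\<le>n. \<forall>j<m. \<forall>z\<in>P j. z \<in> B' i \<longleftrightarrow> i \<in> s j)"
    by (rule finite_partition_atoms) (rule B'_sets)
  then obtain m :: nat and P s where "\<forall>j<m. P j \<in> sets E" and disj: "disjoint_family_on P {..<m}"
    and "\<forall>i\<le>n. B' i = (\<Union>j\<in>{j. j < m \<and> i \<in> s j}. P j)"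
    and "\<forall>i\<le>n. \<forall>j<m. \<forall>z\<in>P j. z \<in> B' i \<longleftrightarrow> i \<in> s j"
    by (elim exE conjE) (rule that)
  then have P: "\<And>j. j < m \<Longrightarrow> P j \<in> sets E"
    and B': "\<And>i. i \<le> n \<Longrightarrow> B' i = (\<Union>j\<in>{j. j < m \<and> i \<in> s j}. P j)"
    and mem: "\<And>i j z. i \<le> n \<Longrightarrow> j < m \<Longrightarrow> z \<in> P j \<Longrightarrow> z \<in> B' i \<longleftrightarrow> i \<in> s j"
    by blast+
  define L where "L i = {j. j < m \<and> i \<in> s j}" for i
  define c where "c \<omega> l = emeasure (N \<omega>) (P l)" for \<omega> l
  define K where "K = {v :: nat \<Rightarrow> ennreal. \<forall>i<n. (\<Sum>l\<in>L i. v l) = k i}"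
  define C where "C d = {\<omega> \<in> space M. (\<lambda>l. c \<omega> l + d l) \<in> K}" for d
  define \<delta> where "\<delta> j l = (of_bool (l = j) :: ennreal)" for j l :: nat
  have Lm: "j \<in> L i \<Longrightarrow> j < m" for i j by (auto simp: L_def)
  have fL: "finite (L i)" for i using Lm by (intro finite_subset[of "L i" "{..<m}"]) auto
  have PL: "P j \<in> sets E" if "j \<in> L i" for i j using P Lm that by blast
  have A_UN: "A = (\<Union>j\<in>L n. P j)" using B'[of n] by (simp add: B'_def L_def)
  have dL: "disjoint_family_on P (L i)" for i using disj Lm by (auto simp: disjoint_family_on_def)
  have ind: "indicator A z = (\<Sum>j\<in>L n. indicator (P j) z :: ennreal)" for z
    unfolding A_UN by (rule indicator_UN_disjoint[OF fL dL])
  have fin_P: "emeasure E (P j) < \<infinity>" if "j \<in> L n" for j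
    using emeasure_mono[of "P j" A E] A_UN that fin A by (auto intro: le_less_trans)
  have count: "emeasure (N \<omega>) (B' i) = (\<Sum>j\<in>L i. c \<omega> j)" if "\<omega> \<in> space M" "i \<le> n" for \<omega> i
  proof -
    have "(\<Sum>j\<in>L i. c \<omega> j) = emeasure (N \<omega>) (\<Union>j\<in>L i. P j)"
      unfolding c_def using PL
      by (intro sum_emeasure dL fL) (auto simp: sets_config[OF N_space[OF that(1)]])
    then show ?thesis by (simp add: B'[OF that(2)] L_def)
  qed
  have B'n: "B' i = B i" if "i < n" for i using that by (simp add: B'_def)
  have before: "(\<forall>i<n. emeasure (N \<omega>) (B i) = k i) \<longleftrightarrow> c \<omega> \<in> K" if "\<omega> \<in> space M" for \<omega>
  proof -
    have "emeasure (N \<omega>) (B i) = (\<Sum>l\<in>L i. c \<omega> l)" if "i < n" for i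
      using count[OF \<open>\<omega> \<in> space M\<close>, of i] B'n that by simp
    then show ?thesis by (simp add: K_def)
  qed
  have after: "(\<forall>i<n. emeasure (add_point (N \<omega>) z) (B i) = k i) \<longleftrightarrow> \<omega> \<in> C (\<delta> j)"
    if \<omega>: "\<omega> \<in> space M" and j: "j < m" and z: "z \<in> P j" for \<omega> z j
  proof -
    have "emeasure (add_point (N \<omega>) z) (B i) = (\<Sum>l\<in>L i. c \<omega> l + \<delta> j l)" if i: "i < n" for i
    proof -
      have "emeasure (add_point (N \<omega>) z) (B i) = emeasure (N \<omega>) (B' i) + indicator (B' i) z"
        using add_point_count[OF \<omega> B[OF i]] B'n[OF i] by simp
      also have "indicator (B' i) z = (\<Sum>l\<in>L i. \<delta> j l)"
        using mem[of i j z] z j i fL by (auto simp: L_def \<delta>_def indicator_def of_bool_def)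
      finally show ?thesis using count[OF \<omega>, of i] i by (simp add: sum.distrib)
    qed
    then show ?thesis using \<omega> by (simp add: C_def K_def)
  qed
  have C_sets: "C d \<in> sets M" for d
  proof -
    have "{\<omega> \<in> space M. (\<Sum>l\<in>L i. c \<omega> l + d l) = k i} \<in> sets M" for i
    proof -
      have "(\<lambda>\<omega>. \<Sum>l\<in>L i. c \<omega> l + d l) \<in> borel_measurable M"
        unfolding c_def using PL
        by (intro borel_measurable_sum borel_measurable_add borel_measurable_const
            measurable_compose[OF N_measurable measurable_emeasure_config])
      from measurable_sets[OF this, of "{k i}"]
      show ?thesis by (simp add: vimage_def Int_def conj_commute)
    qed
    then have "{\<omega> \<in> space M. \<forall>i\<in>{..<n}. (\<Sum>l\<in>L i. c \<omega> l + d l) = k i} \<in> sets M"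
      by (rule sets.sets_Collect_finite_All) (rule finite_lessThan)
    then show ?thesis by (simp only: C_def K_def mem_Collect_eq Ball_def lessThan_iff)
  qed
  have restr: "(\<lambda>i\<in>{..<m}. v i) \<in> K \<longleftrightarrow> v \<in> K" for v
  proof -
    have "(\<Sum>l\<in>L i. (\<lambda>i\<in>{..<m}. v i) l) = (\<Sum>l\<in>L i. v l)" for i
      using Lm by (intro sum.cong) auto
    then show ?thesis by (simp add: K_def)
  qed
  have bias: "(\<integral>\<^sup>+ \<omega>. c \<omega> j * indicator (C (\<lambda>_. 0)) \<omega> \<partial>M) = emeasure E (P j) * emeasure M (C (\<delta> j))"
    if j: "j \<in> L n" for j
  proof -
    have "(\<integral>\<^sup>+ \<omega>. c \<omega> j * indicator (C (\<lambda>_. 0)) \<omega> \<partial>M)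
      = (\<integral>\<^sup>+ \<omega>. c \<omega> j * indicator K (\<lambda>i\<in>{..<m}. c \<omega> i) \<partial>M)"
      by (intro nn_integral_cong) (simp add: C_def restr indicator_def)
    also have "\<dots> = emeasure E (P j) * emeasure M (C (\<delta> j))"
      using size_bias_partition[OF P disj Lm[OF j] fin_P[OF j], of K]
      by (simp add: restr C_def \<delta>_def c_def)
    finally show ?thesis .
  qed
  have "(\<integral>\<^sup>+ \<omega>. emeasure (N \<omega>) A * of_bool (\<forall>i<n. emeasure (N \<omega>) (B i) = k i) \<partial>M)
    = (\<integral>\<^sup>+ \<omega>. (\<Sum>j\<in>L n. c \<omega> j * indicator (C (\<lambda>_. 0)) \<omega>) \<partial>M)"
    using count[of _ n]
    by (intro nn_integral_cong) (simp add: B'_def before C_def sum_distrib_right[symmetric] indicator_def of_bool_def)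
  also have "\<dots> = (\<Sum>j\<in>L n. \<integral>\<^sup>+ \<omega>. c \<omega> j * indicator (C (\<lambda>_. 0)) \<omega> \<partial>M)"
    unfolding c_def[abs_def] using PL C_sets
    by (intro nn_integral_sum borel_measurable_times_ennreal borel_measurable_indicator
        measurable_compose[OF N_measurable measurable_emeasure_config])
  also have "\<dots> = (\<Sum>j\<in>L n. \<integral>\<^sup>+ \<omega>. emeasure E (P j) * indicator (C (\<delta> j)) \<omega> \<partial>M)"
    by (intro sum.cong refl) (simp add: bias nn_integral_cmult_indicator[OF C_sets])
  also have "\<dots> = (\<integral>\<^sup>+ \<omega>. (\<Sum>j\<in>L n. emeasure E (P j) * indicator (C (\<delta> j)) \<omega>) \<partial>M)"
    using C_sets by (intro nn_integral_sum[symmetric]) simp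
  also have "\<dots> = (\<integral>\<^sup>+ \<omega>. \<integral>\<^sup>+ z. indicator A z * of_bool (\<forall>i<n. emeasure (add_point (N \<omega>) z) (B i) = k i) \<partial>E \<partial>M)"
  proof (rule nn_integral_cong)
    fix \<omega> assume \<omega>: "\<omega> \<in> space M"
    let ?hit = "\<lambda>z. of_bool (\<forall>i<n. emeasure (add_point (N \<omega>) z) (B i) = k i) :: ennreal"
    have "indicator A z * ?hit z = (\<Sum>j\<in>L n. indicator (C (\<delta> j)) \<omega> * indicator (P j) z)" for z
      unfolding ind sum_distrib_right
    proof (rule sum.cong[OF refl])
      fix j assume "j \<in> L n"
      then show "indicator (P j) z * ?hit z = indicator (C (\<delta> j)) \<omega> * indicator (P j) z"
        using after[OF \<omega> Lm, of j n z] by (cases "z \<in> P j") (simp_all add: indicator_def)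
    qed
    then have "(\<integral>\<^sup>+ z. indicator A z * ?hit z \<partial>E) = (\<integral>\<^sup>+ z. (\<Sum>j\<in>L n. indicator (C (\<delta> j)) \<omega> * indicator (P j) z) \<partial>E)"
      by simp
    also have "\<dots> = (\<Sum>j\<in>L n. \<integral>\<^sup>+ z. indicator (C (\<delta> j)) \<omega> * indicator (P j) z \<partial>E)"
      using PL by (intro nn_integral_sum) simp
    also have "\<dots> = (\<Sum>j\<in>L n. emeasure E (P j) * indicator (C (\<delta> j)) \<omega>)"
      by (intro sum.cong refl, subst nn_integral_cmult_indicator) (simp_all add: PL mult.commute)
    finally show "(\<Sum>j\<in>L n. emeasure E (P j) * indicator (C (\<delta> j)) \<omega>) = (\<integral>\<^sup>+ z. indicator A z * ?hit z \<partial>E)" ..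
  qed
  finally show ?thesis .
qed

end

section \<open>The Mecke formula\<close>

definition cylinders :: "'z measure \<Rightarrow> 'z measure set set" where
  "cylinders E = {{\<eta> \<in> space (configurations E). \<forall>i<n. emeasure \<eta> (B i) = k i} | n B k.
     \<forall>i<n::nat. B i \<in> sets E}"

lemma cylinders_sets: "Cy \<in> cylinders E \<Longrightarrow> Cy \<in> sets (configurations E)"
proof -
  assume "Cy \<in> cylinders E"
  then obtain n :: nat and B k where B: "\<forall>i<n. B i \<in> sets E"
    and Cy: "Cy = {\<eta> \<in> space (configurations E). \<forall>i<n. emeasure \<eta> (B i) = k i}"
    unfolding cylinders_def by auto
  have "{\<eta> \<in> space (configurations E). emeasure \<eta> (B i) = k i} \<in> sets (configurations E)" if "i \<in> {..<n}" for i
  proof -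
    have [measurable]: "B i \<in> sets E" using B that by simp
    show ?thesis by measurable
  qed
  then have "{\<eta> \<in> space (configurations E). \<forall>i\<in>{..<n}. emeasure \<eta> (B i) = k i} \<in> sets (configurations E)"
    by (rule sets.sets_Collect_finite_All) (assumption, rule finite_lessThan)
  then show ?thesis by (simp only: Cy Ball_def lessThan_iff)
qed

lemma cylinders_Int:
  assumes "a \<in> cylinders E" "b \<in> cylinders E"
  shows "a \<inter> b \<in> cylinders E"
proof -
  obtain n :: nat and B k where B: "\<forall>i<n. B i \<in> sets E"
    and a: "a = {\<eta> \<in> space (configurations E). \<forall>i<n. emeasure \<eta> (B i) = k i}"
    using assms(1) unfolding cylinders_def by auto
  obtain m :: nat and C l where C: "\<forall>i<m. C i \<in> sets E"
    and b: "b = {\<eta> \<in> space (configurations E). \<forall>i<m. emeasure \<eta> (C i) = l i}"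
    using assms(2) unfolding cylinders_def by auto
  define F where "F i = (if i < n then B i else C (i - n))" for i
  define h where "h i = (if i < n then k i else l (i - n))" for i
  have F: "\<forall>i<n + m. F i \<in> sets E" using B C by (auto simp: F_def)
  have "(\<forall>i<n + m. emeasure \<eta> (F i) = h i) \<longleftrightarrow>
      (\<forall>i<n. emeasure \<eta> (B i) = k i) \<and> (\<forall>i<m. emeasure \<eta> (C i) = l i)" for \<eta>
  proof safe
    fix i assume *: "\<forall>i<n + m. emeasure \<eta> (F i) = h i"
    show "emeasure \<eta> (B i) = k i" if "i < n" using *[rule_format, of i] that by (simp add: F_def h_def)
    show "emeasure \<eta> (C i) = l i" if "i < m" using *[rule_format, of "n + i"] that by (simp add: F_def h_def)
  qed (auto simp: F_def h_def)
  then have "a \<inter> b = {\<eta> \<in> space (configurations E). \<forall>i<n + m. emeasure \<eta> (F i) = h i}"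
    by (auto simp: a b)
  then show ?thesis unfolding cylinders_def using F by blast
qed

text \<open>Counts have values in the countable set $\mathbf N_0 \cup \{\infty\}$; events about a single
  count are therefore countable unions of cylinders.\<close>

lemma sets_configurations_cylinders:
  "sets (configurations E) = sigma_sets (space (configurations E)) (cylinders E)"
proof
  let ?S = "sigma_sets (space (configurations E)) (cylinders E)"
  interpret S: sigma_algebra "space (configurations E)" ?S
    by (rule sigma_algebra_sigma_sets) (use cylinders_sets sets.sets_into_space in blast)
  have "sets (configurations E) = sigma_sets (space (configurations E))
      {{\<eta> \<in> point_measures E. emeasure \<eta> B \<in> C} | B C. B \<in> sets E \<and> C \<in> sets borel}"
    unfolding space_configurations unfolding configurations_def
    by (rule sets_measure_of[OF configuration_generator_subset])
  also have "\<dots> \<subseteq> ?S"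
  proof (rule S.sigma_sets_subset, safe)
    fix B and C :: "ennreal set" assume B: "B \<in> sets E"
    have "emeasure \<eta> B \<in> range of_nat \<union> {\<infinity>}" if "\<eta> \<in> point_measures E" for \<eta>
      using that B by (simp add: point_measures_def)
    then have "{\<eta> \<in> point_measures E. emeasure \<eta> B \<in> C}
      = (\<Union>k\<in>(range of_nat \<union> {\<infinity>}) \<inter> C. {\<eta> \<in> space (configurations E). emeasure \<eta> B = k})"
      unfolding space_configurations by fastforce
    also have "\<dots> \<in> ?S"
    proof (rule S.countable_UN'')
      fix k
      have "{\<eta> \<in> space (configurations E). emeasure \<eta> B = k} \<in> cylinders E"
        unfolding cylinders_def using B
        by (intro CollectI exI[of _ "1::nat"] exI[of _ "\<lambda>_. B"] exI[of _ "\<lambda>_. k"]) auto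
      then show "{\<eta> \<in> space (configurations E). emeasure \<eta> B = k} \<in> ?S" by (rule sigma_sets.Basic)
    qed (auto intro: countable_Int1)
    finally show "{\<eta> \<in> point_measures E. emeasure \<eta> B \<in> C} \<in> ?S" .
  qed
  finally show "sets (configurations E) \<subseteq> ?S" .
  show "?S \<subseteq> sets (configurations E)" by (intro sets.sigma_sets_subset) (auto intro: cylinders_sets)
qed

lemma sets_pair_generated:
  assumes A: "sets K = sigma_sets (space K) A" "A \<subseteq> Pow (space K)" "space K \<in> A"
  shows "sets (K \<Otimes>\<^sub>M L) = sigma_sets (space K \<times> space L) {a \<times> b | a b. a \<in> A \<and> b \<in> sets L}"
proof -
  have "sets (K \<Otimes>\<^sub>M L) = sets (sigma (space K) A \<Otimes>\<^sub>M sigma (space L) (sets L))"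
    by (rule sets_pair_measure_cong)
       (simp_all add: A sets_measure_of[OF A(2)] sets_measure_of[OF sets.space_closed] sets.sigma_sets_eq)
  also have "sigma (space K) A \<Otimes>\<^sub>M sigma (space L) (sets L)
      = sigma (space K \<times> space L) {a \<times> b | a b. a \<in> A \<and> b \<in> sets L}"
  proof (rule sigma_prod)
    show "\<exists>E\<subseteq>A. countable E \<and> space K = \<Union>E" using A(3) by (intro exI[of _ "{space K}"]) simp
    show "\<exists>E\<subseteq>sets L. countable E \<and> space L = \<Union>E" by (intro exI[of _ "{space L}"]) simp
  qed (rule A(2), rule sets.space_closed)
  also have "sets \<dots> = sigma_sets (space K \<times> space L) {a \<times> b | a b. a \<in> A \<and> b \<in> sets L}"
    by (rule sets_measure_of) (use A(2) sets.sets_into_space in blast)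
  finally show ?thesis .
qed

lemma Int_stable_rectangles:
  assumes "\<And>a b. a \<in> A \<Longrightarrow> b \<in> A \<Longrightarrow> a \<inter> b \<in> A"
  shows "Int_stable {a \<times> B | a B. a \<in> A \<and> B \<in> sets L}"
proof (rule Int_stableI)
  fix x y assume "x \<in> {a \<times> B | a B. a \<in> A \<and> B \<in> sets L}" "y \<in> {a \<times> B | a B. a \<in> A \<and> B \<in> sets L}"
  then show "x \<inter> y \<in> {a \<times> B | a B. a \<in> A \<and> B \<in> sets L}"
    by (auto simp: Times_Int_Times) (metis assms sets.Int)
qed

context poisson_process
begin

text \<open>The measure $G \mapsto E \int 1_G(N, z)\,N(dz)$. It is assembled from the subprobability kernel
  \<open>normalized\<close>, and the density removes the weight again.\<close>

definition campbell :: "('z measure \<times> 'z) measure" where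
  "campbell = density (M \<bind> (\<lambda>\<omega>. distr (normalized (N \<omega>)) (configurations E \<Otimes>\<^sub>M E) (Pair (N \<omega>))))
     (\<lambda>x. ennreal (1 / weight (fst x) (snd x)))"

text \<open>The measure $G \mapsto E \int 1_G(N + \delta_z, z)\,E(dz)$.\<close>

definition insertion :: "('z measure \<times> 'z) measure" where
  "insertion = distr (M \<Otimes>\<^sub>M E) (configurations E \<Otimes>\<^sub>M E) (\<lambda>x. (add_point (N (fst x)) (snd x), snd x))"

lemma campbell_kernel:
  "(\<lambda>\<omega>. distr (normalized (N \<omega>)) (configurations E \<Otimes>\<^sub>M E) (Pair (N \<omega>)))
     \<in> measurable M (subprob_algebra (configurations E \<Otimes>\<^sub>M E))"
  by (rule measurable_distr2[OF _ measurable_normalized[OF N_measurable]]) measurable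

lemma sets_campbell [simp]: "sets campbell = sets (configurations E \<Otimes>\<^sub>M E)"
  by (simp add: campbell_def sets_bind_measurable[OF campbell_kernel not_empty])

lemma nn_integral_campbell:
  assumes h [measurable]: "h \<in> borel_measurable (configurations E \<Otimes>\<^sub>M E)"
  shows "(\<integral>\<^sup>+ x. h x \<partial>campbell) = (\<integral>\<^sup>+ \<omega>. \<integral>\<^sup>+ z. h (N \<omega>, z) \<partial>N \<omega> \<partial>M)"
proof -
  let ?w = "\<lambda>x. ennreal (1 / weight (fst x) (snd x))"
  let ?B = "M \<bind> (\<lambda>\<omega>. distr (normalized (N \<omega>)) (configurations E \<Otimes>\<^sub>M E) (Pair (N \<omega>)))"
  have [measurable]: "?w \<in> borel_measurable (configurations E \<Otimes>\<^sub>M E)"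
    using measurable_weight[OF measurable_ident_sets[OF refl]] by measurable
  have B: "borel_measurable ?B = borel_measurable (configurations E \<Otimes>\<^sub>M E)"
    by (rule measurable_cong_sets[OF sets_bind_measurable[OF campbell_kernel not_empty] refl])
  have "(\<integral>\<^sup>+ x. h x \<partial>campbell) = (\<integral>\<^sup>+ x. ?w x * h x \<partial>?B)"
    unfolding campbell_def by (rule nn_integral_density) (simp_all add: B)
  also have "\<dots> = (\<integral>\<^sup>+ \<omega>. \<integral>\<^sup>+ x. ?w x * h x \<partial>distr (normalized (N \<omega>)) (configurations E \<Otimes>\<^sub>M E) (Pair (N \<omega>)) \<partial>M)"
    by (rule nn_integral_bind[OF _ campbell_kernel]) measurable
  also have "\<dots> = (\<integral>\<^sup>+ \<omega>. \<integral>\<^sup>+ z. h (N \<omega>, z) \<partial>N \<omega> \<partial>M)"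
  proof (rule nn_integral_cong_AE)
    show "AE \<omega> in M. (\<integral>\<^sup>+ x. ?w x * h x \<partial>distr (normalized (N \<omega>)) (configurations E \<Otimes>\<^sub>M E) (Pair (N \<omega>)))
       = (\<integral>\<^sup>+ z. h (N \<omega>, z) \<partial>N \<omega>)"
      using AE_locally_finite AE_space
    proof eventually_elim
      case (elim \<omega>)
      note [measurable] = elim(2)
      have "sets (normalized (N \<omega>)) = sets E"
        using sets_config[OF N_space[OF elim(2)]] by (simp add: normalized_def)
      then have "Pair (N \<omega>) \<in> measurable (normalized (N \<omega>)) (configurations E \<Otimes>\<^sub>M E)"
        using N_space[OF elim(2)] by (simp cong: measurable_cong_sets)
      then have "(\<integral>\<^sup>+ x. ?w x * h x \<partial>distr (normalized (N \<omega>)) (configurations E \<Otimes>\<^sub>M E) (Pair (N \<omega>)))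
        = (\<integral>\<^sup>+ z. ennreal (1 / weight (N \<omega>) z) * h (N \<omega>, z) \<partial>normalized (N \<omega>))"
        by (subst nn_integral_distr) simp_all
      then show ?case
        using elim(1) by (subst (asm) nn_integral_normalized[OF N_space[OF elim(2)]]) simp_all
    qed
  qed
  finally show ?thesis .
qed

lemma nn_integral_insertion:
  assumes h [measurable]: "h \<in> borel_measurable (configurations E \<Otimes>\<^sub>M E)"
  shows "(\<integral>\<^sup>+ x. h x \<partial>insertion) = (\<integral>\<^sup>+ \<omega>. \<integral>\<^sup>+ z. h (add_point (N \<omega>) z, z) \<partial>E \<partial>M)"
  unfolding insertion_def
  by (subst nn_integral_distr, simp_all) (subst nn_integral_fst[symmetric], simp_all)

lemma mecke_rectangle:
  assumes Cy: "Cy \<in> cylinders E" and A [measurable]: "A \<in> sets E" and fin: "emeasure E A < \<infinity>"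
  shows "emeasure campbell (Cy \<times> A) = emeasure insertion (Cy \<times> A)"
proof -
  obtain n :: nat and B k where B: "\<forall>i<n. B i \<in> sets E"
    and Cy': "Cy = {\<eta> \<in> space (configurations E). \<forall>i<n. emeasure \<eta> (B i) = k i}"
    using Cy unfolding cylinders_def by auto
  have R: "Cy \<times> A \<in> sets (configurations E \<Otimes>\<^sub>M E)" using cylinders_sets[OF Cy] A by (rule pair_measureI)
  have "emeasure campbell (Cy \<times> A) = (\<integral>\<^sup>+ \<omega>. \<integral>\<^sup>+ z. indicator (Cy \<times> A) (N \<omega>, z) \<partial>N \<omega> \<partial>M)"
    using nn_integral_campbell[of "indicator (Cy \<times> A)"] R by simp
  also have "\<dots> = (\<integral>\<^sup>+ \<omega>. emeasure (N \<omega>) A * of_bool (\<forall>i<n. emeasure (N \<omega>) (B i) = k i) \<partial>M)"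
  proof (rule nn_integral_cong)
    fix \<omega> assume \<omega>: "\<omega> \<in> space M"
    have "(\<integral>\<^sup>+ z. indicator (Cy \<times> A) (N \<omega>, z) \<partial>N \<omega>)
       = (\<integral>\<^sup>+ z. of_bool (\<forall>i<n. emeasure (N \<omega>) (B i) = k i) * indicator A z \<partial>N \<omega>)"
      using N_space[OF \<omega>] by (intro nn_integral_cong) (auto simp: Cy' indicator_def)
    also have "\<dots> = emeasure (N \<omega>) A * of_bool (\<forall>i<n. emeasure (N \<omega>) (B i) = k i)"
      by (subst nn_integral_cmult_indicator) (simp_all add: sets_config[OF N_space[OF \<omega>]] mult.commute)
    finally show "(\<integral>\<^sup>+ z. indicator (Cy \<times> A) (N \<omega>, z) \<partial>N \<omega>)
       = emeasure (N \<omega>) A * of_bool (\<forall>i<n. emeasure (N \<omega>) (B i) = k i)" .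
  qed
  also have "\<dots> = (\<integral>\<^sup>+ \<omega>. \<integral>\<^sup>+ z. indicator A z * of_bool (\<forall>i<n. emeasure (add_point (N \<omega>) z) (B i) = k i) \<partial>E \<partial>M)"
    using B fin by (intro mecke_cylinder) auto
  also have "\<dots> = (\<integral>\<^sup>+ \<omega>. \<integral>\<^sup>+ z. indicator (Cy \<times> A) (add_point (N \<omega>) z, z) \<partial>E \<partial>M)"
    by (intro nn_integral_cong) (auto simp: Cy' indicator_def N_space add_point_in_configurations)
  also have "\<dots> = emeasure insertion (Cy \<times> A)"
    using nn_integral_insertion[of "indicator (Cy \<times> A)"] R by (simp add: insertion_def)
  finally show ?thesis .
qed

text \<open>Rectangles over cylinders form a generator that is stable under intersections. The identity on
  rectangles with a base of finite mass extends to all rectangles by cutting along \<open>D\<close>.\<close>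

lemma campbell_eq_insertion: "campbell = insertion"
proof -
  let ?S = "space (configurations E)"
  have sp: "?S \<in> cylinders E"
    unfolding cylinders_def by (intro CollectI exI[of _ "0::nat"]) auto
  have Pow: "cylinders E \<subseteq> Pow ?S" using cylinders_sets sets.sets_into_space by blast
  note gen = sets_pair_generated[OF sets_configurations_cylinders Pow sp, of E]
  show ?thesis
  proof (rule measure_eqI_generator_eq[where A="\<lambda>m. ?S \<times> D m"])
    show "Int_stable {a \<times> b | a b. a \<in> cylinders E \<and> b \<in> sets E}"
      by (rule Int_stable_rectangles) (rule cylinders_Int)
    show "{a \<times> b | a b. a \<in> cylinders E \<and> b \<in> sets E} \<subseteq> Pow (?S \<times> space E)"
      using Pow sets.sets_into_space by blast
    show "sets campbell = sigma_sets (?S \<times> space E) {a \<times> b | a b. a \<in> cylinders E \<and> b \<in> sets E}"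
      using gen by simp
    show "sets insertion = sigma_sets (?S \<times> space E) {a \<times> b | a b. a \<in> cylinders E \<and> b \<in> sets E}"
      using gen by (simp add: insertion_def)
    show "range (\<lambda>m. ?S \<times> D m) \<subseteq> {a \<times> b | a b. a \<in> cylinders E \<and> b \<in> sets E}"
      using sp D_sets by blast
    have "(\<Union>m. ?S \<times> D m) = ?S \<times> (\<Union>m. D m)" by blast
    then show "(\<Union>m. ?S \<times> D m) = ?S \<times> space E" by (simp only: D_union)
    show "emeasure campbell (?S \<times> D m) \<noteq> \<infinity>" for m
    proof -
      have "emeasure insertion (?S \<times> D m) = (\<integral>\<^sup>+ \<omega>. \<integral>\<^sup>+ z. indicator (?S \<times> D m) (add_point (N \<omega>) z, z) \<partial>E \<partial>M)"
        using nn_integral_insertion[of "indicator (?S \<times> D m)"] by (simp add: insertion_def)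
      also have "\<dots> \<le> (\<integral>\<^sup>+ \<omega>. \<integral>\<^sup>+ z. indicator (D m) z \<partial>E \<partial>M)"
        by (intro nn_integral_mono) (auto split: split_indicator)
      also have "\<dots> < \<infinity>" using D_finite[of m] by (simp add: emeasure_space_1)
      finally show ?thesis using mecke_rectangle[OF sp D_sets D_finite, of m] by simp
    qed
    fix X assume "X \<in> {a \<times> b | a b. a \<in> cylinders E \<and> b \<in> sets E}"
    then obtain Cy A where X: "X = Cy \<times> A" and Cy: "Cy \<in> cylinders E" and A: "A \<in> sets E" by blast
    have "X = Cy \<times> (A \<inter> (\<Union>m. D m))" unfolding D_union using sets.sets_into_space[OF A] X by auto
    then have X_UN: "X = (\<Union>m. Cy \<times> (A \<inter> D m))" by blast
    have piece: "Cy \<times> (A \<inter> D m) \<in> sets (configurations E \<Otimes>\<^sub>M E)" for m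
      using cylinders_sets[OF Cy] A by auto
    have disj: "disjoint_family (\<lambda>m. Cy \<times> (A \<inter> D m))"
      using D_disjoint by (auto simp: disjoint_family_on_def)
    have "emeasure E (A \<inter> D m) < \<infinity>" for m
      using D_finite[of m] emeasure_mono[of "A \<inter> D m" "D m" E] by (auto intro: le_less_trans)
    then have "emeasure campbell (Cy \<times> (A \<inter> D m)) = emeasure insertion (Cy \<times> (A \<inter> D m))" for m
      using A by (intro mecke_rectangle[OF Cy]) auto
    moreover have "emeasure L X = (\<Sum>m. emeasure L (Cy \<times> (A \<inter> D m)))"
      if "sets L = sets (configurations E \<Otimes>\<^sub>M E)" for L
      unfolding X_UN using piece that by (intro suminf_emeasure[symmetric] disj) auto
    ultimately show "emeasure campbell X = emeasure insertion X" by (simp add: insertion_def)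
  qed
qed

theorem mecke:
  assumes "h \<in> borel_measurable (configurations E \<Otimes>\<^sub>M E)"
  shows "(\<integral>\<^sup>+ \<omega>. \<integral>\<^sup>+ z. h (N \<omega>, z) \<partial>N \<omega> \<partial>M) = (\<integral>\<^sup>+ \<omega>. \<integral>\<^sup>+ z. h (add_point (N \<omega>) z, z) \<partial>E \<partial>M)"
  using nn_integral_campbell[OF assms] nn_integral_insertion[OF assms] campbell_eq_insertion by simp

end

section \<open>Predictable processes as functions of the past configuration\<close>

text \<open>Only countably many exceptional null sets arise when a \<open>\<sigma>\<close>-algebra is built up from its
  generator. The quantifier over \<open>i\<close> stays inside the almost-everywhere statement, so \<open>J\<close> may be
  uncountable.\<close>

lemma versions_of_sets:
  fixes M :: "'w measure"
  assumes f: "\<And>\<omega> i. \<omega> \<in> space M \<Longrightarrow> i \<in> J \<Longrightarrow> f \<omega> i \<in> \<Omega>"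
    and g: "\<And>\<omega> i. \<omega> \<in> space M \<Longrightarrow> i \<in> J \<Longrightarrow> g \<omega> i \<in> space K"
    and gen: "\<And>A. A \<in> G \<Longrightarrow> \<exists>A'\<in>sets K. AE \<omega> in M. \<forall>i\<in>J. f \<omega> i \<in> A \<longleftrightarrow> g \<omega> i \<in> A'"
    and A: "A \<in> sigma_sets \<Omega> G"
  shows "\<exists>A'\<in>sets K. AE \<omega> in M. \<forall>i\<in>J. f \<omega> i \<in> A \<longleftrightarrow> g \<omega> i \<in> A'"
  using A
proof induction
  case (Basic a)
  then show ?case by (rule gen)
next
  case Empty
  show ?case by (intro bexI[of _ "{}"]) auto
next
  case (Compl a)
  then obtain a' where a': "a' \<in> sets K" "AE \<omega> in M. \<forall>i\<in>J. f \<omega> i \<in> a \<longleftrightarrow> g \<omega> i \<in> a'" by auto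
  show ?case
  proof (intro bexI[of _ "space K - a'"])
    show "AE \<omega> in M. \<forall>i\<in>J. f \<omega> i \<in> \<Omega> - a \<longleftrightarrow> g \<omega> i \<in> space K - a'"
      using a'(2) AE_space by eventually_elim (auto simp: f g)
  qed (use a' in auto)
next
  case (Union a)
  have "\<forall>n. \<exists>a'. a' \<in> sets K \<and> (AE \<omega> in M. \<forall>i\<in>J. f \<omega> i \<in> a n \<longleftrightarrow> g \<omega> i \<in> a')"
    using Union(2) unfolding Bex_def by (rule allI)
  from choice[OF this] obtain a' where a': "\<forall>n. a' n \<in> sets K \<and> (AE \<omega> in M. \<forall>i\<in>J. f \<omega> i \<in> a n \<longleftrightarrow> g \<omega> i \<in> a' n)" ..
  have "AE \<omega> in M. \<forall>n. \<forall>i\<in>J. f \<omega> i \<in> a n \<longleftrightarrow> g \<omega> i \<in> a' n"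
    unfolding AE_all_countable using a' by simp
  then have "AE \<omega> in M. \<forall>i\<in>J. f \<omega> i \<in> (\<Union>n. a n) \<longleftrightarrow> g \<omega> i \<in> (\<Union>n. a' n)"
    by eventually_elim auto
  moreover have "(\<Union>n. a' n) \<in> sets K" using a' by auto
  ultimately show ?case by (intro bexI[of _ "\<Union>n. a' n"])
qed

text \<open>Approximate by simple functions, replace each level set by its version, and take the limit where
  it exists.\<close>

lemma versions_of_functions:
  fixes F :: "'a \<Rightarrow> 'h::{banach, second_countable_topology}"
  assumes F: "F \<in> borel_measurable L"
    and f: "\<And>\<omega> i. \<omega> \<in> space M \<Longrightarrow> i \<in> J \<Longrightarrow> f \<omega> i \<in> space L"
    and sets: "\<And>A. A \<in> sets L \<Longrightarrow> \<exists>A'\<in>sets K. AE \<omega> in M. \<forall>i\<in>J. f \<omega> i \<in> A \<longleftrightarrow> g \<omega> i \<in> A'"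
  shows "\<exists>F'\<in>borel_measurable K. AE \<omega> in M. \<forall>i\<in>J. F (f \<omega> i) = F' (g \<omega> i)"
proof -
  obtain s where s: "\<And>n. simple_function L (s n)" "\<And>x. x \<in> space L \<Longrightarrow> (\<lambda>n. s n x) \<longlonglongrightarrow> F x"
    using borel_measurable_implies_sequence_metric[OF F, of 0] by metis
  let ?A = "\<lambda>n y. s n -` {y} \<inter> space L"
  let ?P = "\<lambda>n y A'. A' \<in> sets K \<and> (AE \<omega> in M. \<forall>i\<in>J. f \<omega> i \<in> ?A n y \<longleftrightarrow> g \<omega> i \<in> A')"
  define A' where "A' n y = (SOME A'. ?P n y A')" for n y
  have "?P n y (A' n y)" for n y
    unfolding A'_def
    by (rule someI_ex) (rule sets[OF simple_functionD(2)[OF s(1)], unfolded Bex_def])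
  then have A' [measurable]: "A' n y \<in> sets K"
    and AE: "AE \<omega> in M. \<forall>i\<in>J. f \<omega> i \<in> ?A n y \<longleftrightarrow> g \<omega> i \<in> A' n y" for n y by auto
  \<comment> \<open>The same linear combination as \<open>s n\<close>, with the versions as level sets.\<close>
  define s' where "s' n x = (\<Sum>y\<in>s n ` space L. indicator (A' n y) x *\<^sub>R y)" for n x
  have fin: "finite (s n ` space L)" for n using s(1) by (rule simple_functionD)
  have [measurable]: "s' n \<in> borel_measurable K" for n unfolding s'_def by measurable
  have "AE \<omega> in M. \<forall>n. \<forall>y\<in>s n ` space L. \<forall>i\<in>J. f \<omega> i \<in> ?A n y \<longleftrightarrow> g \<omega> i \<in> A' n y"
    unfolding AE_all_countable AE_ball_countable[OF countable_finite[OF fin]] using AE by simp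
  then have "AE \<omega> in M. \<forall>i\<in>J. F (f \<omega> i) = lim (\<lambda>n. s' n (g \<omega> i))"
    using AE_space
  proof eventually_elim
    case (elim \<omega>)
    show ?case
    proof
      fix i assume i: "i \<in> J"
      have "s' n (g \<omega> i) = s n (f \<omega> i)" for n
      proof -
        have "s' n (g \<omega> i) = (\<Sum>y\<in>s n ` space L. if y = s n (f \<omega> i) then y else 0)"
          unfolding s'_def
        proof (rule sum.cong[OF refl])
          fix y assume "y \<in> s n ` space L"
          then have "f \<omega> i \<in> ?A n y \<longleftrightarrow> g \<omega> i \<in> A' n y" using elim(1) i by blast
          then show "indicator (A' n y) (g \<omega> i) *\<^sub>R y = (if y = s n (f \<omega> i) then y else 0)"
            using f[OF elim(2) i] by (auto simp: indicator_def)
        qed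
        also have "\<dots> = s n (f \<omega> i)" using fin f[OF elim(2) i] by simp
        finally show ?thesis .
      qed
      then show "F (f \<omega> i) = lim (\<lambda>n. s' n (g \<omega> i))"
        using s(2)[OF f[OF elim(2) i]] by (simp add: limI)
    qed
  qed
  then show ?thesis by (intro bexI[of _ "\<lambda>x. lim (\<lambda>n. s' n x)"]) auto
qed

lemma space_time_measure [simp]: "space (time_measure T) = {0..T}"
  by (simp add: time_measure_def space_restrict_space)

lemma interval_time_measure [measurable]:
  assumes "0 \<le> r" "s \<le> T" shows "{r<..s} \<in> sets (time_measure T)"
  unfolding time_measure_def using assms by (subst sets_restrict_space_iff) auto

lemma sets_time_measureI: "A \<in> sets borel \<Longrightarrow> {0..T} \<inter> A \<in> sets (time_measure T)"
  unfolding time_measure_def by (auto simp: sets_restrict_space)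

lemma finite_time_measure: "finite_measure (time_measure T)"
  unfolding time_measure_def
  by (rule finite_measureI) (simp add: emeasure_restrict_space space_restrict_space emeasure_lborel_Icc_eq)

lemma subalgebra_sigma:
  assumes "G \<subseteq> sets M"
  shows "subalgebra M (sigma (space M) G)"
  unfolding subalgebra_def
proof
  show "space (sigma (space M) G) = space M"
    by (rule space_measure_of) (use assms sets.sets_into_space in auto)
  show "sets (sigma (space M) G) \<subseteq> sets M"
    by (rule sets.sigma_sets_subset[OF assms, THEN subset_trans[rotated]])
       (subst sets_measure_of, use assms sets.sets_into_space in auto)
qed

lemma space_completed [simp]: "space (completed M G) = space M"
  by (simp add: completed_def space_restr_to_subalg)

lemma sets_completed_superset:
  assumes "subalgebra M G" shows "sets G \<subseteq> sets (completed M G)"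
  unfolding completed_def using sets_restr_to_subalg[OF assms] by (auto intro: sets_completionI_sets)

lemma completedE:
  assumes "A \<in> sets (completed M G)" and G: "subalgebra M G"
  obtains S where "S \<in> sets G" "AE \<omega> in M. \<omega> \<in> A \<longleftrightarrow> \<omega> \<in> S"
proof -
  obtain S L L' where *: "A = S \<union> L" "L \<subseteq> L'" "L' \<in> null_sets (restr_to_subalg M G)" "S \<in> sets (restr_to_subalg M G)"
    using assms(1) unfolding completed_def by (rule sets_completionE)
  have "L' \<in> null_sets M" using * by (simp add: null_sets_restr_to_subalg[OF G])
  then have "AE \<omega> in M. \<omega> \<notin> L'" by (rule AE_not_in)
  then have "AE \<omega> in M. \<omega> \<in> A \<longleftrightarrow> \<omega> \<in> S" by eventually_elim (use * in auto)
  then show thesis using * by (intro that) (simp_all add: sets_restr_to_subalg[OF G])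
qed

type_synonym 'u history_mark = "((real \<times> 'u) measure \<times> real) \<times> 'u"

type_synonym ('w, 'u) sample = "('w \<times> real) \<times> 'u"

text \<open>The exhaustion has the form $[0,T] \times U_m$, which makes $\nu(U_m) < \infty$
  available for elementary integrands.\<close>

locale marked_poisson = mark: sigma_finite_measure \<nu> + poisson_process M "intensity T \<nu>" "\<lambda>m. {0..T} \<times> U m" N
  for M :: "'w measure" and T :: real
    and \<nu> :: "'u::{real_inner, banach, second_countable_topology} measure"
    and U :: "nat \<Rightarrow> 'u set" and N :: "'w \<Rightarrow> (real \<times> 'u) measure" +
  assumes T_pos: "0 < T" and sets_mark [measurable_cong]: "sets \<nu> = sets borel"
    and U_sets: "\<And>m. U m \<in> sets borel" and U_finite: "\<And>m. emeasure \<nu> (U m) < \<infinity>"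
begin

abbreviation E :: "(real \<times> 'u) measure" where "E \<equiv> intensity T \<nu>"
abbreviation conf :: "(real \<times> 'u) measure measure" where "conf \<equiv> configurations E"
abbreviation proc :: "(('w \<times> real) \<times> 'u) measure" where "proc \<equiv> process_measure M T \<nu>"
abbreviation pred :: "('w \<times> real) measure" where "pred \<equiv> predictable M T \<nu> N"
abbreviation before :: "real \<Rightarrow> (real \<times> 'u) set" where "before r \<equiv> {0..r} \<times> UNIV"

lemma space_mark [simp]: "space \<nu> = UNIV"
  using sets_eq_imp_space_eq[OF sets_mark] by simp

lemma space_E: "space E = {0..T} \<times> UNIV"
  by (simp add: space_pair_measure)

lemma before_sets: "B \<in> sets E \<Longrightarrow> before r \<inter> B \<in> sets E"
proof -
  assume B: "B \<in> sets E"
  have "({0..T} \<inter> {0..r}) \<times> UNIV \<in> sets E"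
    using sets.top[of \<nu>] by (intro pair_measureI sets_time_measureI) auto
  moreover have "before r \<inter> B = (({0..T} \<inter> {0..r}) \<times> UNIV) \<inter> B"
    using sets.sets_into_space[OF B] by (auto simp: space_E)
  ultimately show ?thesis using B by auto
qed

text \<open>Events that depend only on the points up to time \<open>r\<close>. Neither completion nor right limits are
  taken: this keeps insertion of a point measurable (\<open>past_add_point\<close>).\<close>

definition past :: "real \<Rightarrow> (real \<times> 'u) measure measure" where
  "past r = sigma (space conf)
     {{\<eta> \<in> space conf. emeasure \<eta> (before r \<inter> B) \<in> C} | B C. B \<in> sets E \<and> C \<in> sets borel}"

text \<open>The predictable \<open>\<sigma>\<close>-algebra on the space of configurations. It has no generator at time $0$,
  where neither the intensity nor the random measure has mass.\<close>

definition canonical :: "((real \<times> 'u) measure \<times> real) measure" where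
  "canonical = sigma (space conf \<times> {0..T})
     {A \<times> {r<..s} | A r s. 0 \<le> r \<and> r \<le> s \<and> s \<le> T \<and> A \<in> sets (past r)}"

abbreviation marked_canonical :: "'u history_mark measure" where
  "marked_canonical \<equiv> canonical \<Otimes>\<^sub>M borel"

abbreviation marked_pred :: "('w, 'u) sample measure" where
  "marked_pred \<equiv> pred \<Otimes>\<^sub>M borel"

abbreviation hist :: "real \<Rightarrow> 'w measure" where "hist \<equiv> history M T \<nu> N"

abbreviation L1_pr :: "(('w, 'u) sample \<Rightarrow> 'h::real_normed_vector) set" where
  "L1_pr \<equiv> Lp_pr 1 M T \<nu> N"

abbreviation is_integral :: "((('w, 'u) sample \<Rightarrow> 'h::real_normed_vector) \<Rightarrow> 'w \<Rightarrow> 'h) \<Rightarrow> bool" where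
  "is_integral \<equiv> is_stochastic_integral 1 M T \<nu> N"

lemma past_generator:
  "{{\<eta> \<in> space conf. emeasure \<eta> (before r \<inter> B) \<in> C} | B C. B \<in> sets E \<and> C \<in> sets borel} \<subseteq> Pow (space conf)"
  by auto

lemma space_past [simp]: "space (past r) = space conf"
  unfolding past_def by (rule space_measure_of[OF past_generator])

lemma sets_past: "sets (past r) = sigma_sets (space conf)
     {{\<eta> \<in> space conf. emeasure \<eta> (before r \<inter> B) \<in> C} | B C. B \<in> sets E \<and> C \<in> sets borel}"
  unfolding past_def by (rule sets_measure_of[OF past_generator])

lemma past_basic:
  assumes "B \<in> sets E" "C \<in> sets borel"
  shows "{\<eta> \<in> space conf. emeasure \<eta> (before r \<inter> B) \<in> C} \<in> sets (past r)"
  unfolding sets_past using assms by (intro sigma_sets.Basic) blast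

lemma past_measurable:
  assumes "B \<in> sets E"
  shows "(\<lambda>\<eta>. emeasure \<eta> (before r \<inter> B)) \<in> borel_measurable (past r)"
proof (rule measurableI)
  fix C :: "ennreal set" assume "C \<in> sets borel"
  moreover have "(\<lambda>\<eta>. emeasure \<eta> (before r \<inter> B)) -` C \<inter> space (past r)
    = {\<eta> \<in> space conf. emeasure \<eta> (before r \<inter> B) \<in> C}" by auto
  ultimately show "(\<lambda>\<eta>. emeasure \<eta> (before r \<inter> B)) -` C \<inter> space (past r) \<in> sets (past r)"
    using past_basic[OF assms] by simp
qed simp

lemma measurable_pastI:
  assumes "\<And>x. x \<in> space P \<Longrightarrow> \<kappa> x \<in> space conf"
    and "\<And>B. B \<in> sets E \<Longrightarrow> (\<lambda>x. emeasure (\<kappa> x) (before r \<inter> B)) \<in> borel_measurable P"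
  shows "\<kappa> \<in> measurable P (past r)"
  unfolding past_def
proof (rule measurable_measure_of[OF past_generator])
  show "\<kappa> \<in> space P \<rightarrow> space conf" using assms(1) by auto
next
  fix y assume "y \<in> {{\<eta> \<in> space conf. emeasure \<eta> (before r \<inter> B) \<in> C} | B C. B \<in> sets E \<and> C \<in> sets borel}"
  then obtain B C where y: "y = {\<eta> \<in> space conf. emeasure \<eta> (before r \<inter> B) \<in> C}" "B \<in> sets E" "C \<in> sets borel"
    by auto
  moreover have "\<kappa> -` y \<inter> space P = (\<lambda>x. emeasure (\<kappa> x) (before r \<inter> B)) -` C \<inter> space P"
    using assms(1) by (auto simp: y)
  ultimately show "\<kappa> -` y \<inter> space P \<in> sets P" using measurable_sets[OF assms(2)] by auto
qed

lemma past_mono_measurable: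
  assumes "r \<le> s" shows "(\<lambda>\<eta>. \<eta>) \<in> measurable (past s) (past r)"
proof (rule measurable_pastI)
  fix B assume B: "B \<in> sets E"
  have "before r \<inter> B = before s \<inter> (before r \<inter> B)" using assms by auto
  then show "(\<lambda>\<eta>. emeasure \<eta> (before r \<inter> B)) \<in> borel_measurable (past s)"
    using past_measurable[OF before_sets[OF B, of r], of s] by simp
qed simp

lemma past_mono: "r \<le> s \<Longrightarrow> A \<in> sets (past r) \<Longrightarrow> A \<in> sets (past s)"
  using measurable_sets[OF past_mono_measurable, of r s A] sets.sets_into_space[of A "past r"]
  by (auto simp: Int_absorb2)

lemma past_subset: "A \<in> sets (past r) \<Longrightarrow> A \<in> sets conf"
proof -
  assume A: "A \<in> sets (past r)"
  have "(\<lambda>\<eta>. \<eta>) \<in> measurable conf (past r)"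
    by (rule measurable_pastI) (auto intro: measurable_emeasure_config before_sets)
  from measurable_sets[OF this A] sets.sets_into_space[OF A] show ?thesis by (auto simp: Int_absorb2)
qed

lemma canonical_generator:
  "{A \<times> {r<..s} | A r s. 0 \<le> r \<and> r \<le> s \<and> s \<le> T \<and> A \<in> sets (past r)} \<subseteq> Pow (space conf \<times> {0..T})"
  using sets.sets_into_space[of _ "past _"] by fastforce

lemma space_canonical [simp]: "space canonical = space conf \<times> {0..T}"
  unfolding canonical_def by (rule space_measure_of[OF canonical_generator])

lemma sets_canonical: "sets canonical = sigma_sets (space conf \<times> {0..T})
     {A \<times> {r<..s} | A r s. 0 \<le> r \<and> r \<le> s \<and> s \<le> T \<and> A \<in> sets (past r)}"
  unfolding canonical_def by (rule sets_measure_of[OF canonical_generator])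

lemma canonical_basic:
  "0 \<le> r \<Longrightarrow> r \<le> s \<Longrightarrow> s \<le> T \<Longrightarrow> A \<in> sets (past r) \<Longrightarrow> A \<times> {r<..s} \<in> sets canonical"
  unfolding sets_canonical by (intro sigma_sets.Basic) blast

lemma measurable_canonicalI:
  assumes "\<And>x. x \<in> space P \<Longrightarrow> \<kappa> x \<in> space conf \<times> {0..T}"
    and "\<And>A r s. 0 \<le> r \<Longrightarrow> r \<le> s \<Longrightarrow> s \<le> T \<Longrightarrow> A \<in> sets (past r) \<Longrightarrow> \<kappa> -` (A \<times> {r<..s}) \<inter> space P \<in> sets P"
  shows "\<kappa> \<in> measurable P canonical"
  unfolding canonical_def
  by (rule measurable_measure_of[OF canonical_generator]) (use assms in blast)+

text \<open>Canonical predictable functions are in particular jointly measurable, which is all that the Mecke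
  formula asks for.\<close>

lemma id_measurable_canonical: "(\<lambda>x. x) \<in> measurable (conf \<Otimes>\<^sub>M time_measure T) canonical"
proof (rule measurable_canonicalI)
  fix A r s assume *: "0 \<le> r" "r \<le> s" "s \<le> T" "A \<in> sets (past r)"
  then have "A \<times> {r<..s} \<in> sets (conf \<Otimes>\<^sub>M time_measure T)"
    by (intro pair_measureI past_subset interval_time_measure)
  moreover have "(\<lambda>x. x) -` (A \<times> {r<..s}) \<inter> space (conf \<Otimes>\<^sub>M time_measure T) = A \<times> {r<..s}"
    using sets.sets_into_space[OF calculation] by auto
  ultimately show "(\<lambda>x. x) -` (A \<times> {r<..s}) \<inter> space (conf \<Otimes>\<^sub>M time_measure T) \<in> sets (conf \<Otimes>\<^sub>M time_measure T)"
    by simp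
qed (simp add: space_pair_measure)

lemma measurable_into_canonical [measurable (raw)]:
  assumes "f \<in> measurable P conf" "g \<in> measurable P (time_measure T)"
  shows "(\<lambda>p. (f p, g p)) \<in> measurable P canonical"
  using measurable_compose[OF measurable_Pair[OF assms] id_measurable_canonical] .

lemma observed_subalgebra:
  "subalgebra M (sigma (space M)
     {{\<omega> \<in> space M. emeasure (N \<omega>) (before u \<inter> B) \<in> C} | B C. B \<in> sets E \<and> C \<in> sets borel})"
proof (rule subalgebra_sigma, safe)
  fix B and C :: "ennreal set" assume B: "B \<in> sets E" and C [measurable]: "C \<in> sets borel"
  have [measurable]: "before u \<inter> B \<in> sets E" using B by (rule before_sets)
  show "{\<omega> \<in> space M. emeasure (N \<omega>) (before u \<inter> B) \<in> C} \<in> sets M" by measurable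
qed

lemma observed_basic:
  assumes "B \<in> sets E" "C \<in> sets borel"
  shows "{\<omega> \<in> space M. emeasure (N \<omega>) (before u \<inter> B) \<in> C} \<in> sets (observed M E N (before u))"
  unfolding observed_def
  by (rule sets_completed_superset[OF observed_subalgebra, THEN subsetD])
     (subst sets_measure_of, use assms in \<open>auto intro: sigma_sets.Basic\<close>)

text \<open>An intersection of \<open>\<sigma>\<close>-algebras is one itself, so generating adds no sets.\<close>

lemma history_eq:
  assumes "r < T"
  shows "space (hist r) = space M"
    and "sets (hist r) = (\<Inter>u\<in>{r<..T}. sets (observed M E N (before u)))"
proof -
  let ?X = "(\<Inter>u\<in>{r<..T}. sets (observed M E N (before u)))"
  have obs: "space (observed M E N (before u)) = space M" for u by (simp add: observed_def)
  have low: "?X \<subseteq> sets (observed M E N (before u))" if "u \<in> {r<..T}" for u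
    by (rule INF_lower[OF that])
  have sub: "?X \<subseteq> Pow (space M)"
    using low[of T] sets.space_closed[of "observed M E N (before T)"] assms obs[of T] by auto
  then show "space (hist r) = space M"
    using assms unfolding history_def by (simp add: space_measure_of)
  have "sigma_sets (space M) ?X \<subseteq> ?X"
  proof (rule INF_greatest)
    fix u assume "u \<in> {r<..T}"
    from sets.sigma_sets_subset[OF low[OF this]]
    show "sigma_sets (space M) ?X \<subseteq> sets (observed M E N (before u))" by (simp only: obs)
  qed
  then have "sigma_sets (space M) ?X = ?X" by (auto intro: sigma_sets.Basic)
  then show "sets (hist r) = ?X" unfolding history_def using assms sub by simp
qed

lemma space_history [simp]: "space (hist r) = space M"
  using history_eq(1) by (cases "r < T") (simp_all add: history_def)

lemmas history_sets = history_eq(2)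

lemma N_measurable_past:
  assumes "r \<le> T" shows "N \<in> measurable (hist r) (past r)"
proof (rule measurable_pastI)
  fix B assume B: "B \<in> sets E"
  show "(\<lambda>\<omega>. emeasure (N \<omega>) (before r \<inter> B)) \<in> borel_measurable (hist r)"
  proof (cases "r < T")
    case False
    have [measurable]: "before r \<inter> B \<in> sets E" using B by (rule before_sets)
    show ?thesis using False by (simp add: history_def)
  next
    case True
    show ?thesis
    proof (rule measurableI)
      fix C :: "ennreal set" assume C: "C \<in> sets borel"
      have "{\<omega> \<in> space M. emeasure (N \<omega>) (before r \<inter> B) \<in> C} \<in> sets (observed M E N (before u))"
        if "u \<in> {r<..T}" for u
      proof -
        have "before u \<inter> (before r \<inter> B) = before r \<inter> B" using that by auto
        then show ?thesis using observed_basic[OF before_sets[OF B, of r] C, of u] by simp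
      qed
      moreover have "(\<lambda>\<omega>. emeasure (N \<omega>) (before r \<inter> B)) -` C \<inter> space (hist r)
        = {\<omega> \<in> space M. emeasure (N \<omega>) (before r \<inter> B) \<in> C}" by auto
      ultimately show "(\<lambda>\<omega>. emeasure (N \<omega>) (before r \<inter> B)) -` C \<inter> space (hist r)
        \<in> sets (hist r)" using True by (simp add: history_sets)
    qed simp
  qed
qed (simp add: N_space)

lemma predictable_generator:
  "{A \<times> {0} | A. A \<in> sets (hist 0)} \<union>
      {A \<times> {r<..s} | A r s. 0 \<le> r \<and> r \<le> s \<and> s \<le> T \<and> A \<in> sets (hist r)}
   \<subseteq> Pow (space M \<times> {0..T})"
  using sets.sets_into_space[of _ "hist _"] T_pos by fastforce

lemma space_predictable [simp]: "space pred = space M \<times> {0..T}"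
  unfolding predictable_def by (rule space_measure_of[OF predictable_generator])

lemma sets_predictable: "sets pred = sigma_sets (space M \<times> {0..T})
  ({A \<times> {0} | A. A \<in> sets (hist 0)} \<union>
      {A \<times> {r<..s} | A r s. 0 \<le> r \<and> r \<le> s \<and> s \<le> T \<and> A \<in> sets (hist r)})"
  unfolding predictable_def by (rule sets_measure_of[OF predictable_generator])

lemma predictable_to_canonical: "(\<lambda>(\<omega>, t). (N \<omega>, t)) \<in> measurable pred canonical"
proof (rule measurable_canonicalI)
  fix A r s assume *: "0 \<le> r" "r \<le> s" "s \<le> T" "A \<in> sets (past r)"
  have "(N -` A \<inter> space M) \<times> {r<..s} \<in> sets pred"
    unfolding sets_predictable
    using measurable_sets[OF N_measurable_past *(4)] * by (intro sigma_sets.Basic) auto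
  moreover have "(\<lambda>(\<omega>, t). (N \<omega>, t)) -` (A \<times> {r<..s}) \<inter> space pred = (N -` A \<inter> space M) \<times> {r<..s}"
    using * by auto
  ultimately show "(\<lambda>(\<omega>, t). (N \<omega>, t)) -` (A \<times> {r<..s}) \<inter> space pred \<in> sets pred" by simp
qed (auto simp: N_space)

text \<open>A set in the completion of a \<open>\<sigma>\<close>-algebra differs from one of its members by a null set.\<close>

lemma observed_version:
  assumes "A \<in> sets (observed M E N (before u))"
  shows "\<exists>A'\<in>sets (past u). AE \<omega> in M. \<omega> \<in> A \<longleftrightarrow> N \<omega> \<in> A'"
proof -
  obtain S where S: "S \<in> sets (sigma (space M)
     {{\<omega> \<in> space M. emeasure (N \<omega>) (before u \<inter> B) \<in> C} | B C. B \<in> sets E \<and> C \<in> sets borel})"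
    and AS: "AE \<omega> in M. \<omega> \<in> A \<longleftrightarrow> \<omega> \<in> S"
    using completedE[OF assms[unfolded observed_def] observed_subalgebra] by blast
  have "S \<in> sigma_sets (space M)
     {{\<omega> \<in> space M. emeasure (N \<omega>) (before u \<inter> B) \<in> C} | B C. B \<in> sets E \<and> C \<in> sets borel}"
    using S by (subst (asm) sets_measure_of) auto
  then have "\<exists>S'\<in>sets (past u). AE \<omega> in M. \<forall>i\<in>UNIV::unit set. \<omega> \<in> S \<longleftrightarrow> N \<omega> \<in> S'"
  proof (rule versions_of_sets[rotated 3])
    fix G assume "G \<in> {{\<omega> \<in> space M. emeasure (N \<omega>) (before u \<inter> B) \<in> C} | B C. B \<in> sets E \<and> C \<in> sets borel}"
    then obtain B C where G: "G = {\<omega> \<in> space M. emeasure (N \<omega>) (before u \<inter> B) \<in> C}" "B \<in> sets E" "C \<in> sets borel"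
      by auto
    have "AE \<omega> in M. \<forall>i\<in>UNIV::unit set. \<omega> \<in> G \<longleftrightarrow> N \<omega> \<in> {\<eta> \<in> space conf. emeasure \<eta> (before u \<inter> B) \<in> C}"
      using AE_space by eventually_elim (auto simp: G N_space)
    then show "\<exists>A'\<in>sets (past u). AE \<omega> in M. \<forall>i\<in>UNIV::unit set. \<omega> \<in> G \<longleftrightarrow> N \<omega> \<in> A'"
      using past_basic[OF G(2,3)] by blast
  qed (auto simp: N_space)
  then obtain S' where "S' \<in> sets (past u)" and S': "AE \<omega> in M. \<omega> \<in> S \<longleftrightarrow> N \<omega> \<in> S'" by auto
  moreover have "AE \<omega> in M. \<omega> \<in> A \<longleftrightarrow> N \<omega> \<in> S'" using AS S' by eventually_elim auto
  ultimately show ?thesis by blast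
qed

text \<open>Right-continuity of the filtration is harmless for predictable sets: \<open>A\<close> is known from the
  points up to \<open>u n\<close>, up to a null set, whenever \<open>u n > r\<close>, and $(r, s]$ is the union of the
  intervals $(u_n, s]$ for $u_n \downarrow r$.\<close>

lemma history_interval_version:
  assumes r: "0 \<le> r" "r \<le> s" "s \<le> T" and A: "A \<in> sets (hist r)"
  shows "\<exists>A'\<in>sets canonical. AE \<omega> in M. \<forall>t\<in>{0<..T}. (\<omega>, t) \<in> A \<times> {r<..s} \<longleftrightarrow> (N \<omega>, t) \<in> A'"
proof (cases "r < T")
  case False
  then have "{r<..s} = {}" using r by auto
  then show ?thesis by (intro bexI[of _ "{}"]) auto
next
  case True
  \<comment> \<open>A sequence in $(r, T]$ that decreases to \<open>r\<close>.\<close>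
  define u where "u n = r + (T - r) / real (Suc n)" for n
  have u: "r < u n" "u n \<le> T" for n
  proof -
    have "(T - r) / real (Suc n) \<le> (T - r) / 1" using True by (intro divide_left_mono) auto
    then show "r < u n" "u n \<le> T" using True by (simp_all add: u_def)
  qed
  have "A \<in> sets (observed M E N (before (u n)))" for n
    using A u[of n] by (auto simp: history_sets[OF True])
  then have "\<forall>n. \<exists>A'. A' \<in> sets (past (u n)) \<and> (AE \<omega> in M. \<omega> \<in> A \<longleftrightarrow> N \<omega> \<in> A')"
    using observed_version by blast
  then obtain A' where A': "\<And>n. A' n \<in> sets (past (u n))" "\<And>n. AE \<omega> in M. \<omega> \<in> A \<longleftrightarrow> N \<omega> \<in> A' n"
    by metis
  \<comment> \<open>Generators are intervals with ordered end points, so the indices with \<open>u n > s\<close> are dropped.\<close>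
  define a where "a n = (if u n \<le> s then A' n \<times> {u n<..s} else {})" for n
  have "a n \<in> sets canonical" for n
    using canonical_basic[of "u n" s "A' n"] A'(1)[of n] u[of n] r by (auto simp: a_def)
  then have "(\<Union>n. a n) \<in> sets canonical" by auto
  moreover have "AE \<omega> in M. \<forall>n. \<omega> \<in> A \<longleftrightarrow> N \<omega> \<in> A' n"
    unfolding AE_all_countable using A'(2) by blast
  then have "AE \<omega> in M. \<forall>t\<in>{0<..T}. (\<omega>, t) \<in> A \<times> {r<..s} \<longleftrightarrow> (N \<omega>, t) \<in> (\<Union>n. a n)"
  proof eventually_elim
    case (elim \<omega>)
    show ?case
    proof (intro ballI iffI)
      fix t assume "(\<omega>, t) \<in> A \<times> {r<..s}"
      then have \<omega>: "\<omega> \<in> A" and t: "r < t" "t \<le> s" by auto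
      obtain n where "(T - r) / (t - r) < real n" using reals_Archimedean2 by blast
      then have "(T - r) / (t - r) < real (Suc n)" by simp
      then have "u n < t" using t by (simp add: u_def field_simps)
      then have "(N \<omega>, t) \<in> a n" using elim \<omega> t by (auto simp: a_def)
      then show "(N \<omega>, t) \<in> (\<Union>n. a n)" by blast
    next
      fix t assume "(N \<omega>, t) \<in> (\<Union>n. a n)"
      then obtain n where "(N \<omega>, t) \<in> a n" by blast
      then show "(\<omega>, t) \<in> A \<times> {r<..s}" using elim u[of n] by (auto simp: a_def split: if_splits)
    qed
  qed
  ultimately show ?thesis by blast
qed

lemma predictable_set_version:
  assumes "A \<in> sets pred"
  shows "\<exists>A'\<in>sets canonical. AE \<omega> in M. \<forall>t\<in>{0<..T}. (\<omega>, t) \<in> A \<longleftrightarrow> (N \<omega>, t) \<in> A'"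
  using assms unfolding sets_predictable
proof (rule versions_of_sets[rotated 3])
  fix G assume "G \<in> {A \<times> {0} | A. A \<in> sets (hist 0)} \<union>
      {A \<times> {r<..s} | A r s. 0 \<le> r \<and> r \<le> s \<and> s \<le> T \<and> A \<in> sets (hist r)}"
  then show "\<exists>A'\<in>sets canonical. AE \<omega> in M. \<forall>t\<in>{0<..T}. (\<omega>, t) \<in> G \<longleftrightarrow> (N \<omega>, t) \<in> A'"
  proof
    assume "G \<in> {A \<times> {0} | A. A \<in> sets (hist 0)}"
    then show ?thesis by (intro bexI[of _ "{}"]) auto
  next
    assume "G \<in> {A \<times> {r<..s} | A r s. 0 \<le> r \<and> r \<le> s \<and> s \<le> T \<and> A \<in> sets (hist r)}"
    then show ?thesis using history_interval_version by blast
  qed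
qed (auto simp: N_space)

lemma predictable_mark_set_version:
  assumes "A \<in> sets marked_pred"
  shows "\<exists>A'\<in>sets marked_canonical.
    AE \<omega> in M. \<forall>(t, x)\<in>{0<..T} \<times> UNIV. ((\<omega>, t), x) \<in> A \<longleftrightarrow> ((N \<omega>, t), x) \<in> A'"
proof -
  have A: "A \<in> sigma_sets (space pred \<times> space (borel :: 'u measure))
      {a \<times> b | a b. a \<in> sets pred \<and> b \<in> sets (borel :: 'u measure)}"
    using assms by (simp add: sets_pair_measure)
  have "\<exists>A'\<in>sets marked_canonical.
    AE \<omega> in M. \<forall>x\<in>{0<..T} \<times> UNIV. ((\<omega>, fst x), snd x) \<in> A \<longleftrightarrow> ((N \<omega>, fst x), snd x) \<in> A'"
    using A
  proof (rule versions_of_sets[rotated 3])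
  fix G assume "G \<in> {a \<times> b | a b. a \<in> sets pred \<and> b \<in> sets (borel :: 'u measure)}"
  then obtain a b where G: "G = a \<times> b" "a \<in> sets pred" "b \<in> sets borel" by auto
  obtain a' where a': "a' \<in> sets canonical" "AE \<omega> in M. \<forall>t\<in>{0<..T}. (\<omega>, t) \<in> a \<longleftrightarrow> (N \<omega>, t) \<in> a'"
    using predictable_set_version[OF G(2)] by blast
  have "AE \<omega> in M. \<forall>x\<in>{0<..T} \<times> UNIV. ((\<omega>, fst x), snd x) \<in> G \<longleftrightarrow> ((N \<omega>, fst x), snd x) \<in> a' \<times> b"
    using a'(2) by eventually_elim (auto simp: G)
  then show "\<exists>A'\<in>sets marked_canonical. AE \<omega> in M. \<forall>x\<in>{0<..T} \<times> UNIV.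
      ((\<omega>, fst x), snd x) \<in> G \<longleftrightarrow> ((N \<omega>, fst x), snd x) \<in> A'"
    using a'(1) G(3) by (intro bexI[of _ "a' \<times> b"]) auto
  qed (auto simp: N_space space_pair_measure)
  then show ?thesis by (simp add: split_beta')
qed

text \<open>Every predictable integrand is a canonical predictable function of the random measure, outside a
  null set of \<open>\<omega>\<close> that does not depend on the time \<open>t > 0\<close>. The strong form matters: it gives
  equality almost everywhere for the intensity and for the random measure alike.\<close>

lemma predictable_version:
  fixes \<Phi> :: "('w, 'u) sample \<Rightarrow> 'h::{banach, second_countable_topology}"
  assumes "\<Phi> \<in> borel_measurable marked_pred"
  shows "\<exists>\<phi>\<in>borel_measurable marked_canonical.
    AE \<omega> in M. \<forall>t\<in>{0<..T}. \<forall>x. \<Phi> ((\<omega>, t), x) = \<phi> ((N \<omega>, t), x)"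
proof -
  have "\<exists>\<phi>\<in>borel_measurable marked_canonical.
    AE \<omega> in M. \<forall>z\<in>{0<..T} \<times> UNIV. \<Phi> ((\<omega>, fst z), snd z) = \<phi> ((N \<omega>, fst z), snd z)"
    using assms
    by (rule versions_of_functions)
       (use predictable_mark_set_version in \<open>auto simp: space_pair_measure split_beta'\<close>)
  then show ?thesis by (auto simp: split_beta')
qed

text \<open>A generator $A \times (r, s]$ is only consulted at times $t > r$, while \<open>A\<close> does not see points
  after \<open>r\<close>.\<close>

lemma canonical_set_add_present:
  assumes "A \<in> sets canonical" and \<eta>: "\<eta> \<in> space conf" and z: "t \<in> {0..T}"
  shows "(add_point \<eta> (t, x), t) \<in> A \<longleftrightarrow> (\<eta>, t) \<in> A"
  using assms(1) unfolding sets_canonical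
proof induction
  case (Basic a)
  then obtain A r s where a: "a = A \<times> {r<..s}" and A: "A \<in> sets (past r)" by auto
  have "add_point \<eta> (t, x) \<in> A \<longleftrightarrow> \<eta> \<in> A" if "r < t"
    using A unfolding sets_past
  proof induction
    case (Basic b)
    then obtain B C where b: "b = {\<eta> \<in> space conf. emeasure \<eta> (before r \<inter> B) \<in> C}" "B \<in> sets E" by auto
    have "emeasure (add_point \<eta> (t, x)) (before r \<inter> B) = emeasure \<eta> (before r \<inter> B)"
      using before_sets[OF b(2), of r] that by (simp add: emeasure_add_point sets_config[OF \<eta>])
    then show ?case using \<eta> by (simp add: b add_point_in_configurations)
  qed (use \<eta> in \<open>auto simp: add_point_in_configurations\<close>)
  then show ?case by (auto simp: a)
qed (use \<eta> z in \<open>auto simp: add_point_in_configurations\<close>)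

lemma canonical_mark_set_add_present:
  assumes "A \<in> sets marked_canonical" and \<eta>: "\<eta> \<in> space conf" and z: "t \<in> {0..T}"
  shows "((add_point \<eta> (t, x), t), y) \<in> A \<longleftrightarrow> ((\<eta>, t), y) \<in> A"
  using assms(1) unfolding sets_pair_measure
proof induction
  case (Basic a)
  then show ?case using canonical_set_add_present[OF _ \<eta> z] by auto
qed (use \<eta> z in \<open>auto simp: add_point_in_configurations space_pair_measure\<close>)

lemma canonical_add_present:
  fixes \<phi> :: "'u history_mark \<Rightarrow> 'h::t2_space"
  assumes \<phi>: "\<phi> \<in> borel_measurable marked_canonical" and \<eta>: "\<eta> \<in> space conf" and z: "t \<in> {0..T}"
  shows "\<phi> ((add_point \<eta> (t, x), t), y) = \<phi> ((\<eta>, t), y)"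
proof -
  let ?A = "\<phi> -` {\<phi> ((\<eta>, t), y)} \<inter> space marked_canonical"
  have "?A \<in> sets marked_canonical" using \<phi> by (rule measurable_sets) simp
  from canonical_mark_set_add_present[OF this \<eta> z, of x y]
  show ?thesis using \<eta> z by (auto simp: space_pair_measure add_point_in_configurations)
qed

lemma past_add_point: "(\<lambda>(\<eta>, z). add_point \<eta> z) \<in> measurable (past r \<Otimes>\<^sub>M E) (past r)"
proof (rule measurable_pastI)
  fix B assume B: "B \<in> sets E"
  note [measurable] = before_sets[OF B, of r] past_measurable[OF B, of r]
  have "(\<lambda>(\<eta>, z). emeasure \<eta> (before r \<inter> B) + indicator (before r \<inter> B) z) \<in> borel_measurable (past r \<Otimes>\<^sub>M E)"
    by measurable
  also have "?this \<longleftrightarrow> (\<lambda>x. emeasure (case x of (\<eta>, z) \<Rightarrow> add_point \<eta> z) (before r \<inter> B)) \<in> borel_measurable (past r \<Otimes>\<^sub>M E)"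
    by (rule measurable_cong)
       (auto simp: space_pair_measure sets_config emeasure_add_point before_sets[OF B])
  finally show "(\<lambda>x. emeasure (case x of (\<eta>, z) \<Rightarrow> add_point \<eta> z) (before r \<inter> B)) \<in> borel_measurable (past r \<Otimes>\<^sub>M E)" .
qed (auto simp: space_pair_measure add_point_in_configurations)

text \<open>On the times in $(r, s]$ the canonical \<open>\<sigma>\<close>-algebra contains \<open>past r\<close>.\<close>

lemma canonical_slice:
  assumes r: "0 \<le> r" "r \<le> s" "s \<le> T" and S: "S \<in> sets (past r \<Otimes>\<^sub>M E)"
  shows "{((\<eta>, t), z) | \<eta> t z. (\<eta>, z) \<in> S \<and> t \<in> {r<..s}} \<in> sets (canonical \<Otimes>\<^sub>M E)"
proof -
  have "S \<in> sigma_sets (space (past r) \<times> space E) {a \<times> b | a b. a \<in> sets (past r) \<and> b \<in> sets E}"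
    using S by (simp only: sets_pair_measure)
  then show ?thesis
  proof induction
  case (Basic a)
  then obtain A B where a: "a = A \<times> B" "A \<in> sets (past r)" "B \<in> sets E" by auto
  have "{((\<eta>, t), z) | \<eta> t z. (\<eta>, z) \<in> a \<and> t \<in> {r<..s}} = (A \<times> {r<..s}) \<times> B" by (auto simp: a)
  also have "\<dots> \<in> sets (canonical \<Otimes>\<^sub>M E)" using a r by (intro pair_measureI canonical_basic)
  finally show ?case .
next
  case Empty
  then show ?case by simp
next
  case (Compl a)
  have "{((\<eta>, t), z) | \<eta> t z. (\<eta>, z) \<in> space (past r) \<times> space E - a \<and> t \<in> {r<..s}}
    = ((space conf \<times> {r<..s}) \<times> space E) - {((\<eta>, t), z) | \<eta> t z. (\<eta>, z) \<in> a \<and> t \<in> {r<..s}}"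
    by auto
  also have "\<dots> \<in> sets (canonical \<Otimes>\<^sub>M E)"
    using Compl r canonical_basic[OF r, of "space conf"] sets.top[of "past r"]
    by (intro sets.Diff pair_measureI) auto
  finally show ?case .
next
  case (Union a)
  have "{((\<eta>, t), z) | \<eta> t z. (\<eta>, z) \<in> (\<Union>i. a i) \<and> t \<in> {r<..s}}
    = (\<Union>i. {((\<eta>, t), z) | \<eta> t z. (\<eta>, z) \<in> a i \<and> t \<in> {r<..s}})" by auto
  also have "\<dots> \<in> sets (canonical \<Otimes>\<^sub>M E)" using Union by (intro sets.countable_UN) auto
  finally show ?case .
qed
qed

text \<open>This is why the difference operator preserves predictability.\<close>

lemma canonical_add_point: "(\<lambda>((\<eta>, t), z). (add_point \<eta> z, t)) \<in> measurable (canonical \<Otimes>\<^sub>M E) canonical"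
proof (rule measurable_canonicalI)
  fix A r s assume *: "0 \<le> r" "r \<le> s" "s \<le> T" "A \<in> sets (past r)"
  let ?S = "(\<lambda>(\<eta>, z). add_point \<eta> z) -` A \<inter> space (past r \<Otimes>\<^sub>M E)"
  have "{((\<eta>, t), z) | \<eta> t z. (\<eta>, z) \<in> ?S \<and> t \<in> {r<..s}} \<in> sets (canonical \<Otimes>\<^sub>M E)"
    by (rule canonical_slice[OF *(1-3)]) (rule measurable_sets[OF past_add_point *(4)])
  also have "{((\<eta>, t), z) | \<eta> t z. (\<eta>, z) \<in> ?S \<and> t \<in> {r<..s}}
      = (\<lambda>((\<eta>, t), z). (add_point \<eta> z, t)) -` (A \<times> {r<..s}) \<inter> space (canonical \<Otimes>\<^sub>M E)"
    using * by (auto simp: space_pair_measure)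
  finally show "(\<lambda>((\<eta>, t), z). (add_point \<eta> z, t)) -` (A \<times> {r<..s}) \<inter> space (canonical \<Otimes>\<^sub>M E)
    \<in> sets (canonical \<Otimes>\<^sub>M E)" .
qed (auto simp: space_pair_measure add_point_in_configurations)

end

section \<open>Compensated integrals of canonical integrands\<close>

lemma p_moment_1: "p_moment 1 L f = (\<integral>\<^sup>+ a. ennreal (norm (f a)) \<partial>L)"
  by (simp add: p_moment_def)

lemma p_moment_1_cong_AE:
  assumes "AE x in L. f x = g x"
  shows "p_moment 1 L f = p_moment 1 L g"
  unfolding p_moment_1
proof (rule nn_integral_cong_AE)
  show "AE x in L. ennreal (norm (f x)) = ennreal (norm (g x))"
    using assms by eventually_elim simp
qed

lemma norm_integral_le_nn_integral:
  fixes f :: "'a \<Rightarrow> 'h::{banach, second_countable_topology}"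
  shows "ennreal (norm (integral\<^sup>L L f)) \<le> (\<integral>\<^sup>+ x. ennreal (norm (f x)) \<partial>L)"
  by (cases "integrable L f") (simp_all add: integral_norm_bound_ennreal not_integrable_integral_eq)

context marked_poisson
begin

sublocale time: finite_measure "time_measure T"
  by (rule finite_time_measure)

abbreviation pull :: "('u history_mark \<Rightarrow> 'h) \<Rightarrow> ('w, 'u) sample \<Rightarrow> 'h" where
  "pull \<phi> \<equiv> (\<lambda>((\<omega>, t), x). \<phi> ((N \<omega>, t), x))"

lemma measurable_snd_mark [measurable]: "snd \<in> measurable E borel"
  using measurable_snd[of "time_measure T" \<nu>] measurable_cong_sets[OF refl sets_mark] by blast

lemma canonical_borel_measurable [measurable (raw)]:
  assumes "\<phi> \<in> measurable marked_canonical L"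
    and "f \<in> measurable P conf" "g \<in> measurable P (time_measure T)" "h \<in> measurable P borel"
  shows "(\<lambda>p. \<phi> ((f p, g p), h p)) \<in> measurable P L"
  by (rule measurable_compose[OF _ assms(1)])
     (rule measurable_Pair[OF measurable_into_canonical[OF assms(2,3)] assms(4)])

lemma proc_components [measurable]:
  "(\<lambda>\<zeta>. N (fst (fst \<zeta>))) \<in> measurable proc conf"
  "(\<lambda>\<zeta>. snd (fst \<zeta>)) \<in> measurable proc (time_measure T)"
  "snd \<in> measurable proc (borel :: 'u measure)"
proof -
  have "snd \<in> measurable proc \<nu>" by measurable
  then show "snd \<in> measurable proc (borel :: 'u measure)"
    using measurable_cong_sets[OF refl sets_mark] by blast
qed measurable

lemma pull_measurable_proc:
  assumes "\<phi> \<in> measurable marked_canonical L"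
  shows "pull \<phi> \<in> measurable proc L"
  unfolding split_beta' by (rule canonical_borel_measurable[OF assms]) measurable

lemma section_measurable_E:
  assumes "\<phi> \<in> measurable marked_canonical L" "\<eta> \<in> space conf"
  shows "(\<lambda>z. \<phi> ((\<eta>, fst z), snd z)) \<in> measurable E L"
  using assms(2) by (intro canonical_borel_measurable[OF assms(1)]) measurable

lemma section_measurable_config:
  assumes "\<phi> \<in> measurable marked_canonical L" "\<eta> \<in> space conf"
  shows "(\<lambda>z. \<phi> ((\<eta>, fst z), snd z)) \<in> measurable \<eta> L"
  using section_measurable_E[OF assms] measurable_cong_sets[OF sets_config[OF assms(2)] refl] by blast

lemma nn_integral_proc:
  assumes h [measurable]: "h \<in> borel_measurable (M \<Otimes>\<^sub>M E)"
  shows "(\<integral>\<^sup>+ \<zeta>. h (fst (fst \<zeta>), (snd (fst \<zeta>), snd \<zeta>)) \<partial>proc) = (\<integral>\<^sup>+ \<omega>. \<integral>\<^sup>+ z. h (\<omega>, z) \<partial>E \<partial>M)"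
proof -
  have [measurable]: "(\<lambda>\<zeta>. h (fst (fst \<zeta>), (snd (fst \<zeta>), snd \<zeta>))) \<in> borel_measurable proc"
    by measurable
  have "(\<integral>\<^sup>+ \<zeta>. h (fst (fst \<zeta>), (snd (fst \<zeta>), snd \<zeta>)) \<partial>proc)
    = (\<integral>\<^sup>+ p. \<integral>\<^sup>+ x. h (fst p, (snd p, x)) \<partial>\<nu> \<partial>(M \<Otimes>\<^sub>M time_measure T))"
    by (subst mark.nn_integral_fst[symmetric]) simp_all
  also have "\<dots> = (\<integral>\<^sup>+ \<omega>. \<integral>\<^sup>+ t. \<integral>\<^sup>+ x. h (\<omega>, (t, x)) \<partial>\<nu> \<partial>time_measure T \<partial>M)"
    by (subst time.nn_integral_fst[symmetric]) simp_all
  also have "\<dots> = (\<integral>\<^sup>+ \<omega>. \<integral>\<^sup>+ z. h (\<omega>, z) \<partial>E \<partial>M)"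
  proof (rule nn_integral_cong)
    fix \<omega> assume [measurable]: "\<omega> \<in> space M"
    show "(\<integral>\<^sup>+ t. \<integral>\<^sup>+ x. h (\<omega>, (t, x)) \<partial>\<nu> \<partial>time_measure T) = (\<integral>\<^sup>+ z. h (\<omega>, z) \<partial>E)"
      by (rule mark.nn_integral_fst) measurable
  qed
  finally show ?thesis .
qed

text \<open>The products $(\Omega \times [0,T]) \times U$ and $\Omega \times ([0,T] \times U)$ carry the
  same measure up to the order of the brackets; the first one appears in the definition of
  integrands, the second one in the Mecke formula.\<close>

lemma distr_proc:
  "distr proc (M \<Otimes>\<^sub>M E) (\<lambda>\<zeta>. (fst (fst \<zeta>), (snd (fst \<zeta>), snd \<zeta>))) = M \<Otimes>\<^sub>M E"
proof (rule measure_eqI)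
  fix L assume "L \<in> sets (distr proc (M \<Otimes>\<^sub>M E) (\<lambda>\<zeta>. (fst (fst \<zeta>), (snd (fst \<zeta>), snd \<zeta>))))"
  then have L [measurable]: "L \<in> sets (M \<Otimes>\<^sub>M E)" by simp
  have "emeasure (distr proc (M \<Otimes>\<^sub>M E) (\<lambda>\<zeta>. (fst (fst \<zeta>), (snd (fst \<zeta>), snd \<zeta>)))) L
    = (\<integral>\<^sup>+ \<zeta>. indicator L (fst (fst \<zeta>), (snd (fst \<zeta>), snd \<zeta>)) \<partial>proc)"
    by (subst nn_integral_indicator[symmetric], simp, subst nn_integral_distr) simp_all
  also have "\<dots> = emeasure (M \<Otimes>\<^sub>M E) L"
    by (subst nn_integral_proc) (simp_all add: nn_integral_fst)
  finally show "emeasure (distr proc (M \<Otimes>\<^sub>M E) (\<lambda>\<zeta>. (fst (fst \<zeta>), (snd (fst \<zeta>), snd \<zeta>)))) L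
    = emeasure (M \<Otimes>\<^sub>M E) L" .
qed simp

lemma AE_procI:
  assumes "AE x in M \<Otimes>\<^sub>M E. P x"
  shows "AE \<zeta> in proc. P (fst (fst \<zeta>), (snd (fst \<zeta>), snd \<zeta>))"
  by (rule AE_distrD[where M'="M \<Otimes>\<^sub>M E"]) (measurable, simp only: distr_proc assms)

lemma AE_proc_iff:
  assumes [measurable]: "Measurable.pred (M \<Otimes>\<^sub>M E) P"
  shows "(AE \<zeta> in proc. P (fst (fst \<zeta>), (snd (fst \<zeta>), snd \<zeta>))) \<longleftrightarrow> (AE x in M \<Otimes>\<^sub>M E. P x)"
  using AE_distr_iff[of "\<lambda>\<zeta>. (fst (fst \<zeta>), (snd (fst \<zeta>), snd \<zeta>))" proc "M \<Otimes>\<^sub>M E" P]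
  unfolding distr_proc by simp

sublocale ME: pair_sigma_finite M E ..

lemma null_time_zero: "{0} \<times> UNIV \<in> null_sets E"
proof (rule null_setsI)
  have z: "{0} \<in> sets (time_measure T)"
    using T_pos unfolding time_measure_def by (subst sets_restrict_space_iff) auto
  then show "{0} \<times> UNIV \<in> sets E" using sets.top[of \<nu>] by (intro pair_measureI) auto
  have "emeasure (time_measure T) {0} = 0"
    using T_pos unfolding time_measure_def by (subst emeasure_restrict_space) auto
  then show "emeasure E ({0} \<times> UNIV) = 0"
    using z sets.top[of \<nu>] by (subst mark.emeasure_pair_measure_Times) auto
qed

lemma AE_E_time_pos: "AE z in E. fst z \<in> {0<..T}"
  using AE_not_in[OF null_time_zero] AE_space
  by eventually_elim (auto simp: space_E less_eq_real_def)

text \<open>The Mecke formula carries the null set at time $0$ from the intensity to the random measure.\<close>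

lemma AE_N_time_pos: "AE \<omega> in M. AE z in N \<omega>. fst z \<in> {0<..T}"
proof -
  have [measurable]: "{0} \<times> UNIV \<in> sets E" using null_time_zero by auto
  let ?h = "\<lambda>x :: (real \<times> 'u) measure \<times> (real \<times> 'u). indicator ({0} \<times> UNIV) (snd x) :: ennreal"
  have "(\<integral>\<^sup>+ \<omega>. emeasure (N \<omega>) ({0} \<times> UNIV) \<partial>M) = (\<integral>\<^sup>+ \<omega>. \<integral>\<^sup>+ z. ?h (N \<omega>, z) \<partial>N \<omega> \<partial>M)"
    by (intro nn_integral_cong) (simp add: sets_config[OF N_space])
  also have "\<dots> = (\<integral>\<^sup>+ \<omega>. \<integral>\<^sup>+ z. ?h (add_point (N \<omega>) z, z) \<partial>E \<partial>M)"
    by (rule mecke) measurable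
  also have "\<dots> = 0" using null_time_zero by (simp add: null_setsD1)
  finally have "AE \<omega> in M. emeasure (N \<omega>) ({0} \<times> UNIV) = 0"
    by (subst (asm) nn_integral_0_iff_AE) auto
  then show ?thesis using AE_space
  proof eventually_elim
    case (elim \<omega>)
    then have "{0} \<times> UNIV \<in> null_sets (N \<omega>)" by (intro null_setsI) (simp_all add: sets_config[OF N_space])
    from AE_not_in[OF this] AE_space[of "N \<omega>"] show ?case
      by eventually_elim (use elim in \<open>auto simp: space_config[OF N_space] space_E less_eq_real_def\<close>)
  qed
qed

lemma AE_proc_versionI:
  assumes "AE \<omega> in M. \<forall>t\<in>{0<..T}. \<forall>x. P ((\<omega>, t), x)"
  shows "AE \<zeta> in proc. P \<zeta>"
proof -
  obtain L where L: "{\<omega> \<in> space M. \<not> (\<forall>t\<in>{0<..T}. \<forall>x. P ((\<omega>, t), x))} \<subseteq> L" "emeasure M L = 0" "L \<in> sets M"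
    using assms by (rule AE_E)
  have L0: "AE \<omega> in M. \<omega> \<notin> L" using L by (intro AE_not_in) auto
  have Z [measurable]: "{0} \<times> UNIV \<in> sets E" using null_time_zero by auto
  note [measurable] = L(3)
  have "AE x in M \<Otimes>\<^sub>M E. fst x \<notin> L \<and> snd x \<notin> {0} \<times> UNIV"
  proof (rule ME.AE_pair_measure)
    show "{x \<in> space (M \<Otimes>\<^sub>M E). fst x \<notin> L \<and> snd x \<notin> {0} \<times> UNIV} \<in> sets (M \<Otimes>\<^sub>M E)" by measurable
    show "AE \<omega> in M. AE z in E. fst (\<omega>, z) \<notin> L \<and> snd (\<omega>, z) \<notin> {0} \<times> UNIV"
      using L0 AE_not_in[OF null_time_zero] by auto
  qed
  from AE_procI[OF this] AE_space show ?thesis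
  proof eventually_elim
    case (elim \<zeta>)
    obtain \<omega> t x where \<zeta>: "\<zeta> = ((\<omega>, t), x)" by (metis prod.exhaust)
    have "\<omega> \<in> space M" "t \<in> {0<..T}" "\<omega> \<notin> L" using elim by (auto simp: \<zeta> space_pair_measure)
    then show ?case using L(1) \<zeta> by blast
  qed
qed

text \<open>The norm in $L^1_{\mathrm{pr}}$, written for a canonical integrand.\<close>

definition L1_norm :: "('u history_mark \<Rightarrow> 'h::real_normed_vector) \<Rightarrow> ennreal" where
  "L1_norm \<phi> = (\<integral>\<^sup>+ \<omega>. \<integral>\<^sup>+ z. ennreal (norm (\<phi> ((N \<omega>, fst z), snd z))) \<partial>E \<partial>M)"

lemma nn_integral_pull:
  fixes \<phi> :: "'u history_mark \<Rightarrow> ennreal"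
  assumes [measurable]: "\<phi> \<in> borel_measurable marked_canonical"
  shows "(\<integral>\<^sup>+ \<zeta>. pull \<phi> \<zeta> \<partial>proc) = (\<integral>\<^sup>+ \<omega>. \<integral>\<^sup>+ z. \<phi> ((N \<omega>, fst z), snd z) \<partial>E \<partial>M)"
  using nn_integral_proc[of "\<lambda>(\<omega>, z). \<phi> ((N \<omega>, fst z), snd z)"] by (simp add: split_beta')

lemma L1_norm_eq:
  fixes \<phi> :: "'u history_mark \<Rightarrow> 'h::real_normed_vector"
  assumes [measurable]: "\<phi> \<in> borel_measurable marked_canonical"
  shows "L1_norm \<phi> = p_moment 1 proc (pull \<phi>)"
  using nn_integral_pull[of "\<lambda>x. ennreal (norm (\<phi> x))"] by (simp add: L1_norm_def p_moment_1 split_beta')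

text \<open>By the Mecke formula the left-hand side averages \<open>\<phi>\<close> at a freshly inserted point, and
  \<open>\<phi>\<close> ignores that point because it is predictable.\<close>

lemma jump_sum_compensation:
  fixes \<phi> :: "'u history_mark \<Rightarrow> ennreal"
  assumes [measurable]: "\<phi> \<in> borel_measurable marked_canonical"
  shows "(\<integral>\<^sup>+ \<omega>. \<integral>\<^sup>+ z. \<phi> ((N \<omega>, fst z), snd z) \<partial>N \<omega> \<partial>M) = (\<integral>\<^sup>+ \<omega>. \<integral>\<^sup>+ z. \<phi> ((N \<omega>, fst z), snd z) \<partial>E \<partial>M)"
proof -
  let ?h = "\<lambda>(\<eta>, z). \<phi> ((\<eta>, fst z), snd z)"
  have "(\<integral>\<^sup>+ \<omega>. \<integral>\<^sup>+ z. ?h (N \<omega>, z) \<partial>N \<omega> \<partial>M) = (\<integral>\<^sup>+ \<omega>. \<integral>\<^sup>+ z. ?h (add_point (N \<omega>) z, z) \<partial>E \<partial>M)"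
    by (rule mecke) measurable
  also have "\<dots> = (\<integral>\<^sup>+ \<omega>. \<integral>\<^sup>+ z. ?h (N \<omega>, z) \<partial>E \<partial>M)"
  proof (intro nn_integral_cong)
    fix \<omega> z assume "\<omega> \<in> space M" "z \<in> space E"
    then show "?h (add_point (N \<omega>) z, z) = ?h (N \<omega>, z)"
      using canonical_add_present[OF assms N_space, of \<omega> "fst z" "snd z" "snd z"] by (auto simp: space_E)
  qed
  finally show ?thesis by simp
qed

text \<open>On configurations that are not locally finite the value is a default that makes the function
  measurable.\<close>

definition compensated ::
  "('u history_mark \<Rightarrow> 'h::{banach, second_countable_topology}) \<Rightarrow> (real \<times> 'u) measure \<Rightarrow> 'h" where
  "compensated \<phi> \<eta> = (if locally_finite \<eta>
     then (\<integral> z. \<phi> ((\<eta>, fst z), snd z) \<partial>\<eta>) - (\<integral> z. \<phi> ((\<eta>, fst z), snd z) \<partial>E) else 0)"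

lemma compensated_measurable [measurable]:
  fixes \<phi> :: "'u history_mark \<Rightarrow> 'h::{banach, second_countable_topology}"
  assumes [measurable]: "\<phi> \<in> borel_measurable marked_canonical"
  shows "compensated \<phi> \<in> borel_measurable conf"
proof -
  have "(\<lambda>\<eta>. if locally_finite \<eta> then \<integral> z. \<phi> ((\<eta>, fst z), snd z) \<partial>\<eta> else 0) \<in> borel_measurable conf"
    by (rule borel_measurable_integral_config) measurable
  then have "(\<lambda>\<eta>. (if locally_finite \<eta> then \<integral> z. \<phi> ((\<eta>, fst z), snd z) \<partial>\<eta> else 0)
      - (if locally_finite \<eta> then \<integral> z. \<phi> ((\<eta>, fst z), snd z) \<partial>E else 0)) \<in> borel_measurable conf"
    by measurable
  also have "(\<lambda>\<eta>. (if locally_finite \<eta> then \<integral> z. \<phi> ((\<eta>, fst z), snd z) \<partial>\<eta> else 0)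
      - (if locally_finite \<eta> then \<integral> z. \<phi> ((\<eta>, fst z), snd z) \<partial>E else 0)) = compensated \<phi>"
    by (auto simp: compensated_def fun_eq_iff)
  finally show ?thesis .
qed

lemma mean_jump_sum:
  fixes \<phi> :: "'u history_mark \<Rightarrow> 'h::real_normed_vector"
  assumes [measurable]: "\<phi> \<in> borel_measurable marked_canonical"
  defines "S \<equiv> \<lambda>\<omega>. if locally_finite (N \<omega>) then \<integral>\<^sup>+ z. ennreal (norm (\<phi> ((N \<omega>, fst z), snd z))) \<partial>N \<omega> else 0"
  shows "S \<in> borel_measurable M" and "(\<integral>\<^sup>+ \<omega>. S \<omega> \<partial>M) = L1_norm \<phi>"
proof -
  show "S \<in> borel_measurable M"
    unfolding S_def by (rule borel_measurable_nn_integral_config) measurable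
  have "(\<integral>\<^sup>+ \<omega>. S \<omega> \<partial>M) = (\<integral>\<^sup>+ \<omega>. \<integral>\<^sup>+ z. ennreal (norm (\<phi> ((N \<omega>, fst z), snd z))) \<partial>N \<omega> \<partial>M)"
    unfolding S_def using AE_locally_finite by (intro nn_integral_cong_AE) (auto elim!: eventually_mono)
  also have "\<dots> = L1_norm \<phi>"
    unfolding L1_norm_def using jump_sum_compensation[of "\<lambda>x. ennreal (norm (\<phi> x))"] by simp
  finally show "(\<integral>\<^sup>+ \<omega>. S \<omega> \<partial>M) = L1_norm \<phi>" .
qed

text \<open>The integrals of the norm of \<open>\<phi>\<close> against the random measure and against the intensity have
  the same mean.\<close>

lemma compensated_bound:
  fixes \<phi> :: "'u history_mark \<Rightarrow> 'h::{banach, second_countable_topology}"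
  assumes [measurable]: "\<phi> \<in> borel_measurable marked_canonical"
  shows "(\<integral>\<^sup>+ \<omega>. ennreal (norm (compensated \<phi> (N \<omega>))) \<partial>M) \<le> 2 * L1_norm \<phi>"
proof -
  let ?n = "\<lambda>\<omega> z. ennreal (norm (\<phi> ((N \<omega>, fst z), snd z)))"
  note [measurable] = mean_jump_sum(1)[OF assms(1)]
  have "(\<integral>\<^sup>+ \<omega>. ennreal (norm (compensated \<phi> (N \<omega>))) \<partial>M)
    \<le> (\<integral>\<^sup>+ \<omega>. (if locally_finite (N \<omega>) then \<integral>\<^sup>+ z. ?n \<omega> z \<partial>N \<omega> else 0) + (\<integral>\<^sup>+ z. ?n \<omega> z \<partial>E) \<partial>M)"
  proof (rule nn_integral_mono)
    fix \<omega>
    show "ennreal (norm (compensated \<phi> (N \<omega>)))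
      \<le> (if locally_finite (N \<omega>) then \<integral>\<^sup>+ z. ?n \<omega> z \<partial>N \<omega> else 0) + (\<integral>\<^sup>+ z. ?n \<omega> z \<partial>E)"
    proof (cases "locally_finite (N \<omega>)")
      case True
      have "ennreal (norm (compensated \<phi> (N \<omega>)))
        \<le> ennreal (norm (\<integral> z. \<phi> ((N \<omega>, fst z), snd z) \<partial>N \<omega>) + norm (\<integral> z. \<phi> ((N \<omega>, fst z), snd z) \<partial>E))"
        using True by (simp add: compensated_def ennreal_leI norm_triangle_ineq4 del: ennreal_plus)
      also have "\<dots> \<le> (\<integral>\<^sup>+ z. ?n \<omega> z \<partial>N \<omega>) + (\<integral>\<^sup>+ z. ?n \<omega> z \<partial>E)"
        by (simp add: add_mono norm_integral_le_nn_integral)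
      finally show ?thesis using True by simp
    qed (simp add: compensated_def)
  qed
  also have "\<dots> = (\<integral>\<^sup>+ \<omega>. (if locally_finite (N \<omega>) then \<integral>\<^sup>+ z. ?n \<omega> z \<partial>N \<omega> else 0) \<partial>M) + L1_norm \<phi>"
    unfolding L1_norm_def by (rule nn_integral_add) measurable
  finally show ?thesis by (simp add: mean_jump_sum(2)[OF assms(1)] mult_2)
qed

lemma AE_integrable:
  fixes \<phi> :: "'u history_mark \<Rightarrow> 'h::{banach, second_countable_topology}"
  assumes [measurable]: "\<phi> \<in> borel_measurable marked_canonical" and fin: "L1_norm \<phi> < \<infinity>"
  shows "AE \<omega> in M. integrable (N \<omega>) (\<lambda>z. \<phi> ((N \<omega>, fst z), snd z))"
    and "AE \<omega> in M. integrable E (\<lambda>z. \<phi> ((N \<omega>, fst z), snd z))"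
proof -
  let ?n = "\<lambda>\<omega> z. ennreal (norm (\<phi> ((N \<omega>, fst z), snd z)))"
  have "AE \<omega> in M. (\<integral>\<^sup>+ z. ?n \<omega> z \<partial>E) \<noteq> \<infinity>"
    using fin unfolding L1_norm_def by (intro nn_integral_PInf_AE) auto
  then show "AE \<omega> in M. integrable E (\<lambda>z. \<phi> ((N \<omega>, fst z), snd z))"
    using AE_space
    by eventually_elim (auto intro!: integrableI_bounded section_measurable_E[OF assms(1)] N_space simp: less_top)
  note [measurable] = mean_jump_sum(1)[OF assms(1)]
  have "AE \<omega> in M. (if locally_finite (N \<omega>) then \<integral>\<^sup>+ z. ?n \<omega> z \<partial>N \<omega> else 0) \<noteq> \<infinity>"
    using fin by (intro nn_integral_PInf_AE) (simp_all add: mean_jump_sum[OF assms(1)])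
  then show "AE \<omega> in M. integrable (N \<omega>) (\<lambda>z. \<phi> ((N \<omega>, fst z), snd z))"
    using AE_space AE_locally_finite
    by eventually_elim (auto intro!: integrableI_bounded section_measurable_config[OF assms(1)] N_space simp: less_top)
qed

lemma compensated_linear:
  fixes \<phi> \<psi> :: "'u history_mark \<Rightarrow> 'h::{banach, second_countable_topology}"
  assumes \<phi>: "\<phi> \<in> borel_measurable marked_canonical" "L1_norm \<phi> < \<infinity>"
    and \<psi>: "\<psi> \<in> borel_measurable marked_canonical" "L1_norm \<psi> < \<infinity>"
  shows "AE \<omega> in M. compensated (\<lambda>\<zeta>. a *\<^sub>R \<phi> \<zeta> + b *\<^sub>R \<psi> \<zeta>) (N \<omega>)
    = a *\<^sub>R compensated \<phi> (N \<omega>) + b *\<^sub>R compensated \<psi> (N \<omega>)"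
  using AE_integrable[OF \<phi>] AE_integrable[OF \<psi>] AE_locally_finite
  by eventually_elim (simp add: compensated_def algebra_simps)

text \<open>The bound applied to the difference of two integrands that are equal almost everywhere.\<close>

lemma compensated_cong:
  fixes \<phi> \<psi> :: "'u history_mark \<Rightarrow> 'h::{banach, second_countable_topology}"
  assumes \<phi>: "\<phi> \<in> borel_measurable marked_canonical" "L1_norm \<phi> < \<infinity>"
    and \<psi>: "\<psi> \<in> borel_measurable marked_canonical"
    and eq: "AE \<zeta> in proc. pull \<phi> \<zeta> = pull \<psi> \<zeta>"
  shows "AE \<omega> in M. compensated \<phi> (N \<omega>) = compensated \<psi> (N \<omega>)"
proof -
  note [measurable] = \<phi>(1) \<psi>(1)
  have "L1_norm \<psi> = L1_norm \<phi>"
    unfolding L1_norm_eq[OF \<phi>(1)] L1_norm_eq[OF \<psi>(1)] p_moment_1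
    using eq by (intro nn_integral_cong_AE) (auto elim!: eventually_mono)
  then have s\<psi>: "L1_norm \<psi> < \<infinity>" using \<phi>(2) by simp
  let ?d = "\<lambda>\<zeta>. 1 *\<^sub>R \<phi> \<zeta> + (-1) *\<^sub>R \<psi> \<zeta>"
  have "AE \<zeta> in proc. ennreal (norm (pull ?d \<zeta>)) = 0"
    using eq by eventually_elim (simp add: split_beta')
  then have "p_moment 1 proc (pull ?d) = (\<integral>\<^sup>+ \<zeta>. 0 \<partial>proc)"
    unfolding p_moment_1 by (rule nn_integral_cong_AE)
  moreover have "L1_norm ?d = p_moment 1 proc (pull ?d)" by (rule L1_norm_eq) measurable
  ultimately have "L1_norm ?d = 0" by simp
  then have "(\<integral>\<^sup>+ \<omega>. ennreal (norm (compensated ?d (N \<omega>))) \<partial>M) = 0"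
    using compensated_bound[of ?d] by simp
  then have "AE \<omega> in M. compensated ?d (N \<omega>) = 0"
    by (subst (asm) nn_integral_0_iff_AE) auto
  with compensated_linear[OF \<phi> \<psi> s\<psi>, of 1 "-1"] show ?thesis
    by eventually_elim simp
qed

text \<open>Equality at all positive times, not merely almost everywhere, so that a version can be
  integrated against the random measure in place of \<open>\<Phi>\<close>.\<close>

definition is_version ::
  "(('w, 'u) sample \<Rightarrow> 'h::{banach, second_countable_topology}) \<Rightarrow>
   ('u history_mark \<Rightarrow> 'h) \<Rightarrow> bool" where
  "is_version \<Phi> \<phi> \<longleftrightarrow> \<phi> \<in> borel_measurable marked_canonical \<and>
     (AE \<omega> in M. \<forall>t\<in>{0<..T}. \<forall>x. \<Phi> ((\<omega>, t), x) = \<phi> ((N \<omega>, t), x))"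

lemma is_version_AE: "is_version \<Phi> \<phi> \<Longrightarrow> AE \<zeta> in proc. \<Phi> \<zeta> = pull \<phi> \<zeta>"
  unfolding is_version_def by (intro AE_proc_versionI) auto

lemma version_exists:
  "\<Phi> \<in> L1_pr \<Longrightarrow> \<exists>\<phi>. is_version \<Phi> \<phi> \<and> L1_norm \<phi> < \<infinity>"
proof -
  assume \<Phi>: "\<Phi> \<in> L1_pr"
  then obtain \<phi> where \<phi>: "is_version \<Phi> \<phi>"
    using predictable_version[of \<Phi>] by (auto simp: Lp_pr_def is_version_def)
  have "L1_norm \<phi> = p_moment 1 proc \<Phi>"
    using is_version_AE[OF \<phi>] \<phi> unfolding is_version_def
    by (subst L1_norm_eq) (auto simp: p_moment_1 intro!: nn_integral_cong_AE elim!: eventually_mono)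
  then show ?thesis using \<Phi> \<phi> by (auto simp: Lp_pr_def)
qed

lemma pull_Lp_pr:
  assumes \<phi>: "\<phi> \<in> borel_measurable marked_canonical" and fin: "L1_norm \<phi> < \<infinity>"
  shows "pull \<phi> \<in> L1_pr"
proof -
  have "(\<lambda>\<zeta>. ((\<lambda>(\<omega>, t). (N \<omega>, t)) (fst \<zeta>), snd \<zeta>)) \<in> measurable marked_pred marked_canonical"
    by (intro measurable_Pair measurable_compose[OF measurable_fst predictable_to_canonical] measurable_snd)
  from measurable_compose[OF this \<phi>] have "pull \<phi> \<in> borel_measurable marked_pred"
    by (simp add: split_beta')
  then show ?thesis using fin by (simp add: Lp_pr_def L1_norm_eq[OF \<phi>])
qed

text \<open>The choice of the version only matters on a null set (\<open>pathwise_eq\<close>).\<close>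

definition pathwise :: "(('w, 'u) sample \<Rightarrow> 'h::{banach, second_countable_topology}) \<Rightarrow> 'w \<Rightarrow> 'h" where
  "pathwise \<Phi> \<omega> = compensated (SOME \<phi>. is_version \<Phi> \<phi> \<and> L1_norm \<phi> < \<infinity>) (N \<omega>)"

lemma pathwise_eq:
  assumes "is_version \<Phi> \<phi>" "L1_norm \<phi> < \<infinity>"
  shows "AE \<omega> in M. pathwise \<Phi> \<omega> = compensated \<phi> (N \<omega>)"
proof -
  define \<psi> where "\<psi> = (SOME \<phi>. is_version \<Phi> \<phi> \<and> L1_norm \<phi> < \<infinity>)"
  have "is_version \<Phi> \<psi> \<and> L1_norm \<psi> < \<infinity>" unfolding \<psi>_def by (rule someI[where x=\<phi>]) (intro conjI assms)
  moreover have "AE \<zeta> in proc. pull \<psi> \<zeta> = pull \<phi> \<zeta>"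
    using is_version_AE[OF conjunct1[OF calculation]] is_version_AE[OF assms(1)] by eventually_elim simp
  ultimately have "AE \<omega> in M. compensated \<psi> (N \<omega>) = compensated \<phi> (N \<omega>)"
    using assms by (intro compensated_cong) (simp_all add: is_version_def)
  then show ?thesis unfolding pathwise_def \<psi>_def[symmetric] .
qed

lemma is_version_linear:
  assumes "is_version \<Phi> \<phi>" "is_version \<Psi> \<psi>"
  shows "is_version (\<lambda>\<zeta>. a *\<^sub>R \<Phi> \<zeta> + b *\<^sub>R \<Psi> \<zeta>) (\<lambda>\<zeta>. a *\<^sub>R \<phi> \<zeta> + b *\<^sub>R \<psi> \<zeta>)"
proof -
  have [measurable]: "\<phi> \<in> borel_measurable marked_canonical" "\<psi> \<in> borel_measurable marked_canonical"
    using assms by (auto simp: is_version_def)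
  have "AE \<omega> in M. \<forall>t\<in>{0<..T}. \<forall>x. \<Phi> ((\<omega>, t), x) = \<phi> ((N \<omega>, t), x)"
    "AE \<omega> in M. \<forall>t\<in>{0<..T}. \<forall>x. \<Psi> ((\<omega>, t), x) = \<psi> ((N \<omega>, t), x)"
    using assms by (auto simp: is_version_def)
  then have "AE \<omega> in M. \<forall>t\<in>{0<..T}. \<forall>x. a *\<^sub>R \<Phi> ((\<omega>, t), x) + b *\<^sub>R \<Psi> ((\<omega>, t), x)
     = a *\<^sub>R \<phi> ((N \<omega>, t), x) + b *\<^sub>R \<psi> ((N \<omega>, t), x)"
    by eventually_elim simp
  then show ?thesis by (simp add: is_version_def)
qed

lemma L1_norm_linear:
  fixes \<phi> \<psi> :: "'u history_mark \<Rightarrow> 'h::{banach, second_countable_topology}"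
  assumes [measurable]: "\<phi> \<in> borel_measurable marked_canonical" "\<psi> \<in> borel_measurable marked_canonical"
    and fin: "L1_norm \<phi> < \<infinity>" "L1_norm \<psi> < \<infinity>"
  shows "L1_norm (\<lambda>\<zeta>. a *\<^sub>R \<phi> \<zeta> + b *\<^sub>R \<psi> \<zeta>) < \<infinity>"
proof -
  let ?n = "\<lambda>\<phi> \<zeta>. ennreal (norm (pull \<phi> \<zeta> :: 'h))"
  have mn [measurable]: "?n \<phi> \<in> borel_measurable proc" "?n \<psi> \<in> borel_measurable proc"
    using pull_measurable_proc[OF assms(1)] pull_measurable_proc[OF assms(2)] by simp_all
  have "L1_norm (\<lambda>\<zeta>. a *\<^sub>R \<phi> \<zeta> + b *\<^sub>R \<psi> \<zeta>) = (\<integral>\<^sup>+ \<zeta>. ennreal (norm (a *\<^sub>R pull \<phi> \<zeta> + b *\<^sub>R pull \<psi> \<zeta>)) \<partial>proc)"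
    by (subst L1_norm_eq) (auto simp: p_moment_1 intro!: nn_integral_cong)
  also have "\<dots> \<le> (\<integral>\<^sup>+ \<zeta>. ennreal \<bar>a\<bar> * ?n \<phi> \<zeta> + ennreal \<bar>b\<bar> * ?n \<psi> \<zeta> \<partial>proc)"
  proof (rule nn_integral_mono)
    fix \<zeta>
    have "norm (a *\<^sub>R pull \<phi> \<zeta> + b *\<^sub>R pull \<psi> \<zeta>) \<le> \<bar>a\<bar> * norm (pull \<phi> \<zeta>) + \<bar>b\<bar> * norm (pull \<psi> \<zeta>)"
      by (rule order_trans[OF norm_triangle_ineq]) simp
    then show "ennreal (norm (a *\<^sub>R pull \<phi> \<zeta> + b *\<^sub>R pull \<psi> \<zeta>)) \<le> ennreal \<bar>a\<bar> * ?n \<phi> \<zeta> + ennreal \<bar>b\<bar> * ?n \<psi> \<zeta>"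
      by (simp add: ennreal_mult[symmetric] ennreal_plus[symmetric] ennreal_leI del: ennreal_plus)
  qed
  also have "\<dots> = ennreal \<bar>a\<bar> * L1_norm \<phi> + ennreal \<bar>b\<bar> * L1_norm \<psi>"
    unfolding L1_norm_eq[OF assms(1)] L1_norm_eq[OF assms(2)] p_moment_1
      nn_integral_cmult[OF mn(1), symmetric] nn_integral_cmult[OF mn(2), symmetric]
    by (rule nn_integral_add) measurable
  also have "\<dots> < \<infinity>" using fin by (simp add: ennreal_mult_less_top)
  finally show ?thesis .
qed

end

section \<open>Existence and uniqueness of the stochastic integral\<close>

context marked_poisson
begin

lemma pathwise_Lp:
  fixes \<Phi> :: "('w, 'u) sample \<Rightarrow> 'h::{banach, second_countable_topology}"
  assumes "\<Phi> \<in> L1_pr" shows "pathwise \<Phi> \<in> Lp 1 M"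
proof -
  define \<phi> where "\<phi> = (SOME \<phi>. is_version \<Phi> \<phi> \<and> L1_norm \<phi> < \<infinity>)"
  have \<phi>: "is_version \<Phi> \<phi> \<and> L1_norm \<phi> < \<infinity>"
    unfolding \<phi>_def by (rule someI_ex[OF version_exists[OF assms]])
  then have [measurable]: "\<phi> \<in> borel_measurable marked_canonical" by (simp add: is_version_def)
  have "(\<integral>\<^sup>+ \<omega>. ennreal (norm (compensated \<phi> (N \<omega>))) \<partial>M) \<le> 2 * L1_norm \<phi>"
    by (rule compensated_bound) measurable
  also have "\<dots> < \<infinity>" using \<phi> by (simp add: ennreal_mult_less_top)
  finally have "p_moment 1 M (\<lambda>\<omega>. compensated \<phi> (N \<omega>)) < \<infinity>" by (simp add: p_moment_1)
  then show ?thesis unfolding pathwise_def[abs_def] \<phi>_def[symmetric] Lp_def by simp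
qed

lemma pathwise_linear:
  fixes \<Phi> \<Psi> :: "('w, 'u) sample \<Rightarrow> 'h::{banach, second_countable_topology}"
  assumes "\<Phi> \<in> L1_pr" "\<Psi> \<in> L1_pr"
  shows "AE \<omega> in M. pathwise (\<lambda>\<zeta>. a *\<^sub>R \<Phi> \<zeta> + b *\<^sub>R \<Psi> \<zeta>) \<omega> = a *\<^sub>R pathwise \<Phi> \<omega> + b *\<^sub>R pathwise \<Psi> \<omega>"
proof -
  obtain \<phi> \<psi> where \<phi>: "is_version \<Phi> \<phi>" "L1_norm \<phi> < \<infinity>" and \<psi>: "is_version \<Psi> \<psi>" "L1_norm \<psi> < \<infinity>"
    using version_exists[OF assms(1)] version_exists[OF assms(2)] by auto
  have m: "\<phi> \<in> borel_measurable marked_canonical" "\<psi> \<in> borel_measurable marked_canonical"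
    using \<phi> \<psi> by (auto simp: is_version_def)
  show ?thesis
    using pathwise_eq[OF is_version_linear[OF \<phi>(1) \<psi>(1)] L1_norm_linear[OF m \<phi>(2) \<psi>(2)], of a b]
      pathwise_eq[OF \<phi>] pathwise_eq[OF \<psi>] compensated_linear[OF m(1) \<phi>(2) m(2) \<psi>(2), of a b]
    by eventually_elim simp
qed

lemma Lp_pr_linear:
  fixes \<Phi> \<Psi> :: "('w, 'u) sample \<Rightarrow> 'h::{banach, second_countable_topology}"
  assumes "\<Phi> \<in> L1_pr" "\<Psi> \<in> L1_pr"
  shows "(\<lambda>\<zeta>. a *\<^sub>R \<Phi> \<zeta> + b *\<^sub>R \<Psi> \<zeta>) \<in> L1_pr"
proof -
  obtain \<phi> \<psi> where \<phi>: "is_version \<Phi> \<phi>" "L1_norm \<phi> < \<infinity>" and \<psi>: "is_version \<Psi> \<psi>" "L1_norm \<psi> < \<infinity>"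
    using version_exists[OF assms(1)] version_exists[OF assms(2)] by auto
  have m: "\<phi> \<in> borel_measurable marked_canonical" "\<psi> \<in> borel_measurable marked_canonical"
    using \<phi> \<psi> by (auto simp: is_version_def)
  note v = is_version_linear[OF \<phi>(1) \<psi>(1), of a b]
  have "p_moment 1 proc (\<lambda>\<zeta>. a *\<^sub>R \<Phi> \<zeta> + b *\<^sub>R \<Psi> \<zeta>) = p_moment 1 proc (pull (\<lambda>\<zeta>. a *\<^sub>R \<phi> \<zeta> + b *\<^sub>R \<psi> \<zeta>))"
    by (rule p_moment_1_cong_AE[OF is_version_AE[OF v]])
  also have "\<dots> = L1_norm (\<lambda>\<zeta>. a *\<^sub>R \<phi> \<zeta> + b *\<^sub>R \<psi> \<zeta>)"
    by (rule L1_norm_eq[symmetric], rule conjunct1[OF v[unfolded is_version_def]])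
  also have "\<dots> < \<infinity>" by (rule L1_norm_linear[OF m \<phi>(2) \<psi>(2)])
  finally have fin: "p_moment 1 proc (\<lambda>\<zeta>. a *\<^sub>R \<Phi> \<zeta> + b *\<^sub>R \<Psi> \<zeta>) < \<infinity>" .
  have "\<Phi> \<in> borel_measurable marked_pred" "\<Psi> \<in> borel_measurable marked_pred"
    using assms by (simp_all add: Lp_pr_def)
  then have "(\<lambda>\<zeta>. a *\<^sub>R \<Phi> \<zeta> + b *\<^sub>R \<Psi> \<zeta>) \<in> borel_measurable marked_pred"
    by (intro borel_measurable_add borel_measurable_scaleR borel_measurable_const)
  then show ?thesis unfolding Lp_pr_def using fin by (intro CollectI conjI)
qed

lemma pathwise_bound:
  fixes \<Phi> :: "('w, 'u) sample \<Rightarrow> 'h::{banach, second_countable_topology}"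
  assumes "\<Phi> \<in> L1_pr"
  shows "p_moment 1 M (pathwise \<Phi>) \<le> 2 * p_moment 1 proc \<Phi>"
proof -
  obtain \<phi> where \<phi>: "is_version \<Phi> \<phi>" "L1_norm \<phi> < \<infinity>" using version_exists[OF assms] by auto
  then have m [measurable]: "\<phi> \<in> borel_measurable marked_canonical" by (simp add: is_version_def)
  have "p_moment 1 M (pathwise \<Phi>) = p_moment 1 M (\<lambda>\<omega>. compensated \<phi> (N \<omega>))"
    by (rule p_moment_1_cong_AE[OF pathwise_eq[OF \<phi>]])
  also have "\<dots> = (\<integral>\<^sup>+ \<omega>. ennreal (norm (compensated \<phi> (N \<omega>))) \<partial>M)" by (rule p_moment_1)
  also have "\<dots> \<le> 2 * L1_norm \<phi>" by (rule compensated_bound[OF m])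
  also have "L1_norm \<phi> = p_moment 1 proc \<Phi>"
    unfolding L1_norm_eq[OF m] by (rule p_moment_1_cong_AE[OF is_version_AE[OF \<phi>(1)], symmetric])
  finally show ?thesis .
qed

lemma pathwise_continuous:
  fixes \<Phi> :: "('w, 'u) sample \<Rightarrow> 'h::{banach, second_countable_topology}"
  assumes \<Phi>: "\<Phi> \<in> L1_pr" and \<Phi>s: "\<And>n. \<Phi>s n \<in> L1_pr"
    and lim: "(\<lambda>n. p_moment 1 proc (\<lambda>\<zeta>. \<Phi>s n \<zeta> - \<Phi> \<zeta>)) \<longlonglongrightarrow> 0"
  shows "(\<lambda>n. p_moment 1 M (\<lambda>\<omega>. pathwise (\<Phi>s n) \<omega> - pathwise \<Phi> \<omega>)) \<longlonglongrightarrow> 0"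
proof (rule tendsto_sandwich[OF _ _ tendsto_const])
  show "\<forall>\<^sub>F n in sequentially. p_moment 1 M (\<lambda>\<omega>. pathwise (\<Phi>s n) \<omega> - pathwise \<Phi> \<omega>)
     \<le> 2 * p_moment 1 proc (\<lambda>\<zeta>. \<Phi>s n \<zeta> - \<Phi> \<zeta>)"
  proof (intro always_eventually allI)
    fix n
    have "p_moment 1 M (\<lambda>\<omega>. pathwise (\<Phi>s n) \<omega> - pathwise \<Phi> \<omega>)
      = p_moment 1 M (pathwise (\<lambda>\<zeta>. 1 *\<^sub>R \<Phi>s n \<zeta> + (-1) *\<^sub>R \<Phi> \<zeta>))"
    proof (rule p_moment_1_cong_AE)
      show "AE \<omega> in M. pathwise (\<Phi>s n) \<omega> - pathwise \<Phi> \<omega> = pathwise (\<lambda>\<zeta>. 1 *\<^sub>R \<Phi>s n \<zeta> + (-1) *\<^sub>R \<Phi> \<zeta>) \<omega>"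
        using pathwise_linear[OF \<Phi>s[of n] \<Phi>, of 1 "-1"] by eventually_elim simp
    qed
    also have "\<dots> \<le> 2 * p_moment 1 proc (\<lambda>\<zeta>. 1 *\<^sub>R \<Phi>s n \<zeta> + (-1) *\<^sub>R \<Phi> \<zeta>)"
      by (rule pathwise_bound[OF Lp_pr_linear[OF \<Phi>s \<Phi>]])
    finally show "p_moment 1 M (\<lambda>\<omega>. pathwise (\<Phi>s n) \<omega> - pathwise \<Phi> \<omega>)
     \<le> 2 * p_moment 1 proc (\<lambda>\<zeta>. \<Phi>s n \<zeta> - \<Phi> \<zeta>)" by simp
  qed
  show "(\<lambda>n. 2 * p_moment 1 proc (\<lambda>\<zeta>. \<Phi>s n \<zeta> - \<Phi> \<zeta>)) \<longlonglongrightarrow> 0"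
    using ennreal_tendsto_cmult[OF _ lim, of 2] by simp
qed simp

abbreviation elementary :: "real \<Rightarrow> real \<Rightarrow> 'u set \<Rightarrow> ('w \<Rightarrow> 'h::real_normed_vector) \<Rightarrow> ('w, 'u) sample \<Rightarrow> 'h" where
  "elementary r s B F \<equiv> (\<lambda>((\<omega>, t), x). indicator ({r<..s} \<times> B) (t, x) *\<^sub>R F \<omega>)"

lemma elementary_measurable:
  fixes F :: "'w \<Rightarrow> 'h::{banach, second_countable_topology}"
  assumes r: "0 \<le> r" "r \<le> s" "s \<le> T" and F: "F \<in> borel_measurable (hist r)"
    and B [measurable]: "B \<in> sets borel"
  shows "elementary r s B F \<in> borel_measurable marked_pred"
proof -
  have pos: "A \<times> {r<..s} \<in> sets pred" if "A \<in> sets (hist r)" for A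
    unfolding sets_predictable using r that by (intro sigma_sets.Basic) blast
  have g: "(\<lambda>p. indicator {r<..s} (snd p) *\<^sub>R F (fst p)) \<in> borel_measurable pred"
  proof (rule measurableI)
    fix C :: "'h set" assume C: "C \<in> sets borel"
    let ?P = "(F -` C \<inter> space M) \<times> {r<..s}"
    have P: "?P \<in> sets pred" using measurable_sets[OF F C] by (intro pos) simp
    have Q: "space pred - space M \<times> {r<..s} \<in> sets pred"
      using pos[of "space M"] sets.top[of "hist r"] by (intro sets.Diff sets.top) auto
    have "(\<lambda>p. indicator {r<..s} (snd p) *\<^sub>R F (fst p)) -` C \<inter> space pred
      = ?P \<union> (if 0 \<in> C then space pred - space M \<times> {r<..s} else {})"
      using r by (auto split: split_indicator split_indicator_asm if_splits)
    then show "(\<lambda>p. indicator {r<..s} (snd p) *\<^sub>R F (fst p)) -` C \<inter> space pred \<in> sets pred"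
      using P Q by auto
  qed simp
  have "(\<lambda>\<zeta>. indicator B (snd \<zeta>) *\<^sub>R (indicator {r<..s} (snd (fst \<zeta>)) *\<^sub>R F (fst (fst \<zeta>)))) \<in> borel_measurable marked_pred"
  proof (rule borel_measurable_scaleR)
    show "(\<lambda>\<zeta>. indicator B (snd \<zeta>) :: real) \<in> borel_measurable marked_pred" by measurable
    show "(\<lambda>\<zeta>. indicator {r<..s} (snd (fst \<zeta>)) *\<^sub>R F (fst (fst \<zeta>))) \<in> borel_measurable marked_pred"
      using measurable_compose[OF measurable_fst g] .
  qed
  also have "(\<lambda>\<zeta>. indicator B (snd \<zeta>) *\<^sub>R (indicator {r<..s} (snd (fst \<zeta>)) *\<^sub>R F (fst (fst \<zeta>)))) = elementary r s B F"
    by (auto simp: fun_eq_iff indicator_def)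
  finally show ?thesis .
qed

lemma rectangle_E:
  assumes r: "0 \<le> r" "r \<le> s" "s \<le> T" and B: "B \<in> sets borel" "emeasure \<nu> B < \<infinity>"
  shows "{r<..s} \<times> B \<in> sets E" "emeasure E ({r<..s} \<times> B) < \<infinity>"
proof -
  have B': "B \<in> sets \<nu>" using B sets_mark by simp
  note i = interval_time_measure[OF r(1,3)]
  show "{r<..s} \<times> B \<in> sets E" by (rule pair_measureI[OF i B'])
  have "emeasure E ({r<..s} \<times> B) = emeasure (time_measure T) {r<..s} * emeasure \<nu> B"
    by (rule mark.emeasure_pair_measure_Times[OF i B'])
  also have "\<dots> < \<infinity>"
  proof -
    have "emeasure (time_measure T) {r<..s} < \<infinity>" using time.emeasure_finite[of "{r<..s}"] by (simp add: less_top[symmetric] del: time.emeasure_finite)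
    then show ?thesis using B(2) by (simp add: ennreal_mult_less_top)
  qed
  finally show "emeasure E ({r<..s} \<times> B) < \<infinity>" .
qed

lemma elementary_Lp_pr:
  fixes F :: "'w \<Rightarrow> 'h::{banach, second_countable_topology}"
  assumes r: "0 \<le> r" "r \<le> s" "s \<le> T" and F: "F \<in> borel_measurable (hist r)"
    and bd: "bounded (F ` space M)" and B: "B \<in> sets borel" "emeasure \<nu> B < \<infinity>"
  shows "elementary r s B F \<in> L1_pr"
proof -
  obtain c where c: "c > 0" "\<And>\<omega>. \<omega> \<in> space M \<Longrightarrow> norm (F \<omega>) \<le> c"
    using bd by (auto simp: bounded_pos)
  note R [measurable] = rectangle_E[OF r B]
  have "p_moment 1 proc (elementary r s B F) \<le> (\<integral>\<^sup>+ \<zeta>. ennreal c * indicator ({r<..s} \<times> B) (snd (fst \<zeta>), snd \<zeta>) \<partial>proc)"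
    unfolding p_moment_1
  proof (rule nn_integral_mono)
    fix \<zeta> assume "\<zeta> \<in> space proc"
    then have "norm (F (fst (fst \<zeta>))) \<le> c" using c by (auto simp: space_pair_measure)
    then show "ennreal (norm (elementary r s B F \<zeta>)) \<le> ennreal c * indicator ({r<..s} \<times> B) (snd (fst \<zeta>), snd \<zeta>)"
      by (auto simp: split_beta' indicator_def ennreal_leI)
  qed
  also have "\<dots> = (\<integral>\<^sup>+ \<omega>. \<integral>\<^sup>+ z. ennreal c * indicator ({r<..s} \<times> B) z \<partial>E \<partial>M)"
    using nn_integral_proc[of "\<lambda>x. ennreal c * indicator ({r<..s} \<times> B) (snd x)"] R by simp
  also have "\<dots> = ennreal c * emeasure E ({r<..s} \<times> B)"
    using R by (subst nn_integral_cmult_indicator) (simp_all add: emeasure_space_1)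
  also have "\<dots> < \<infinity>" using R by (simp add: ennreal_mult_less_top)
  finally show ?thesis using elementary_measurable[OF r F B(1)] by (simp add: Lp_pr_def)
qed

text \<open>The version of an elementary integrand agrees with it at all positive times, hence almost
  everywhere for both measures, and the integral of a rectangle is its measure.\<close>

lemma pathwise_elementary:
  fixes F :: "'w \<Rightarrow> 'h::{banach, second_countable_topology}"
  assumes r: "0 \<le> r" "r \<le> s" "s \<le> T" and F: "F \<in> borel_measurable (hist r)"
    and bd: "bounded (F ` space M)" and B: "B \<in> sets borel" "emeasure \<nu> B < \<infinity>"
  shows "AE \<omega> in M. pathwise (elementary r s B F) \<omega>
    = (measure (N \<omega>) ({r<..s} \<times> B) - measure E ({r<..s} \<times> B)) *\<^sub>R F \<omega>"
proof -
  let ?R = "{r<..s} \<times> B"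
  note R [measurable] = rectangle_E[OF r B]
  obtain \<phi> where \<phi>: "is_version (elementary r s B F) \<phi>" "L1_norm \<phi> < \<infinity>"
    using version_exists[OF elementary_Lp_pr[OF assms]] by auto
  then have m: "\<phi> \<in> borel_measurable marked_canonical"
    and v: "AE \<omega> in M. \<forall>t\<in>{0<..T}. \<forall>x. elementary r s B F ((\<omega>, t), x) = \<phi> ((N \<omega>, t), x)"
    by (auto simp: is_version_def)
  have "AE \<omega> in M. emeasure (N \<omega>) ?R < \<infinity>" by (rule count_finite_AE[OF R])
  with pathwise_eq[OF \<phi>] v AE_N_time_pos AE_locally_finite show ?thesis
    using AE_space
  proof eventually_elim
    case (elim \<omega>)
    note \<omega> = N_space[OF elim(6)]
    have int: "(\<integral> z. indicator ?R z *\<^sub>R F \<omega> \<partial>L) = measure L ?R *\<^sub>R F \<omega>"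
      if "emeasure L ?R < \<infinity>" "?R \<in> sets L" for L
      using that sets.sets_into_space[OF that(2)] by (simp add: Int_absorb2)
    have "(\<integral> z. \<phi> ((N \<omega>, fst z), snd z) \<partial>N \<omega>) = (\<integral> z. indicator ?R z *\<^sub>R F \<omega> \<partial>N \<omega>)"
    proof (rule integral_cong_AE)
      show "(\<lambda>z. \<phi> ((N \<omega>, fst z), snd z)) \<in> borel_measurable (N \<omega>)" by (rule section_measurable_config[OF m \<omega>])
      show "(\<lambda>z. indicator ?R z *\<^sub>R F \<omega>) \<in> borel_measurable (N \<omega>)"
        using R(1) sets_config[OF \<omega>] by (intro borel_measurable_scaleR borel_measurable_indicator) auto
      show "AE z in N \<omega>. \<phi> ((N \<omega>, fst z), snd z) = indicator ?R z *\<^sub>R F \<omega>"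
        using elim(3) by eventually_elim (use elim(2) in \<open>auto simp: split_beta'\<close>)
    qed
    also have "\<dots> = measure (N \<omega>) ?R *\<^sub>R F \<omega>" using elim R sets_config[OF \<omega>] by (intro int) auto
    finally have 1: "(\<integral> z. \<phi> ((N \<omega>, fst z), snd z) \<partial>N \<omega>) = measure (N \<omega>) ?R *\<^sub>R F \<omega>" .
    have "(\<integral> z. \<phi> ((N \<omega>, fst z), snd z) \<partial>E) = (\<integral> z. indicator ?R z *\<^sub>R F \<omega> \<partial>E)"
    proof (rule integral_cong_AE)
      show "(\<lambda>z. \<phi> ((N \<omega>, fst z), snd z)) \<in> borel_measurable E" by (rule section_measurable_E[OF m \<omega>])
      show "AE z in E. \<phi> ((N \<omega>, fst z), snd z) = indicator ?R z *\<^sub>R F \<omega>"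
        using AE_E_time_pos by eventually_elim (use elim(2) in \<open>auto simp: split_beta'\<close>)
    qed measurable
    also have "\<dots> = measure E ?R *\<^sub>R F \<omega>" using R by (intro int) auto
    finally show ?case using elim 1 by (simp add: compensated_def scaleR_diff_left)
  qed
qed

theorem pathwise_is_stochastic_integral: "is_integral pathwise"
  unfolding is_stochastic_integral_def
  using pathwise_Lp pathwise_linear pathwise_continuous pathwise_elementary by blast

text \<open>Continuity of both maps and the triangle inequality.\<close>

lemma stochastic_integral_limit:
  fixes I J :: "(('w, 'u) sample \<Rightarrow> 'h::{banach, second_countable_topology}) \<Rightarrow> 'w \<Rightarrow> 'h"
  assumes I: "is_integral I" and J: "is_integral J"
    and \<Phi>: "\<Phi> \<in> L1_pr" and \<Phi>s: "\<And>n. \<Phi>s n \<in> L1_pr"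
    and lim: "(\<lambda>n. p_moment 1 proc (\<lambda>\<zeta>. \<Phi>s n \<zeta> - \<Phi> \<zeta>)) \<longlonglongrightarrow> 0"
    and eq: "\<And>n. AE \<omega> in M. I (\<Phi>s n) \<omega> = J (\<Phi>s n) \<omega>"
  shows "AE \<omega> in M. I \<Phi> \<omega> = J \<Phi> \<omega>"
proof -
  have Lp: "K \<Psi> \<in> Lp 1 M" if "is_integral K" "\<Psi> \<in> L1_pr" for K \<Psi>
    using that unfolding is_stochastic_integral_def by blast
  have [measurable]: "I \<Phi> \<in> borel_measurable M" "J \<Phi> \<in> borel_measurable M"
    "I (\<Phi>s n) \<in> borel_measurable M" "J (\<Phi>s n) \<in> borel_measurable M" for n
    using Lp[OF I] Lp[OF J] \<Phi> \<Phi>s by (auto simp: Lp_def)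
  have cont: "(\<lambda>n. p_moment 1 M (\<lambda>\<omega>. K (\<Phi>s n) \<omega> - K \<Phi> \<omega>)) \<longlonglongrightarrow> 0"
    if "is_integral K" for K
    using that \<Phi> \<Phi>s lim unfolding is_stochastic_integral_def by blast
  have "(\<integral>\<^sup>+ \<omega>. ennreal (norm (I \<Phi> \<omega> - J \<Phi> \<omega>)) \<partial>M)
    \<le> p_moment 1 M (\<lambda>\<omega>. I (\<Phi>s n) \<omega> - I \<Phi> \<omega>) + p_moment 1 M (\<lambda>\<omega>. J (\<Phi>s n) \<omega> - J \<Phi> \<omega>)" for n
  proof -
    have "(\<integral>\<^sup>+ \<omega>. ennreal (norm (I \<Phi> \<omega> - J \<Phi> \<omega>)) \<partial>M)
      \<le> (\<integral>\<^sup>+ \<omega>. ennreal (norm (I (\<Phi>s n) \<omega> - I \<Phi> \<omega>)) + ennreal (norm (J (\<Phi>s n) \<omega> - J \<Phi> \<omega>)) \<partial>M)"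
    proof (rule nn_integral_mono_AE)
      show "AE \<omega> in M. ennreal (norm (I \<Phi> \<omega> - J \<Phi> \<omega>))
          \<le> ennreal (norm (I (\<Phi>s n) \<omega> - I \<Phi> \<omega>)) + ennreal (norm (J (\<Phi>s n) \<omega> - J \<Phi> \<omega>))"
        using eq[of n]
      proof eventually_elim
        case (elim \<omega>)
        have "norm (I \<Phi> \<omega> - J \<Phi> \<omega>) = norm ((J (\<Phi>s n) \<omega> - J \<Phi> \<omega>) - (I (\<Phi>s n) \<omega> - I \<Phi> \<omega>))"
          using elim by simp
        also have "\<dots> \<le> norm (I (\<Phi>s n) \<omega> - I \<Phi> \<omega>) + norm (J (\<Phi>s n) \<omega> - J \<Phi> \<omega>)"
          using norm_triangle_ineq4 by (metis add.commute)
        finally show ?case by (simp add: ennreal_plus[symmetric] ennreal_leI del: ennreal_plus)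
      qed
    qed
    also have "\<dots> = p_moment 1 M (\<lambda>\<omega>. I (\<Phi>s n) \<omega> - I \<Phi> \<omega>) + p_moment 1 M (\<lambda>\<omega>. J (\<Phi>s n) \<omega> - J \<Phi> \<omega>)"
      unfolding p_moment_1 by (rule nn_integral_add) measurable
    finally show ?thesis .
  qed
  moreover have "(\<lambda>n. p_moment 1 M (\<lambda>\<omega>. I (\<Phi>s n) \<omega> - I \<Phi> \<omega>) + p_moment 1 M (\<lambda>\<omega>. J (\<Phi>s n) \<omega> - J \<Phi> \<omega>)) \<longlonglongrightarrow> 0 + 0"
    by (intro tendsto_add cont I J)
  ultimately have "(\<integral>\<^sup>+ \<omega>. ennreal (norm (I \<Phi> \<omega> - J \<Phi> \<omega>)) \<partial>M) \<le> 0 + 0"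
    by (intro LIMSEQ_le_const) auto
  then have "(\<integral>\<^sup>+ \<omega>. ennreal (norm (I \<Phi> \<omega> - J \<Phi> \<omega>)) \<partial>M) = 0" by simp
  then have "AE \<omega> in M. ennreal (norm (I \<Phi> \<omega> - J \<Phi> \<omega>)) = 0"
    by (subst (asm) nn_integral_0_iff_AE) auto
  then show ?thesis by eventually_elim simp
qed

end

text \<open>The class of integrands on which \<open>I\<close> and \<open>J\<close> agree is a closed subspace that contains the
  elementary integrands; a monotone class argument shows that it is everything.\<close>

locale two_integrals = marked_poisson M T \<nu> U N
  for M :: "'w measure" and T :: real
    and \<nu> :: "'u::{real_inner, banach, second_countable_topology} measure"
    and U :: "nat \<Rightarrow> 'u set" and N :: "'w \<Rightarrow> (real \<times> 'u) measure" +
  fixes I J :: "(('w, 'u) sample \<Rightarrow> 'h::{banach, second_countable_topology}) \<Rightarrow> 'w \<Rightarrow> 'h"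
  assumes I: "is_integral I" and J: "is_integral J"
begin

definition agree :: "(('w, 'u) sample \<Rightarrow> 'h) set" where
  "agree = {\<Phi> \<in> L1_pr. AE \<omega> in M. I \<Phi> \<omega> = J \<Phi> \<omega>}"

lemma agree_limit:
  assumes "\<Phi> \<in> L1_pr" "\<And>n. \<Phi>s n \<in> agree"
    "(\<lambda>n. p_moment 1 proc (\<lambda>\<zeta>. \<Phi>s n \<zeta> - \<Phi> \<zeta>)) \<longlonglongrightarrow> 0"
  shows "\<Phi> \<in> agree"
  using stochastic_integral_limit[OF I J assms(1) _ assms(3)] assms by (simp add: agree_def)

lemma agree_AE:
  assumes "\<Phi> \<in> L1_pr" "\<Psi> \<in> agree" "AE \<zeta> in proc. \<Phi> \<zeta> = \<Psi> \<zeta>"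
  shows "\<Phi> \<in> agree"
proof (rule agree_limit[OF assms(1,2)])
  have "AE \<zeta> in proc. \<Psi> \<zeta> - \<Phi> \<zeta> = 0" using assms(3) by eventually_elim simp
  then have "p_moment 1 proc (\<lambda>\<zeta>. \<Psi> \<zeta> - \<Phi> \<zeta>) = p_moment 1 proc (\<lambda>\<zeta>. 0 :: 'h)"
    by (rule p_moment_1_cong_AE)
  then have "p_moment 1 proc (\<lambda>\<zeta>. \<Psi> \<zeta> - \<Phi> \<zeta>) = 0" by (simp add: p_moment_1)
  then show "(\<lambda>n. p_moment 1 proc (\<lambda>\<zeta>. \<Psi> \<zeta> - \<Phi> \<zeta>)) \<longlonglongrightarrow> 0" by simp
qed

lemma agree_linear:
  assumes "\<Phi> \<in> agree" "\<Psi> \<in> agree"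
  shows "(\<lambda>\<zeta>. a *\<^sub>R \<Phi> \<zeta> + b *\<^sub>R \<Psi> \<zeta>) \<in> agree"
proof -
  have L: "\<Phi> \<in> L1_pr" "\<Psi> \<in> L1_pr" using assms by (auto simp: agree_def)
  have lin: "AE \<omega> in M. K (\<lambda>\<zeta>. a *\<^sub>R \<Phi> \<zeta> + b *\<^sub>R \<Psi> \<zeta>) \<omega> = a *\<^sub>R K \<Phi> \<omega> + b *\<^sub>R K \<Psi> \<omega>"
    if "is_integral K" for K :: "(('w, 'u) sample \<Rightarrow> 'h) \<Rightarrow> 'w \<Rightarrow> 'h"
    using that L unfolding is_stochastic_integral_def by blast
  have "AE \<omega> in M. I \<Phi> \<omega> = J \<Phi> \<omega>" "AE \<omega> in M. I \<Psi> \<omega> = J \<Psi> \<omega>" using assms by (auto simp: agree_def)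
  then have "AE \<omega> in M. I (\<lambda>\<zeta>. a *\<^sub>R \<Phi> \<zeta> + b *\<^sub>R \<Psi> \<zeta>) \<omega> = J (\<lambda>\<zeta>. a *\<^sub>R \<Phi> \<zeta> + b *\<^sub>R \<Psi> \<zeta>) \<omega>"
    using lin[OF I] lin[OF J] by eventually_elim simp
  then show ?thesis using Lp_pr_linear[OF L] by (simp add: agree_def)
qed

lemma agree_elementary:
  assumes r: "0 \<le> r" "r \<le> s" "s \<le> T" and F: "F \<in> borel_measurable (hist r)"
    and bd: "bounded (F ` space M)" and B: "B \<in> sets borel" "emeasure \<nu> B < \<infinity>"
  shows "elementary r s B F \<in> agree"
proof -
  have el: "AE \<omega> in M. K (elementary r s B F) \<omega>
    = (measure (N \<omega>) ({r<..s} \<times> B) - measure E ({r<..s} \<times> B)) *\<^sub>R F \<omega>"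
    if "is_integral K" for K :: "(('w, 'u) sample \<Rightarrow> 'h) \<Rightarrow> 'w \<Rightarrow> 'h"
    using that assms unfolding is_stochastic_integral_def by blast
  have "AE \<omega> in M. I (elementary r s B F) \<omega> = J (elementary r s B F) \<omega>"
    using el[OF I] el[OF J] by eventually_elim simp
  then show ?thesis using elementary_Lp_pr[OF assms] by (simp add: agree_def)
qed

text \<open>Canonical integrands are handled as integrable functions on a single measure space, which makes
  induction over integrable functions available.\<close>

definition law :: "'u history_mark measure" where
  "law = distr proc marked_canonical (\<lambda>\<zeta>. ((N (fst (fst \<zeta>)), snd (fst \<zeta>)), snd \<zeta>))"

lemma pull_id_measurable [measurable]:
  "(\<lambda>\<zeta>. ((N (fst (fst \<zeta>)), snd (fst \<zeta>)), snd \<zeta>)) \<in> measurable proc marked_canonical"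
  using pull_measurable_proc[of "\<lambda>x. x"] by (simp add: split_beta')

lemma sets_law [simp, measurable_cong]: "sets law = sets marked_canonical"
  by (simp add: law_def)

lemma space_law [simp]: "space law = space marked_canonical"
  by (simp add: law_def)

lemma nn_integral_law:
  "f \<in> borel_measurable marked_canonical \<Longrightarrow> (\<integral>\<^sup>+ x. f x \<partial>law) = (\<integral>\<^sup>+ \<zeta>. pull f \<zeta> \<partial>proc)"
  unfolding law_def by (subst nn_integral_distr) (auto simp: split_beta')

lemma L1_norm_law:
  fixes \<phi> :: "_ \<Rightarrow> 'h"
  assumes "\<phi> \<in> borel_measurable marked_canonical"
  shows "L1_norm \<phi> = (\<integral>\<^sup>+ x. ennreal (norm (\<phi> x)) \<partial>law)"
  using assms by (simp add: L1_norm_eq p_moment_1 nn_integral_law split_beta')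

lemma integrable_law:
  fixes \<phi> :: "_ \<Rightarrow> 'h"
  shows "integrable law \<phi> \<longleftrightarrow> \<phi> \<in> borel_measurable marked_canonical \<and> L1_norm \<phi> < \<infinity>"
  using measurable_cong_sets[OF sets_law refl] by (auto simp: integrable_iff_bounded L1_norm_law)

lemma pull_Lp_pr_law:
  fixes \<phi> :: "_ \<Rightarrow> 'h"
  shows "integrable law \<phi> \<Longrightarrow> pull \<phi> \<in> L1_pr"
  by (simp add: integrable_law pull_Lp_pr)

lemma agree_dominated:
  fixes \<phi> :: "_ \<Rightarrow> 'h"
  assumes \<phi>: "integrable law \<phi>" and w: "integrable law w"
    and \<phi>s: "\<And>n::nat. integrable law (\<phi>s n)" "\<And>n. pull (\<phi>s n) \<in> agree"
    and bound: "\<And>n x. x \<in> space marked_canonical \<Longrightarrow> norm (\<phi>s n x) \<le> norm (w x :: 'h)"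
    and lim: "\<And>x. x \<in> space marked_canonical \<Longrightarrow> (\<lambda>n. \<phi>s n x) \<longlonglongrightarrow> \<phi> x"
  shows "pull \<phi> \<in> agree"
proof (rule agree_limit[OF pull_Lp_pr_law[OF \<phi>] \<phi>s(2)])
  have "(\<lambda>n. \<integral>\<^sup>+ x. ennreal (norm (\<phi> x - \<phi>s n x)) \<partial>law) \<longlonglongrightarrow> 0"
  proof (rule nn_integral_dominated_convergence_norm[where w="\<lambda>x. norm (w x)"])
    show "(\<integral>\<^sup>+ x. ennreal (norm (w x)) \<partial>law) < \<infinity>" using w by (simp add: integrable_iff_bounded)
  qed (use \<phi> \<phi>s w bound lim in auto)
  moreover have "(\<integral>\<^sup>+ x. ennreal (norm (\<phi> x - \<phi>s n x)) \<partial>law) = p_moment 1 proc (\<lambda>\<zeta>. pull (\<phi>s n) \<zeta> - pull \<phi> \<zeta>)" for n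
  proof -
    have "\<phi> \<in> borel_measurable marked_canonical" "\<phi>s n \<in> borel_measurable marked_canonical"
      using \<phi> \<phi>s by (auto simp: integrable_law)
    then show ?thesis
      by (subst nn_integral_law) (auto simp: p_moment_1 norm_minus_commute intro!: nn_integral_cong)
  qed
  ultimately show "(\<lambda>n. p_moment 1 proc (\<lambda>\<zeta>. pull (\<phi>s n) \<zeta> - pull \<phi> \<zeta>)) \<longlonglongrightarrow> 0" by simp
qed

definition unambiguous :: "'u history_mark set \<Rightarrow> bool" where
  "unambiguous G \<longleftrightarrow> G \<in> sets marked_canonical \<and> emeasure law G < \<infinity> \<and>
     (\<forall>c :: 'h. pull (\<lambda>x. indicator G x *\<^sub>R c) \<in> agree)"

lemma integrable_indicator_law:
  "G \<in> sets marked_canonical \<Longrightarrow> emeasure law G < \<infinity> \<Longrightarrow> integrable law (\<lambda>x. indicator G x *\<^sub>R (c :: 'h))"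
  by (rule integrable_scaleR_left) (rule integrable_real_indicator, simp_all)

text \<open>Finite unions follow by linearity, countable ones by dominated convergence.\<close>

lemma unambiguous_union:
  assumes A: "\<And>n::nat. unambiguous (A n)" and disj: "disjoint_family A" and fin: "emeasure law (\<Union>n. A n) < \<infinity>"
  shows "unambiguous (\<Union>n. A n)"
proof -
  have As: "A n \<in> sets marked_canonical" for n using A by (simp add: unambiguous_def)
  have sub: "emeasure law (\<Union>i<n. A i) < \<infinity>" for n
  proof -
    have "emeasure law (\<Union>i<n. A i) \<le> emeasure law (\<Union>n. A n)"
      using As by (intro emeasure_mono) auto
    then show ?thesis using fin by (rule le_less_trans)
  qed
  have part: "pull (\<lambda>x. indicator (\<Union>i<n. A i) x *\<^sub>R c) \<in> agree" for n and c :: 'h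
  proof (induction n)
    case 0
    have "(\<lambda>\<zeta>. 0 *\<^sub>R pull (\<lambda>x. indicator (A 0) x *\<^sub>R c) \<zeta> + 0 *\<^sub>R pull (\<lambda>x. indicator (A 0) x *\<^sub>R c) \<zeta>) \<in> agree"
      using A by (intro agree_linear) (auto simp: unambiguous_def)
    then show ?case by (simp add: split_beta')
  next
    case (Suc n)
    have "(\<lambda>\<zeta>. 1 *\<^sub>R pull (\<lambda>x. indicator (\<Union>i<n. A i) x *\<^sub>R c) \<zeta> + 1 *\<^sub>R pull (\<lambda>x. indicator (A n) x *\<^sub>R c) \<zeta>) \<in> agree"
      using A[of n] by (intro agree_linear Suc) (auto simp: unambiguous_def)
    also have "(\<lambda>\<zeta>. 1 *\<^sub>R pull (\<lambda>x. indicator (\<Union>i<n. A i) x *\<^sub>R c) \<zeta> + 1 *\<^sub>R pull (\<lambda>x. indicator (A n) x *\<^sub>R c) \<zeta>)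
       = pull (\<lambda>x. indicator (\<Union>i<Suc n. A i) x *\<^sub>R c)"
    proof -
      have "indicator (\<Union>i<Suc n. A i) x = (indicator (\<Union>i<n. A i) x + indicator (A n) x :: real)" for x
        using disjoint_family_onD[OF disj, of _ n] by (fastforce simp: lessThan_Suc indicator_def)
      then show ?thesis by (auto simp: fun_eq_iff scaleR_add_left)
    qed
    finally show ?case .
  qed
  have "pull (\<lambda>x. indicator (\<Union>i. A i) x *\<^sub>R c) \<in> agree" for c :: 'h
  proof (rule agree_dominated[where \<phi>s="\<lambda>n x. indicator (\<Union>i<n. A i) x *\<^sub>R c" and w="\<lambda>x. indicator (\<Union>i. A i) x *\<^sub>R c"])
    show "integrable law (\<lambda>x. indicator (\<Union>i. A i) x *\<^sub>R c)"
      using As fin by (intro integrable_indicator_law) auto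
    then show "integrable law (\<lambda>x. indicator (\<Union>i. A i) x *\<^sub>R c)" .
    show "integrable law (\<lambda>x. indicator (\<Union>i<n. A i) x *\<^sub>R c)" for n
      using As sub by (intro integrable_indicator_law) auto
    show "pull (\<lambda>x. indicator (\<Union>i<n. A i) x *\<^sub>R c) \<in> agree" for n by (rule part)
    show "norm (indicator (\<Union>i<n. A i) x *\<^sub>R c) \<le> norm (indicator (\<Union>i. A i) x *\<^sub>R c)" for n x
      by (auto simp: indicator_def)
    show "(\<lambda>n. indicator (\<Union>i<n. A i) x *\<^sub>R c) \<longlonglongrightarrow> indicator (\<Union>i. A i) x *\<^sub>R c" for x
      by (intro tendsto_scaleR tendsto_const LIMSEQ_indicator_UN)
  qed
  then show ?thesis using As fin by (auto simp: unambiguous_def)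
qed

text \<open>The whole space is included because the intervals $(r, s]$ miss time $0$; without it the
  rectangles would not separate marks at time $0$.\<close>

definition rectangles :: "((real \<times> 'u) measure \<times> real) set set" where
  "rectangles = {A \<times> {r<..s} | A r s. 0 \<le> r \<and> r \<le> s \<and> s \<le> T \<and> A \<in> sets (past r)} \<union> {space canonical}"

lemma rectangles_subset: "rectangles \<subseteq> Pow (space canonical)"
  using canonical_generator by (auto simp: rectangles_def)

lemma rectangles_sets: "a \<in> rectangles \<Longrightarrow> a \<in> sets canonical"
  using canonical_basic sets.top[of canonical] by (auto simp: rectangles_def)

lemma sets_rectangles: "sets canonical = sigma_sets (space canonical) rectangles"
proof
  show "sets canonical \<subseteq> sigma_sets (space canonical) rectangles"
    unfolding sets_canonical space_canonical[symmetric]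
    by (intro sigma_sets_mono') (auto simp: rectangles_def)
  show "sigma_sets (space canonical) rectangles \<subseteq> sets canonical"
    by (intro sets.sigma_sets_subset) (auto intro: rectangles_sets)
qed

text \<open>Two histories can be intersected at the later of the two starting times.\<close>

lemma rectangles_Int:
  assumes "a \<in> rectangles" "b \<in> rectangles" shows "a \<inter> b \<in> rectangles"
proof (cases "a = space canonical \<or> b = space canonical")
  case True
  then have "a \<inter> b = a \<or> a \<inter> b = b" using assms rectangles_subset by blast
  then show ?thesis using assms by auto
next
  case False
  have "a \<in> {A \<times> {r<..s} | A r s. 0 \<le> r \<and> r \<le> s \<and> s \<le> T \<and> A \<in> sets (past r)}"
    using assms(1) False unfolding rectangles_def by blast
  then obtain A r s where a: "a = A \<times> {r<..s}" "0 \<le> r" "r \<le> s" "s \<le> T" "A \<in> sets (past r)"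
    by (elim CollectE exE conjE) (rule that)
  have "b \<in> {A \<times> {r<..s} | A r s. 0 \<le> r \<and> r \<le> s \<and> s \<le> T \<and> A \<in> sets (past r)}"
    using assms(2) False unfolding rectangles_def by blast
  then obtain B r' s' where b: "b = B \<times> {r'<..s'}" "0 \<le> r'" "r' \<le> s'" "s' \<le> T" "B \<in> sets (past r')"
    by (elim CollectE exE conjE) (rule that)
  show ?thesis
  proof (cases "max r r' \<le> min s s'")
    case True
    have "a \<inter> b = (A \<inter> B) \<times> {max r r'<..min s s'}" using a b by auto
    moreover have "A \<inter> B \<in> sets (past (max r r'))"
      using past_mono[OF _ a(5)] past_mono[OF _ b(5)] by auto
    ultimately show ?thesis unfolding rectangles_def using a b True
      by (intro UnI1 CollectI exI[of _ "A \<inter> B"] exI[of _ "max r r'"] exI[of _ "min s s'"]) auto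
  next
    case False
    then have "a \<inter> b = {} \<times> {r<..r}" using a b by (auto simp: max_def min_def split: if_splits)
    then show ?thesis unfolding rectangles_def using a
      by (intro UnI1 CollectI exI[of _ "{}"] exI[of _ "r"] exI[of _ "r"]) auto
  qed
qed

lemma sets_marked_canonical:
  "sets marked_canonical = sigma_sets (space canonical \<times> UNIV) {a \<times> B | a B. a \<in> rectangles \<and> B \<in> sets (borel :: 'u measure)}"
  using sets_pair_generated[OF sets_rectangles rectangles_subset, of borel]
  by (simp add: rectangles_def del: space_canonical)

lemma law_finite:
  assumes "G \<in> sets marked_canonical" "G \<subseteq> UNIV \<times> U m"
  shows "emeasure law G < \<infinity>"
proof -
  have [measurable]: "G \<in> sets marked_canonical" "U m \<in> sets borel" using assms U_sets by auto
  have R: "{0..T} \<times> U m \<in> sets E" "emeasure E ({0..T} \<times> U m) < \<infinity>" by (rule D_sets, rule D_finite)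
  note [measurable] = R(1)
  have "emeasure law G = (\<integral>\<^sup>+ x. indicator G x \<partial>law)" using assms by simp
  also have "\<dots> = (\<integral>\<^sup>+ \<zeta>. pull (indicator G) \<zeta> \<partial>proc)" by (rule nn_integral_law) measurable
  also have "\<dots> \<le> (\<integral>\<^sup>+ \<zeta>. indicator ({0..T} \<times> U m) (snd (fst \<zeta>), snd \<zeta>) \<partial>proc)"
    using assms(2) by (intro nn_integral_mono) (auto simp: space_pair_measure indicator_def)
  also have "\<dots> = (\<integral>\<^sup>+ \<omega>. \<integral>\<^sup>+ z. indicator ({0..T} \<times> U m) z \<partial>E \<partial>M)"
    using nn_integral_proc[of "\<lambda>x. indicator ({0..T} \<times> U m) (snd x)"] by simp
  also have "\<dots> < \<infinity>" using R by (simp add: emeasure_space_1)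
  finally show ?thesis .
qed

text \<open>An indicator over $A \times (r, s] \times B$ is an elementary integrand. The whole space differs
  from $(0, T]$ only at time $0$.\<close>

lemma unambiguous_rectangle:
  assumes a: "a \<in> rectangles" and B: "B \<in> sets borel" "B \<subseteq> U m"
  shows "unambiguous (a \<times> B)"
proof -
  have nB: "emeasure \<nu> B < \<infinity>"
    using U_finite[of m] B U_sets[of m] sets_mark by (auto intro: le_less_trans[OF emeasure_mono])
  have el: "pull (\<lambda>x. indicator ((A \<times> {r<..s}) \<times> B) x *\<^sub>R c) \<in> agree"
    if r: "0 \<le> r" "r \<le> s" "s \<le> T" and A: "A \<in> sets (past r)" for A r s and c :: 'h
  proof -
    let ?F = "\<lambda>\<omega>. indicator A (N \<omega>) *\<^sub>R c"
    have "N \<in> measurable (hist r) (past r)" using r by (intro N_measurable_past) simp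
    then have "?F \<in> borel_measurable (hist r)"
      using measurable_compose[OF _ borel_measurable_indicator[OF A]] by (intro borel_measurable_scaleR borel_measurable_const)
    moreover have "bounded (?F ` space M)"
      by (rule boundedI[of _ "norm c"]) (auto simp: indicator_def)
    ultimately have "elementary r s B ?F \<in> agree" by (rule agree_elementary[OF r _ _ B(1) nB])
    also have "elementary r s B ?F = pull (\<lambda>x. indicator ((A \<times> {r<..s}) \<times> B) x *\<^sub>R c)"
      by (auto simp: fun_eq_iff indicator_def)
    finally show ?thesis .
  qed
  have G: "a \<times> B \<in> sets marked_canonical" using rectangles_sets[OF a] B by auto
  have fin: "emeasure law (a \<times> B) < \<infinity>" using G B by (intro law_finite[of _ m]) auto
  have "pull (\<lambda>x. indicator (a \<times> B) x *\<^sub>R c) \<in> agree" for c :: 'h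
  proof (cases "a = space canonical")
    case False
    then show ?thesis using a el by (auto simp: rectangles_def)
  next
    case True
    show ?thesis
    proof (rule agree_AE)
      show "pull (\<lambda>x. indicator (a \<times> B) x *\<^sub>R c) \<in> L1_pr"
        by (intro pull_Lp_pr_law integrable_indicator_law G fin)
      show "pull (\<lambda>x. indicator ((space conf \<times> {0<..T}) \<times> B) x *\<^sub>R c) \<in> agree"
        using T_pos sets.top[of "past 0"] by (intro el) auto
      have "AE \<omega> in M. \<forall>t\<in>{0<..T}. \<forall>x. pull (\<lambda>x. indicator (a \<times> B) x *\<^sub>R c) ((\<omega>, t), x)
        = pull (\<lambda>x. indicator ((space conf \<times> {0<..T}) \<times> B) x *\<^sub>R c) ((\<omega>, t), x)"
        by (auto simp: True indicator_def)
      then show "AE \<zeta> in proc. pull (\<lambda>x. indicator (a \<times> B) x *\<^sub>R c) \<zeta>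
        = pull (\<lambda>x. indicator ((space conf \<times> {0<..T}) \<times> B) x *\<^sub>R c) \<zeta>"
        by (rule AE_proc_versionI)
    qed
  qed
  then show ?thesis using G fin by (simp add: unambiguous_def)
qed

text \<open>Dynkin's argument needs finite measure to pass to complements, hence the cut by \<open>U m\<close>.\<close>

lemma unambiguous_cut:
  assumes "G \<in> sets marked_canonical"
  shows "unambiguous (G \<inter> (UNIV \<times> U m))"
proof -
  let ?S = "space canonical \<times> (UNIV :: 'u set)"
  let ?R = "{a \<times> B | a B. a \<in> rectangles \<and> B \<in> sets (borel :: 'u measure)}"
  have cut: "G \<inter> (UNIV \<times> U m) \<in> sets marked_canonical" "emeasure law (G \<inter> (UNIV \<times> U m)) < \<infinity>"
    if "G \<in> sets marked_canonical" for G
  proof -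
    have "G \<inter> (UNIV \<times> U m) = G \<inter> (space canonical \<times> U m)"
      using sets.sets_into_space[OF that] by (auto simp: space_pair_measure)
    also have "\<dots> \<in> sets marked_canonical" using that U_sets by (intro sets.Int pair_measureI sets.top)
    finally show "G \<inter> (UNIV \<times> U m) \<in> sets marked_canonical" .
    then show "emeasure law (G \<inter> (UNIV \<times> U m)) < \<infinity>" by (rule law_finite[of _ m]) auto
  qed
  have Int: "Int_stable ?R" by (rule Int_stable_rectangles) (rule rectangles_Int)
  have full: "unambiguous (?S \<inter> (UNIV \<times> U m))"
  proof -
    have "?S \<inter> (UNIV \<times> U m) = space canonical \<times> U m" by auto
    then show ?thesis using unambiguous_rectangle[of "space canonical" "U m" m] U_sets by (auto simp: rectangles_def)
  qed
  have sub: "?R \<subseteq> Pow ?S" using rectangles_subset by blast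
  have "G \<in> sigma_sets ?S ?R" using assms by (simp only: sets_marked_canonical)
  then show ?thesis
  proof (induction rule: sigma_sets_induct_disjoint[OF Int sub, consumes 1, case_names basic empty compl union])
    case (basic G)
    then obtain a B where "G = a \<times> B" "a \<in> rectangles" "B \<in> sets borel" by auto
    moreover have "G \<inter> (UNIV \<times> U m) = a \<times> (B \<inter> U m)" using calculation by auto
    ultimately show ?case using U_sets[of m] by (auto intro: unambiguous_rectangle)
  next
    case empty
    have "{} \<times> {0<..0} \<in> rectangles"
      unfolding rectangles_def using T_pos
      by (intro UnI1 CollectI exI[of _ "{}"] exI[of _ "0::real"]) auto
    from unambiguous_rectangle[OF this, of "U m" m] show ?case using U_sets by simp
  next
    case (compl G)
    then have G: "G \<in> sets marked_canonical" by (simp only: sets_marked_canonical)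
    have Gc: "?S - G \<in> sets marked_canonical" using sets.compl_sets[OF G] by (simp add: space_pair_measure)
    have "pull (\<lambda>x. indicator ((?S - G) \<inter> (UNIV \<times> U m)) x *\<^sub>R c) \<in> agree" for c :: 'h
    proof -
      have "(\<lambda>\<zeta>. 1 *\<^sub>R pull (\<lambda>x. indicator (?S \<inter> (UNIV \<times> U m)) x *\<^sub>R c) \<zeta>
          + (-1) *\<^sub>R pull (\<lambda>x. indicator (G \<inter> (UNIV \<times> U m)) x *\<^sub>R c) \<zeta>) \<in> agree"
        using full compl by (intro agree_linear) (auto simp: unambiguous_def)
      also have "(\<lambda>\<zeta>. 1 *\<^sub>R pull (\<lambda>x. indicator (?S \<inter> (UNIV \<times> U m)) x *\<^sub>R c) \<zeta>
          + (-1) *\<^sub>R pull (\<lambda>x. indicator (G \<inter> (UNIV \<times> U m)) x *\<^sub>R c) \<zeta>)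
        = pull (\<lambda>x. indicator ((?S - G) \<inter> (UNIV \<times> U m)) x *\<^sub>R c)"
        using sets.sets_into_space[OF G] by (auto simp: fun_eq_iff space_pair_measure indicator_def)
      finally show ?thesis .
    qed
    then show ?case using cut[OF Gc] by (simp add: unambiguous_def)
  next
    case (union A)
    have "A n \<in> sets marked_canonical" for n using union(2) unfolding sets_marked_canonical by blast
    then have un: "(\<Union>n. A n) \<in> sets marked_canonical" by auto
    have eq: "(\<Union>n. A n) \<inter> (UNIV \<times> U m) = (\<Union>n. A n \<inter> (UNIV \<times> U m))" by blast
    have "unambiguous (\<Union>n. A n \<inter> (UNIV \<times> U m))"
    proof (rule unambiguous_union)
      show "disjoint_family (\<lambda>n. A n \<inter> (UNIV \<times> U m))" using union(1) by (auto simp: disjoint_family_on_def)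
      show "emeasure law (\<Union>n. A n \<inter> (UNIV \<times> U m)) < \<infinity>" using cut(2)[OF un] unfolding eq .
    qed (rule union(3))
    then show ?case unfolding eq .
  qed
qed

lemma unambiguous_finite:
  assumes G: "G \<in> sets marked_canonical" "emeasure law G < \<infinity>"
  shows "unambiguous G"
proof -
  have U_UNIV: "(\<Union>m. U m) = UNIV"
  proof (intro set_eqI iffI UNIV_I)
    fix x :: 'u
    have "(0, x) \<in> (\<Union>m. {0..T} \<times> U m)" unfolding D_union space_E using T_pos by simp
    then show "x \<in> (\<Union>m. U m)" by blast
  qed
  have eq: "G = (\<Union>m. G \<inter> (UNIV \<times> U m))" (is "_ = ?Un")
  proof
    show "G \<subseteq> ?Un"
    proof
      fix p assume p: "p \<in> G"
      have "snd p \<in> (\<Union>m. U m)" unfolding U_UNIV by simp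
      then obtain m where "snd p \<in> U m" by blast
      with p show "p \<in> ?Un" by (cases p) auto
    qed
  qed blast
  have "disjoint_family (\<lambda>m. G \<inter> (UNIV \<times> U m))"
  proof -
    have "U i \<inter> U j = {}" if "i \<noteq> j" for i j
    proof -
      have "({0..T} \<times> U i) \<inter> ({0..T} \<times> U j) = {}" using disjoint_family_onD[OF D_disjoint _ _ that] by simp
      then show ?thesis using T_pos by (auto simp: Times_Int_Times)
    qed
    then show ?thesis by (auto simp: disjoint_family_on_def)
  qed
  then have "unambiguous (\<Union>m. G \<inter> (UNIV \<times> U m))"
    using unambiguous_cut[OF G(1)] G(2) eq by (intro unambiguous_union) simp_all
  then show ?thesis by (simp only: eq[symmetric])
qed

lemma agree_pull:
  fixes \<phi> :: "_ \<Rightarrow> 'h"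
  assumes "integrable law \<phi>" shows "pull \<phi> \<in> agree"
  using assms
proof (induction rule: integrable_induct)
  case (base A c)
  then have "unambiguous A" by (intro unambiguous_finite) auto
  then show ?case by (auto simp: unambiguous_def)
next
  case (add f g)
  then have "(\<lambda>\<zeta>. 1 *\<^sub>R pull f \<zeta> + 1 *\<^sub>R pull g \<zeta>) \<in> agree" by (intro agree_linear) auto
  also have "(\<lambda>\<zeta>. 1 *\<^sub>R pull f \<zeta> + 1 *\<^sub>R pull g \<zeta>) = pull (\<lambda>x. f x + g x)" by (auto simp: fun_eq_iff)
  finally show ?case .
next
  case (lim f s)
  show ?case
  proof (rule agree_dominated[where w="\<lambda>x. 2 *\<^sub>R f x"])
    show "norm (s n x) \<le> norm (2 *\<^sub>R f x)" if "x \<in> space marked_canonical" for n x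
      using lim(3)[of x n] that by simp
  qed (use lim in auto)
qed

theorem integrals_agree:
  assumes "\<Phi> \<in> L1_pr"
  shows "AE \<omega> in M. I \<Phi> \<omega> = J \<Phi> \<omega>"
proof -
  obtain \<phi> where \<phi>: "is_version \<Phi> \<phi>" "L1_norm \<phi> < \<infinity>" using version_exists[OF assms] by auto
  then have "integrable law \<phi>" by (simp add: integrable_law is_version_def)
  then have "\<Phi> \<in> agree" by (intro agree_AE[OF assms agree_pull is_version_AE[OF \<phi>(1)]])
  then show ?thesis by (simp add: agree_def)
qed

end

section \<open>Difference operators and the commutation formula\<close>

context poisson_process
begin

text \<open>The law of the configuration with an inserted point, averaged over the point, is absolutely
  continuous with respect to the law of \<open>N\<close>: with $h(\eta, z) = 1_{\neg P}(\eta)$ the Mecke formula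
  reads $\int P(N + \delta_z \in Z)\,E(dz) = E[N(\mathrm{space}\,E)\,1_Z(N)] = 0$ for
  $Z = \{\eta.\ \neg P\,\eta\}$.\<close>

lemma AE_add_point:
  assumes [measurable]: "Measurable.pred (configurations E) P" and ae: "AE \<omega> in M. P (N \<omega>)"
  shows "AE x in M \<Otimes>\<^sub>M E. P (add_point (N (fst x)) (snd x))"
proof -
  let ?Z = "{\<eta> \<in> space (configurations E). \<not> P \<eta>}"
  let ?h = "\<lambda>x :: 'z measure \<times> 'z. indicator ?Z (fst x) :: ennreal"
  have "(\<integral>\<^sup>+ \<omega>. \<integral>\<^sup>+ z. ?h (add_point (N \<omega>) z, z) \<partial>E \<partial>M) = (\<integral>\<^sup>+ \<omega>. \<integral>\<^sup>+ z. ?h (N \<omega>, z) \<partial>N \<omega> \<partial>M)"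
    by (rule mecke[symmetric]) measurable
  also have "\<dots> = (\<integral>\<^sup>+ \<omega>. 0 \<partial>M)"
    by (rule nn_integral_cong_AE) (use ae in eventually_elim, simp)
  finally have "(\<integral>\<^sup>+ x. ?h (add_point (N (fst x)) (snd x), snd x) \<partial>(M \<Otimes>\<^sub>M E)) = 0"
    by (subst nn_integral_fst[symmetric]) simp_all
  then have "AE x in M \<Otimes>\<^sub>M E. ?h (add_point (N (fst x)) (snd x), snd x) = 0"
    by (subst (asm) nn_integral_0_iff_AE) simp_all
  then show ?thesis using AE_space
    by eventually_elim (auto simp: space_pair_measure N_space add_point_in_configurations indicator_eq_0_iff)
qed

end

context marked_poisson
begin

lemma AE_fst:
  assumes [measurable]: "Measurable.pred M P" and "AE \<omega> in M. P \<omega>"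
  shows "AE x in M \<Otimes>\<^sub>M E. P (fst x)"
  by (rule ME.AE_pair_measure) (use assms in auto)

text \<open>For almost every fixed value \<open>y\<close> of the second argument this is \<open>AE_add_point\<close>; the order of the variables is exchanged by
  Fubini's theorem for the indicator of the exceptional set.\<close>

lemma AE_add_point_process:
  fixes \<phi> \<psi> :: "(real \<times> 'u) measure \<times> (real \<times> 'u) \<Rightarrow> 'h::{banach, second_countable_topology}"
  assumes [measurable]: "\<phi> \<in> borel_measurable (conf \<Otimes>\<^sub>M E)" "\<psi> \<in> borel_measurable (conf \<Otimes>\<^sub>M E)"
    and eq: "AE x in M \<Otimes>\<^sub>M E. \<phi> (N (fst x), snd x) = \<psi> (N (fst x), snd x)"
  shows "AE z in E. AE x in M \<Otimes>\<^sub>M E. \<phi> (add_point (N (fst x)) z, snd x) = \<psi> (add_point (N (fst x)) z, snd x)"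
proof -
  interpret EE: pair_sigma_finite E E ..
  interpret EM: pair_sigma_finite E M ..
  define Z where "Z = {x \<in> space (conf \<Otimes>\<^sub>M E). \<phi> x \<noteq> \<psi> x}"
  have Z [measurable]: "Z \<in> sets (conf \<Otimes>\<^sub>M E)" unfolding Z_def by measurable
  let ?H = "\<lambda>\<omega> z y. indicator Z (add_point (N \<omega>) z, y) :: ennreal"
  have "AE \<omega> in M. AE y in E. \<phi> (N \<omega>, y) = \<psi> (N \<omega>, y)" using ME.AE_pair[OF eq] by simp
  then have "AE y in E. AE \<omega> in M. \<phi> (N \<omega>, y) = \<psi> (N \<omega>, y)"
    by (subst (asm) ME.AE_commute) simp_all
  then have inner: "AE y in E. (\<integral>\<^sup>+ \<omega>. \<integral>\<^sup>+ z. ?H \<omega> z y \<partial>E \<partial>M) = 0" using AE_space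
  proof eventually_elim
    case (elim y)
    note [measurable] = elim(2)
    have "(\<integral>\<^sup>+ \<omega>. \<integral>\<^sup>+ z. ?H \<omega> z y \<partial>E \<partial>M) = (\<integral>\<^sup>+ \<omega>. \<integral>\<^sup>+ z. indicator Z (N \<omega>, y) \<partial>N \<omega> \<partial>M)"
      using mecke[of "\<lambda>x. indicator Z (fst x, y)"] by simp
    also have "\<dots> = (\<integral>\<^sup>+ \<omega>. 0 \<partial>M)"
      by (rule nn_integral_cong_AE) (use elim(1) in eventually_elim, simp add: Z_def)
    finally show ?case by simp
  qed
  have "(\<integral>\<^sup>+ z. \<integral>\<^sup>+ x. ?H (fst x) z (snd x) \<partial>(M \<Otimes>\<^sub>M E) \<partial>E) = (\<integral>\<^sup>+ z. \<integral>\<^sup>+ \<omega>. \<integral>\<^sup>+ y. ?H \<omega> z y \<partial>E \<partial>M \<partial>E)"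
    by (intro nn_integral_cong, subst nn_integral_fst[symmetric]) simp_all
  also have "\<dots> = (\<integral>\<^sup>+ \<omega>. \<integral>\<^sup>+ z. \<integral>\<^sup>+ y. ?H \<omega> z y \<partial>E \<partial>E \<partial>M)"
    by (rule ME.Fubini') measurable
  also have "\<dots> = (\<integral>\<^sup>+ \<omega>. \<integral>\<^sup>+ y. \<integral>\<^sup>+ z. ?H \<omega> z y \<partial>E \<partial>E \<partial>M)"
    by (intro nn_integral_cong EE.Fubini') measurable
  also have "\<dots> = (\<integral>\<^sup>+ y. \<integral>\<^sup>+ \<omega>. \<integral>\<^sup>+ z. ?H \<omega> z y \<partial>E \<partial>M \<partial>E)"
    by (rule EM.Fubini') measurable
  also have "\<dots> = (\<integral>\<^sup>+ y. 0 \<partial>E)" by (rule nn_integral_cong_AE[OF inner])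
  finally have "(\<integral>\<^sup>+ z. \<integral>\<^sup>+ x. ?H (fst x) z (snd x) \<partial>(M \<Otimes>\<^sub>M E) \<partial>E) = 0" by simp
  interpret MEs: sigma_finite_measure "M \<Otimes>\<^sub>M E" by (rule ME.sigma_finite_measure_axioms)
  have "AE z in E. (\<integral>\<^sup>+ x. ?H (fst x) z (snd x) \<partial>(M \<Otimes>\<^sub>M E)) = 0"
    using \<open>(\<integral>\<^sup>+ z. \<integral>\<^sup>+ x. ?H (fst x) z (snd x) \<partial>(M \<Otimes>\<^sub>M E) \<partial>E) = 0\<close>
    by (subst (asm) nn_integral_0_iff_AE) simp_all
  then show ?thesis using AE_space
  proof eventually_elim
    case (elim z)
    note [measurable] = elim(2)
    have "AE x in M \<Otimes>\<^sub>M E. ?H (fst x) z (snd x) = 0"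
      using elim(1) by (subst (asm) nn_integral_0_iff_AE) simp_all
    then show ?case using AE_space
      by eventually_elim
        (use elim(2) in \<open>auto simp: Z_def space_pair_measure N_space add_point_in_configurations indicator_eq_0_iff\<close>)
  qed
qed

lemma stochastic_integral_is:
  "is_integral
     (stochastic_integral 1 M T \<nu> N :: (('w, 'u) sample \<Rightarrow> 'h::{banach, second_countable_topology}) \<Rightarrow> 'w \<Rightarrow> 'h)"
  unfolding stochastic_integral_def
  by (rule someI[where P="is_integral"]) (rule pathwise_is_stochastic_integral)

lemma stochastic_integral_pathwise:
  fixes \<Phi> :: "('w, 'u) sample \<Rightarrow> 'h::{banach, second_countable_topology}"
  assumes "\<Phi> \<in> L1_pr"
  shows "AE \<omega> in M. stochastic_integral 1 M T \<nu> N \<Phi> \<omega> = pathwise \<Phi> \<omega>"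
proof -
  interpret two_integrals M T \<nu> U N
    "stochastic_integral 1 M T \<nu> N :: (('w, 'u) sample \<Rightarrow> 'h) \<Rightarrow> 'w \<Rightarrow> 'h" pathwise
    by unfold_locales (rule stochastic_integral_is pathwise_is_stochastic_integral)+
  show ?thesis by (rule integrals_agree[OF assms])
qed

text \<open>The chosen stochastic integral is the pathwise one, computed from any canonical integrand that
  represents \<open>\<Phi>\<close> almost everywhere.\<close>

lemma stochastic_integral_compensated:
  fixes \<Phi> :: "('w, 'u) sample \<Rightarrow> 'h::{banach, second_countable_topology}"
  assumes \<Phi>: "\<Phi> \<in> L1_pr" and \<phi>: "\<phi> \<in> borel_measurable marked_canonical"
    and eq: "AE \<zeta> in proc. \<Phi> \<zeta> = pull \<phi> \<zeta>"
  shows "AE \<omega> in M. stochastic_integral 1 M T \<nu> N \<Phi> \<omega> = compensated \<phi> (N \<omega>)"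
proof -
  obtain \<psi> where \<psi>: "is_version \<Phi> \<psi>" "L1_norm \<psi> < \<infinity>" using version_exists[OF \<Phi>] by auto
  have m: "\<psi> \<in> borel_measurable marked_canonical" using \<psi>(1) by (simp add: is_version_def)
  have "AE \<zeta> in proc. pull \<psi> \<zeta> = pull \<phi> \<zeta>"
    using is_version_AE[OF \<psi>(1)] eq by eventually_elim simp
  from compensated_cong[OF m \<psi>(2) \<phi> this] pathwise_eq[OF \<psi>] stochastic_integral_pathwise[OF \<Phi>]
  show ?thesis by eventually_elim simp
qed

definition canonical_difference ::
  "('u history_mark \<Rightarrow> 'h::{banach, second_countable_topology}) \<Rightarrow> real \<times> 'u \<Rightarrow>
   'u history_mark \<Rightarrow> 'h" where
  "canonical_difference \<phi> z = (\<lambda>((\<eta>, s), y). \<phi> ((add_point \<eta> z, s), y) - \<phi> ((\<eta>, s), y))"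

lemma canonical_difference_joint:
  assumes \<phi>: "\<phi> \<in> borel_measurable marked_canonical"
  shows "(\<lambda>(\<zeta>, z). canonical_difference \<phi> z \<zeta>) \<in> borel_measurable (marked_canonical \<Otimes>\<^sub>M E)"
proof -
  have 1: "(\<lambda>x. (fst (fst x), snd x)) \<in> measurable (marked_canonical \<Otimes>\<^sub>M E) (canonical \<Otimes>\<^sub>M E)"
    by measurable
  have "(\<lambda>x. (add_point (fst (fst (fst x))) (snd x), snd (fst (fst x))))
      \<in> measurable (marked_canonical \<Otimes>\<^sub>M E) canonical"
    using measurable_compose[OF 1 canonical_add_point] by (simp add: split_beta')
  from measurable_compose[OF measurable_Pair[OF this measurable_compose[OF measurable_fst measurable_snd]] \<phi>]
  have "(\<lambda>x. \<phi> ((add_point (fst (fst (fst x))) (snd x), snd (fst (fst x))), snd (fst x)))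
      \<in> borel_measurable (marked_canonical \<Otimes>\<^sub>M E)" .
  moreover have "(\<lambda>x. \<phi> (fst x)) \<in> borel_measurable (marked_canonical \<Otimes>\<^sub>M E)"
    by (rule measurable_compose[OF measurable_fst \<phi>])
  ultimately show ?thesis
    using borel_measurable_diff by (fastforce simp: canonical_difference_def split_beta')
qed

lemma canonical_difference_measurable:
  assumes "\<phi> \<in> borel_measurable marked_canonical" "z \<in> space E"
  shows "canonical_difference \<phi> z \<in> borel_measurable marked_canonical"
  using measurable_compose[OF measurable_Pair2'[OF assms(2)] canonical_difference_joint[OF assms(1)]] by simp

text \<open>The commutation formula for a single configuration. Finiteness of the norm of the difference makes
  the shifted integrand integrable against both measures; integrating it against
  \<open>add_point \<eta> z\<close> produces one extra term, its value at \<open>z\<close>, which equals \<open>\<phi>\<close> at \<open>z\<close> before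
  the insertion.\<close>

lemma compensated_difference:
  assumes \<phi>: "\<phi> \<in> borel_measurable marked_canonical" "L1_norm \<phi> < \<infinity>"
    and z: "z \<in> space E" and d: "L1_norm (canonical_difference \<phi> z) < \<infinity>"
  shows "AE \<omega> in M. compensated (canonical_difference \<phi> z) (N \<omega>)
    = compensated \<phi> (add_point (N \<omega>) z) - compensated \<phi> (N \<omega>) - \<phi> ((N \<omega>, fst z), snd z)"
  using AE_integrable[OF \<phi>] AE_integrable[OF canonical_difference_measurable[OF \<phi>(1) z] d]
    AE_locally_finite AE_space
proof eventually_elim
  case (elim \<omega>)
  note \<omega> = N_space[OF elim(6)]
  let ?g = "\<lambda>y. \<phi> ((N \<omega>, fst y), snd y)" and ?a = "\<lambda>y. \<phi> ((add_point (N \<omega>) z, fst y), snd y)"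
  have d_eq: "canonical_difference \<phi> z ((N \<omega>, fst y), snd y) = ?a y - ?g y" for y
    by (simp add: canonical_difference_def)
  have aN: "integrable (N \<omega>) ?a" using Bochner_Integration.integrable_add[OF elim(1) elim(3)] by (simp add: d_eq)
  have aE: "integrable E ?a" using Bochner_Integration.integrable_add[OF elim(2) elim(4)] by (simp add: d_eq)
  have add: "integral\<^sup>L (add_point (N \<omega>) z) ?a = integral\<^sup>L (N \<omega>) ?a + ?a z"
    using integral_add_point[OF _ aN, of z] z by (simp add: space_config[OF \<omega>])
  have "?a z = ?g z"
    using canonical_add_present[OF \<phi>(1) \<omega>, of "fst z" "snd z" "snd z"] z by (auto simp: space_E)
  then show ?case
    using elim(5) locally_finite_add_point[OF \<omega> elim(5), of z] elim(1,2) aN aE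
    by (simp add: compensated_def d_eq add)
qed

text \<open>The representative picked in the definition may differ from \<open>compensated \<phi>\<close> on a set that
  \<open>N\<close> avoids almost surely; \<open>AE_add_point\<close> removes the difference after the insertion.\<close>

lemma difference_compensated:
  fixes F :: "'w \<Rightarrow> 'h::{banach, second_countable_topology}"
  assumes \<phi> [measurable]: "\<phi> \<in> borel_measurable marked_canonical"
    and F: "AE \<omega> in M. F \<omega> = compensated \<phi> (N \<omega>)"
  shows "AE x in M \<Otimes>\<^sub>M E. difference M E N F (snd x) (fst x)
    = compensated \<phi> (add_point (N (fst x)) (snd x)) - compensated \<phi> (N (fst x))"
proof -
  define f where "f = (SOME f. f \<in> borel_measurable conf \<and> (AE \<omega> in M. F \<omega> = f (N \<omega>)))"
  have f: "f \<in> borel_measurable conf \<and> (AE \<omega> in M. F \<omega> = f (N \<omega>))"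
    unfolding f_def by (rule someI[where x="compensated \<phi>"]) (use F in simp)
  then have [measurable]: "f \<in> borel_measurable conf" by simp
  have "AE \<omega> in M. F \<omega> = f (N \<omega>)" using f by simp
  with F have eq: "AE \<omega> in M. f (N \<omega>) = compensated \<phi> (N \<omega>)" by eventually_elim simp
  have "AE x in M \<Otimes>\<^sub>M E. f (add_point (N (fst x)) (snd x)) = compensated \<phi> (add_point (N (fst x)) (snd x))"
    by (rule AE_add_point[OF _ eq]) measurable
  moreover have "AE x in M \<Otimes>\<^sub>M E. f (N (fst x)) = compensated \<phi> (N (fst x))"
    by (rule AE_fst[OF _ eq]) measurable
  ultimately show ?thesis
    by eventually_elim (simp add: difference_def f_def[symmetric])
qed

text \<open>Besides the identification with the canonical difference this records the representative
  \<open>f\<close> itself, whose joint measurability is needed for Fubini arguments.\<close>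

lemma process_difference_version:
  fixes \<Phi> :: "('w, 'u) sample \<Rightarrow> 'h::{banach, second_countable_topology}"
  assumes \<phi> [measurable]: "\<phi> \<in> borel_measurable marked_canonical"
    and \<Phi>: "AE \<zeta> in proc. \<Phi> \<zeta> = pull \<phi> \<zeta>"
  obtains f where "f \<in> borel_measurable (conf \<Otimes>\<^sub>M E)"
    "\<And>z \<zeta>. process_difference M T \<nu> N \<Phi> z \<zeta> =
       f (add_point (N (fst (fst \<zeta>))) z, (snd (fst \<zeta>), snd \<zeta>)) - f (N (fst (fst \<zeta>)), (snd (fst \<zeta>), snd \<zeta>))"
    "AE z in E. AE \<zeta> in proc. process_difference M T \<nu> N \<Phi> z \<zeta> = pull (canonical_difference \<phi> z) \<zeta>"
proof -
  let ?spec = "\<lambda>f. f \<in> borel_measurable (conf \<Otimes>\<^sub>M E) \<and>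
      (AE ((\<omega>, s), y) in proc. \<Phi> ((\<omega>, s), y) = f (N \<omega>, (s, y)))"
  define f where "f = (SOME f. ?spec f)"
  let ?f0 = "\<lambda>x. \<phi> ((fst x, fst (snd x)), snd (snd x))"
  have f0 [measurable]: "?f0 \<in> borel_measurable (conf \<Otimes>\<^sub>M E)" by measurable
  have "?spec f" unfolding f_def
    by (rule someI[where x="?f0"]) (use \<Phi> f0 in \<open>simp add: split_beta'\<close>)
  then have f [measurable]: "f \<in> borel_measurable (conf \<Otimes>\<^sub>M E)"
    and fN: "AE \<zeta> in proc. \<Phi> \<zeta> = f (N (fst (fst \<zeta>)), (snd (fst \<zeta>), snd \<zeta>))"
    by (auto simp: split_beta')
  have pd: "process_difference M T \<nu> N \<Phi> z \<zeta> =
       f (add_point (N (fst (fst \<zeta>))) z, (snd (fst \<zeta>), snd \<zeta>)) - f (N (fst (fst \<zeta>)), (snd (fst \<zeta>), snd \<zeta>))" for z \<zeta>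
    unfolding process_difference_def f_def[symmetric] by (simp add: split_beta' Let_def)
  have "AE \<zeta> in proc. f (N (fst (fst \<zeta>)), (snd (fst \<zeta>), snd \<zeta>)) = ?f0 (N (fst (fst \<zeta>)), (snd (fst \<zeta>), snd \<zeta>))"
    using fN \<Phi> by eventually_elim (simp add: split_beta')
  then have eq: "AE x in M \<Otimes>\<^sub>M E. f (N (fst x), snd x) = ?f0 (N (fst x), snd x)"
    by (subst AE_proc_iff[symmetric]) simp_all
  have "AE z in E. AE \<zeta> in proc. process_difference M T \<nu> N \<Phi> z \<zeta> = pull (canonical_difference \<phi> z) \<zeta>"
    using AE_add_point_process[OF f f0 eq]
  proof eventually_elim
    case (elim z)
    from AE_procI[OF elim] AE_procI[OF eq] show ?case
      by eventually_elim (simp add: pd canonical_difference_def split_beta')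
  qed
  with f pd show thesis by (rule that)
qed

lemma pull_joint_measurable:
  fixes d :: "real \<times> 'u \<Rightarrow> 'u history_mark \<Rightarrow> 'h::{banach, second_countable_topology}"
  assumes d: "(\<lambda>(\<zeta>, z). d z \<zeta>) \<in> borel_measurable (marked_canonical \<Otimes>\<^sub>M E)"
  shows "(\<lambda>(\<zeta>, z). pull (d z) \<zeta>) \<in> borel_measurable (marked_pred \<Otimes>\<^sub>M E)"
    and "(\<lambda>(\<zeta>, z). pull (d z) \<zeta>) \<in> borel_measurable (proc \<Otimes>\<^sub>M E)"
proof -
  have 1: "(\<lambda>\<zeta>. ((N (fst (fst \<zeta>)), snd (fst \<zeta>)), snd \<zeta>)) \<in> measurable marked_pred marked_canonical"
    using measurable_Pair[OF measurable_compose[OF measurable_fst predictable_to_canonical] measurable_snd]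
    by (simp add: split_beta')
  have 2: "(\<lambda>\<zeta>. ((N (fst (fst \<zeta>)), snd (fst \<zeta>)), snd \<zeta>)) \<in> measurable proc marked_canonical"
    using pull_measurable_proc[of "\<lambda>x. x"] by (simp add: split_beta')
  have "(\<lambda>x. (\<lambda>(\<zeta>, z). d z \<zeta>) (((N (fst (fst (fst x))), snd (fst (fst x))), snd (fst x)), snd x)) \<in> borel_measurable (L \<Otimes>\<^sub>M E)"
    if "(\<lambda>\<zeta>. ((N (fst (fst \<zeta>)), snd (fst \<zeta>)), snd \<zeta>)) \<in> measurable L marked_canonical" for L
    by (rule measurable_compose[OF measurable_Pair[OF measurable_compose[OF measurable_fst that] measurable_snd] d])
  from this[OF 1] this[OF 2]
  show "(\<lambda>(\<zeta>, z). pull (d z) \<zeta>) \<in> borel_measurable (marked_pred \<Otimes>\<^sub>M E)"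
    "(\<lambda>(\<zeta>, z). pull (d z) \<zeta>) \<in> borel_measurable (proc \<Otimes>\<^sub>M E)"
    by (simp_all add: split_beta')
qed

text \<open>The canonical difference composed with \<open>N\<close> is a predictable version, so the definition chooses
  some predictable version; it agrees with the canonical one almost everywhere.\<close>

lemma predictable_difference_version:
  fixes \<Phi> :: "('w, 'u) sample \<Rightarrow> 'h::{banach, second_countable_topology}"
  assumes \<phi> [measurable]: "\<phi> \<in> borel_measurable marked_canonical"
    and \<Phi>: "AE \<zeta> in proc. \<Phi> \<zeta> = pull \<phi> \<zeta>"
  shows "z \<in> space E \<Longrightarrow> predictable_difference M T \<nu> N \<Phi> z \<in> borel_measurable marked_pred"
    and "AE z in E. AE \<zeta> in proc. predictable_difference M T \<nu> N \<Phi> z \<zeta> = pull (canonical_difference \<phi> z) \<zeta>"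
proof -
  obtain f where f [measurable]: "f \<in> borel_measurable (conf \<Otimes>\<^sub>M E)"
    and pd: "\<And>z \<zeta>. process_difference M T \<nu> N \<Phi> z \<zeta> =
       f (add_point (N (fst (fst \<zeta>))) z, (snd (fst \<zeta>), snd \<zeta>)) - f (N (fst (fst \<zeta>)), (snd (fst \<zeta>), snd \<zeta>))"
    and ae: "AE z in E. AE \<zeta> in proc. process_difference M T \<nu> N \<Phi> z \<zeta> = pull (canonical_difference \<phi> z) \<zeta>"
    using process_difference_version[OF assms] by blast
  interpret P: sigma_finite_measure proc
  proof -
    interpret MT: pair_sigma_finite M "time_measure T" ..
    interpret MTn: pair_sigma_finite "M \<Otimes>\<^sub>M time_measure T" \<nu> ..
    show "sigma_finite_measure proc" ..
  qed
  interpret PE: pair_sigma_finite proc E ..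
  interpret EP: pair_sigma_finite E proc ..
  let ?d = "\<lambda>z. pull (canonical_difference \<phi> z)"
  note joint = pull_joint_measurable[OF canonical_difference_joint[OF \<phi>]]
  have m1: "(\<lambda>x. ?d (snd x) (fst x)) \<in> borel_measurable (proc \<Otimes>\<^sub>M E)"
    using joint(2) by (simp add: split_beta')
  have [measurable]: "(\<lambda>x. (snd (fst (fst x)), snd (fst x))) \<in> measurable (proc \<Otimes>\<^sub>M E) E" by measurable
  have m2: "(\<lambda>x. process_difference M T \<nu> N \<Phi> (snd x) (fst x)) \<in> borel_measurable (proc \<Otimes>\<^sub>M E)"
    unfolding pd by measurable
  have S: "{x \<in> space (proc \<Otimes>\<^sub>M E). ?d (snd x) (fst x) = process_difference M T \<nu> N \<Phi> (snd x) (fst x)} \<in> sets (proc \<Otimes>\<^sub>M E)"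
    using m1 m2 by measurable
  have ae': "AE \<zeta> in proc. AE z in E. ?d z \<zeta> = process_difference M T \<nu> N \<Phi> z \<zeta>"
  proof (subst PE.AE_commute[OF S])
    show "AE z in E. AE \<zeta> in proc. ?d z \<zeta> = process_difference M T \<nu> N \<Phi> z \<zeta>"
      using ae by (simp add: eq_commute)
  qed
  have ae'': "AE x in proc \<Otimes>\<^sub>M E. ?d (snd x) (fst x) = process_difference M T \<nu> N \<Phi> (snd x) (fst x)"
    by (rule PE.AE_pair_measure[OF S]) (use ae' in simp)
  let ?spec = "\<lambda>\<Psi>. (\<lambda>(\<zeta>, z). \<Psi> z \<zeta>) \<in> borel_measurable (marked_pred \<Otimes>\<^sub>M E) \<and>
        (AE (\<zeta>, z) in proc \<Otimes>\<^sub>M E. \<Psi> z \<zeta> = process_difference M T \<nu> N \<Phi> z \<zeta>)"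
  define \<Psi> where "\<Psi> = predictable_difference M T \<nu> N \<Phi>"
  have "?spec ?d" using joint(1) ae'' by (simp add: split_beta')
  then have spec: "?spec \<Psi>" unfolding \<Psi>_def predictable_difference_def by (rule someI[where P="?spec"])
  show "\<Psi> z \<in> borel_measurable marked_pred" if "z \<in> space E" for z
    using measurable_compose[OF measurable_Pair2'[OF that] conjunct1[OF spec]] by simp
  have "AE x in proc \<Otimes>\<^sub>M E. \<Psi> (snd x) (fst x) = process_difference M T \<nu> N \<Phi> (snd x) (fst x)"
    using conjunct2[OF spec] by (simp add: split_beta')
  with ae'' have "AE x in proc \<Otimes>\<^sub>M E. \<Psi> (snd x) (fst x) = ?d (snd x) (fst x)"
    by eventually_elim simp
  then have "AE x in distr (E \<Otimes>\<^sub>M proc) (proc \<Otimes>\<^sub>M E) (\<lambda>(x, y). (y, x)). \<Psi> (snd x) (fst x) = ?d (snd x) (fst x)"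
    by (subst (asm) PE.distr_pair_swap)
  then have "AE y in E \<Otimes>\<^sub>M proc. \<Psi> (fst y) (snd y) = ?d (fst y) (snd y)"
    using AE_distrD[OF measurable_pair_swap'] by (fastforce simp: split_beta')
  from EP.AE_pair[OF this] show "AE z in E. AE \<zeta> in proc. \<Psi> z \<zeta> = ?d z \<zeta>" by simp
qed

text \<open>By \<open>compensated_difference\<close> the integral of the difference has the jointly measurable version on
  the right-hand side. So the definition chooses some jointly measurable version, and two such
  versions that agree for almost every point and almost surely agree almost everywhere.\<close>

lemma integral_of_difference_version:
  fixes \<Phi> :: "('w, 'u) sample \<Rightarrow> 'h::{banach, second_countable_topology}"
  assumes \<phi> [measurable]: "\<phi> \<in> borel_measurable marked_canonical" and fin: "L1_norm \<phi> < \<infinity>"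
    and \<Phi>: "AE \<zeta> in proc. \<Phi> \<zeta> = pull \<phi> \<zeta>"
    and d: "AE z in E. L1_norm (canonical_difference \<phi> z) < \<infinity>"
  shows "AE x in M \<Otimes>\<^sub>M E. integral_of_difference M T \<nu> N \<Phi> ((fst x, fst (snd x)), snd (snd x))
    = compensated \<phi> (add_point (N (fst x)) (snd x)) - compensated \<phi> (N (fst x)) - \<phi> ((N (fst x), fst (snd x)), snd (snd x))"
proof -
  let ?\<Psi> = "predictable_difference M T \<nu> N \<Phi>"
  let ?J = "\<lambda>x. compensated \<phi> (add_point (N (fst x)) (snd x)) - compensated \<phi> (N (fst x)) - \<phi> ((N (fst x), fst (snd x)), snd (snd x))"
  have "AE z in E. AE \<omega> in M. stochastic_integral 1 M T \<nu> N (?\<Psi> z) \<omega> = ?J (\<omega>, z)"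
    using d predictable_difference_version(2)[OF \<phi> \<Phi>] AE_space
  proof eventually_elim
    case (elim z)
    note dm = canonical_difference_measurable[OF \<phi> elim(3)]
    have "p_moment 1 proc (?\<Psi> z) = L1_norm (canonical_difference \<phi> z)"
      unfolding L1_norm_eq[OF dm] by (rule p_moment_1_cong_AE[OF elim(2)])
    then have L: "?\<Psi> z \<in> L1_pr"
      using predictable_difference_version(1)[OF \<phi> \<Phi> elim(3)] elim(1) by (simp add: Lp_pr_def)
    from stochastic_integral_compensated[OF L dm elim(2)] compensated_difference[OF \<phi> fin elim(3,1)]
    show ?case by eventually_elim simp
  qed
  note SI = this
  let ?spec = "\<lambda>J. J \<in> borel_measurable proc \<and>
        (AE (t, x) in E. AE \<omega> in M. J ((\<omega>, t), x) = stochastic_integral 1 M T \<nu> N (?\<Psi> (t, x)) \<omega>)"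
  define J where "J = integral_of_difference M T \<nu> N \<Phi>"
  have Jm: "?J \<in> borel_measurable (M \<Otimes>\<^sub>M E)" by measurable
  have "(\<lambda>\<zeta>. (fst (fst \<zeta>), (snd (fst \<zeta>), snd \<zeta>))) \<in> measurable proc (M \<Otimes>\<^sub>M E)" by measurable
  from measurable_compose[OF this Jm]
  have "(\<lambda>\<zeta>. ?J (fst (fst \<zeta>), (snd (fst \<zeta>), snd \<zeta>))) \<in> borel_measurable proc" .
  moreover have "AE z in E. AE \<omega> in M. ?J (\<omega>, z) = stochastic_integral 1 M T \<nu> N (?\<Psi> z) \<omega>"
    using SI by (simp add: eq_commute)
  ultimately have "?spec (\<lambda>\<zeta>. ?J (fst (fst \<zeta>), (snd (fst \<zeta>), snd \<zeta>)))"
    by (simp add: split_beta')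
  then have spec: "?spec J" unfolding J_def integral_of_difference_def by (rule someI[where P="?spec"])
  have "(\<lambda>x. ((fst x, fst (snd x)), snd (snd x))) \<in> measurable (M \<Otimes>\<^sub>M E) proc" by measurable
  from measurable_compose[OF this conjunct1[OF spec]]
  have J'm: "(\<lambda>x. J ((fst x, fst (snd x)), snd (snd x))) \<in> borel_measurable (M \<Otimes>\<^sub>M E)" .
  have S: "{x \<in> space (M \<Otimes>\<^sub>M E). J ((fst x, fst (snd x)), snd (snd x)) = ?J x} \<in> sets (M \<Otimes>\<^sub>M E)"
    using J'm Jm by measurable
  have "AE z in E. AE \<omega> in M. J ((\<omega>, fst z), snd z) = stochastic_integral 1 M T \<nu> N (?\<Psi> z) \<omega>"
    using conjunct2[OF spec] by (simp add: split_beta')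
  with SI have "AE z in E. AE \<omega> in M. J ((\<omega>, fst z), snd z) = ?J (\<omega>, z)"
  proof eventually_elim
    case (elim z)
    then show ?case by eventually_elim simp
  qed
  then have "AE \<omega> in M. AE z in E. J ((\<omega>, fst z), snd z) = ?J (\<omega>, z)"
    by (subst ME.AE_commute) (use S in simp_all)
  then show ?thesis unfolding J_def[symmetric] by (intro ME.AE_pair_measure[OF S]) simp
qed

lemma L1_norm_canonical_difference_finite:
  fixes \<Phi> :: "('w, 'u) sample \<Rightarrow> 'h::{banach, second_countable_topology}"
  assumes \<phi> [measurable]: "\<phi> \<in> borel_measurable marked_canonical"
    and \<Phi>: "AE \<zeta> in proc. \<Phi> \<zeta> = pull \<phi> \<zeta>"
    and fin: "AE z in E. (\<integral>\<^sup>+ \<omega>. \<integral>\<^sup>+ s. \<integral>\<^sup>+ y. ennreal (norm (process_difference M T \<nu> N \<Phi> z ((\<omega>, s), y)))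
         \<partial>\<nu> \<partial>time_measure T \<partial>M) < \<infinity>"
  shows "AE z in E. L1_norm (canonical_difference \<phi> z) < \<infinity>"
proof -
  obtain f where f [measurable]: "f \<in> borel_measurable (conf \<Otimes>\<^sub>M E)"
    and pd: "\<And>z \<zeta>. process_difference M T \<nu> N \<Phi> z \<zeta> =
       f (add_point (N (fst (fst \<zeta>))) z, (snd (fst \<zeta>), snd \<zeta>)) - f (N (fst (fst \<zeta>)), (snd (fst \<zeta>), snd \<zeta>))"
    and ae: "AE z in E. AE \<zeta> in proc. process_difference M T \<nu> N \<Phi> z \<zeta> = pull (canonical_difference \<phi> z) \<zeta>"
    using process_difference_version[OF assms(1,2)] by blast
  show ?thesis
    using fin ae AE_space
  proof eventually_elim
    case (elim z)
    note [measurable] = elim(3)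
    have [measurable]: "(\<lambda>\<zeta>. (snd (fst \<zeta>), snd \<zeta>)) \<in> measurable proc E" by measurable
    have [measurable]: "process_difference M T \<nu> N \<Phi> z \<in> borel_measurable proc"
      unfolding pd[abs_def] by measurable
    have "L1_norm (canonical_difference \<phi> z) = p_moment 1 proc (process_difference M T \<nu> N \<Phi> z)"
      unfolding L1_norm_eq[OF canonical_difference_measurable[OF \<phi> elim(3)]]
      by (rule p_moment_1_cong_AE[OF elim(2), symmetric])
    also have "\<dots> = (\<integral>\<^sup>+ p. \<integral>\<^sup>+ y. ennreal (norm (process_difference M T \<nu> N \<Phi> z (p, y))) \<partial>\<nu> \<partial>(M \<Otimes>\<^sub>M time_measure T))"
      unfolding p_moment_1 by (rule mark.nn_integral_fst[symmetric]) measurable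
    also have "\<dots> = (\<integral>\<^sup>+ \<omega>. \<integral>\<^sup>+ s. \<integral>\<^sup>+ y. ennreal (norm (process_difference M T \<nu> N \<Phi> z ((\<omega>, s), y))) \<partial>\<nu> \<partial>time_measure T \<partial>M)"
      by (rule time.nn_integral_fst[symmetric]) measurable
    also have "\<dots> < \<infinity>" by (rule elim(1))
    finally show ?case .
  qed
qed

theorem commutation:
  fixes \<Phi> :: "('w, 'u) sample \<Rightarrow> 'h::{banach, second_countable_topology}"
  assumes \<Phi>: "\<Phi> \<in> L1_pr"
    and fin: "AE z in E. (\<integral>\<^sup>+ \<omega>. \<integral>\<^sup>+ s. \<integral>\<^sup>+ y. ennreal (norm (process_difference M T \<nu> N \<Phi> z ((\<omega>, s), y)))
         \<partial>\<nu> \<partial>time_measure T \<partial>M) < \<infinity>"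
  shows "AE \<zeta> in proc. difference M E N (stochastic_integral 1 M T \<nu> N \<Phi>) (snd (fst \<zeta>), snd \<zeta>) (fst (fst \<zeta>))
    = integral_of_difference M T \<nu> N \<Phi> \<zeta> + \<Phi> \<zeta>"
proof -
  obtain \<phi> where v: "is_version \<Phi> \<phi>" and s: "L1_norm \<phi> < \<infinity>" using version_exists[OF \<Phi>] by auto
  then have \<phi>: "\<phi> \<in> borel_measurable marked_canonical" by (simp add: is_version_def)
  note eq = is_version_AE[OF v]
  have F: "AE \<omega> in M. stochastic_integral 1 M T \<nu> N \<Phi> \<omega> = compensated \<phi> (N \<omega>)"
    by (rule stochastic_integral_compensated[OF \<Phi> \<phi> eq])
  from AE_procI[OF difference_compensated[OF \<phi> F]]
    AE_procI[OF integral_of_difference_version[OF \<phi> s eq L1_norm_canonical_difference_finite[OF \<phi> eq fin]]] eq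
  show ?thesis by eventually_elim (simp add: split_beta')
qed

end

theorem proposition4p12:
  fixes M :: "'w measure"
    and T :: real
    and \<nu> :: "'u :: {real_inner, banach, second_countable_topology} measure"
    and N :: "'w \<Rightarrow> (real \<times> 'u) measure"
    and X :: "nat \<Rightarrow> 'w \<Rightarrow> real \<times> 'u"
    and \<Phi> :: "('w \<times> real) \<times> 'u \<Rightarrow> 'h :: {real_inner, banach, second_countable_topology}"
  assumes "poisson_setting M \<nu> T N X"
    and "\<Phi> \<in> Lp_pr 1 M T \<nu> N"
    and "AE (t, x) in intensity T \<nu>.
      (\<integral>\<^sup>+ \<omega>. \<integral>\<^sup>+ s. \<integral>\<^sup>+ y. ennreal (norm (process_difference M T \<nu> N \<Phi> (t, x) ((\<omega>, s), y)))
         \<partial>\<nu> \<partial>time_measure T \<partial>M) < \<infinity>"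
  shows "AE ((\<omega>, t), x) in process_measure M T \<nu>.
      difference M (intensity T \<nu>) N (stochastic_integral 1 M T \<nu> N \<Phi>) (t, x) \<omega> =
      integral_of_difference M T \<nu> N \<Phi> ((\<omega>, t), x) + \<Phi> ((\<omega>, t), x)"
proof -
  interpret S: poisson_setting M \<nu> T N X by fact
  interpret time: finite_measure "time_measure T" by (rule finite_time_measure)
  \<comment> \<open>Any partition of the mark space into sets of finite measure provides the exhaustion.\<close>
  obtain U :: "nat \<Rightarrow> 'u set" where U: "range U \<subseteq> sets \<nu>" "(\<Union>m. U m) = space \<nu>"
    "\<And>m. emeasure \<nu> (U m) \<noteq> \<infinity>" "disjoint_family U"
    using S.mark.sigma_finite_disjoint by blast
  have sp: "space \<nu> = UNIV" using sets_eq_imp_space_eq[OF S.sets_mark] by simp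
  have top: "{0..T} \<in> sets (time_measure T)" using sets.top[of "time_measure T"] by simp
  have Um: "U m \<in> sets \<nu>" for m using U by auto
  interpret marked_poisson M T \<nu> U N
  proof unfold_locales
    show "{0..T} \<times> U m \<in> sets (intensity T \<nu>)" for m using top Um by (rule pair_measureI)
    show "disjoint_family (\<lambda>m. {0..T} \<times> U m)" using U(4) by (auto simp: disjoint_family_on_def)
    have "(\<Union>m. {0..T} \<times> U m) = {0..T} \<times> (\<Union>m. U m)" by blast
    then show "(\<Union>m. {0..T} \<times> U m) = space (intensity T \<nu>)"
      unfolding U(2) by (simp add: space_pair_measure)
    show "emeasure (intensity T \<nu>) ({0..T} \<times> U m) < \<infinity>" for m
    proof -
      have "emeasure (time_measure T) {0..T} < \<infinity>" "emeasure \<nu> (U m) < \<infinity>"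
        using time.emeasure_finite[of "{0..T}"] U(3)[of m] by (simp_all add: less_top[symmetric] del: time.emeasure_finite)
      then show ?thesis
        by (simp add: S.mark.emeasure_pair_measure_Times[OF top Um] ennreal_mult_less_top)
    qed
    show "space (intensity T \<nu>) \<noteq> {}" using S.T_pos by (auto simp: space_pair_measure sp)
    show "poisson_random_measure M (intensity T \<nu>) N" by (rule S.poisson)
    show "0 < T" by (rule S.T_pos)
    show "sets \<nu> = sets borel" by (rule S.sets_mark)
    show "U m \<in> sets borel" for m using Um S.sets_mark by simp
    show "emeasure \<nu> (U m) < \<infinity>" for m using U(3)[of m] by (simp add: less_top)
  qed
  have "AE z in intensity T \<nu>. (\<integral>\<^sup>+ \<omega>. \<integral>\<^sup>+ s. \<integral>\<^sup>+ y. ennreal (norm (process_difference M T \<nu> N \<Phi> z ((\<omega>, s), y)))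
         \<partial>\<nu> \<partial>time_measure T \<partial>M) < \<infinity>"
    using assms(3) by (simp add: split_beta')
  from commutation[OF assms(2) this] show ?thesis by (simp add: split_beta')
qed

end
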